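(* Let $(E_i)_{i\in\mathbb{N}}$ be a weight-sparse family of weakly self-dual CSS codes with parameters $[[n(i),1,d(i)]]$, with $d(i)=\Omega(\sqrt{n(i)})$ and with benign distance $\Omega(\sqrt{n(i)})$. For each $i$, let the $i$-th strong trap code be the set of codes $\{V_{i,k}\}_{k\in\mathcal{K}_i}$ encoding $m=1$ qubit with $t=3n(i)-1$ tags, $V_{i,k}:=\pi_k E_i^{\otimes 3}\mathsf{H}_{2n(i)+1}$, where $k$ ranges uniformly over the permutations of $3n(i)$ qubits. Then the strong trap code is strong purity testing with error negligible in $n(i)$: there is a function $\varepsilon(i)$, negligible in $n(i)$, such that for every $i$ the set $\{V_{i,k}\}_{k\in\mathcal{K}_i}$ is strong purity testing with error $\varepsilon(i)$.
   Context: **Codes.** $\mathbb{P}_n$ is the $n$-qubit Pauli group modulo phases. An $[[n,m]]$ code is given by an encoding unitary $V$ sending an $m$-qubit state $\rho$ to $V(\rho\otimes|0^{t}\rangle\langle0^{t}|)V^\dagger$, $t=n-m$; $|x_L\rangle=V|x\rangle|0^t\rangle$ for $x\in\{0,1\}^m$. Decoding applies $V^\dagger$ and measures the tags. The *distance* of the code is the minimum weight of a Pauli $P$ with $P|x_L\rangle=|y_L\rangle$ for some $x\ne y$; an $[[n,m,d]]$ code is an $[[n,m]]$ code of distance $d$. The *benign distance* is the minimum weight of a non-identity Pauli $P$ with $P|x_L\rangle=|x_L\rangle$ for all $x\in\{0,1\}^m$ ($\infty$ if none exists); such a $P$ is called *benign*. **Weakly self-dual CSS codes.** These are the CSS codes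 $CSS(C_1,C_2)$ built from binary linear codes $C_2\subset C_1$ with $C_2=C_1^\perp$: the stabilizer is generated by the $\mathsf{X}$-type Paulis with support given by elements of $C_2$ and the $\mathsf{Z}$-type Paulis with support given by elements of $C_1^\perp=C_2$, with the usual CSS encoding into logical basis states indexed by cosets of $C_2$ in $C_1$. $E_i$ also denotes the (Clifford) encoding unitary of the $i$-th code, with the message in the first qubit and $n(i)-1$ tag qubits. **Negligible.** A function $f(i)$ is negligible in $g(i)$ if for every $c\in\mathbb{N}$ there is $i_0$ such that $f(i)<g(i)^{-c}$ for all $i\ge i_0$. **Weight-sparse.** For non-negative integers $x,y,z$ with $x+y+z\le n(i)$, let $A_i(x,y,z)$ be the set of $n(i)$-qubit Paulis with exactly $x$ factors $\mathsf{X}$, $y$ factors $\mathsf{Y}$ and $z$ factors $\mathsf{Z}$, and $B_i(x,y,z)$ the set of benign Paulis (for $E_i$) in $A_i(x,y,z)$. The family is weight-sparse if $f(i)=\max_{x+y+z\le n(i)}|B_i(x,y,z)|/|A_i(x,y,z)|$ is negligible in $n(i)$. **Strong trap code.** $\mathsf{H}_{2n(i)+1}=\mathsf{I}^{\otimes 2n(i)}\otimes\mathsf{H}\otimes\mathsf{I}^{\otimes(n(i)-1)}$ is a Hadamard on qubit $2n(i)+1$; $E_i^{\otimes3}$ encodes each of three consecutive blocks of $n(i)$ qubits (the first qubit of the first block is the message, the first qubits of the second and third blocks are the $|0\rangle$ and $|+\rangle$ traps, and all qubits other than the message are tags initialized to $|0\rangle$); $\pi_k$ is the unitary permuting the $3n(i)$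 qubits according to $k$. **Strong purity testing.** A set $\{V_k\}_{k\in\mathcal{K}}$ of $[[m+t,m]]$ codes, $k$ uniform, is strong purity testing with error $\varepsilon$ if for every $P_\ell\in\mathbb{P}_{m+t}\setminus\{\mathsf{I}^{\otimes(m+t)}\}$, $$\Pr_k\left[V_k^\dagger P_\ell V_k\in\mathbb{P}_m\otimes\{\mathsf{I},\mathsf{Z}\}^{\otimes t}\right]\le\varepsilon,$$ membership being understood up to phase. *)

theory Defs
  imports
    Complex_Main
    "Jordan_Normal_Form.Schur_Decomposition"
    "HOL-Library.Z2"
    "HOL-Library.Extended_Real"
    "HOL-Library.Landau_Symbols"
    "HOL-Combinatorics.Permutations"
begin

section \<open>Qubits and unitaries\<close>

text \<open>
  An operator on \<open>n\<close> qubits is a \<open>2 ^ n\<close> by \<open>2 ^ n\<close> complex matrix. Qubits are numbered from \<open>0\<close>,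
  and qubit \<open>p\<close> of the basis state with index \<open>a\<close> is the \<open>p\<close>-th most significant of the \<open>n\<close> binary
  digits of \<open>a\<close>; with this convention the Kronecker product below is juxtaposition of registers,
  the left factor acting on the first qubits.
\<close>

definition qubit :: "nat \<Rightarrow> nat \<Rightarrow> nat \<Rightarrow> bool" where
  "qubit n a p \<longleftrightarrow> Bit_Operations.bit a (n - 1 - p)"

definition ket :: "bit vec \<Rightarrow> complex vec" where
  "ket b = vec (2 ^ dim_vec b)
     (\<lambda>a. if \<forall>p<dim_vec b. qubit (dim_vec b) a p \<longleftrightarrow> b $ p = 1 then 1 else 0)"

definition kron :: "complex mat \<Rightarrow> complex mat \<Rightarrow> complex mat" (infixr "\<otimes>\<^sub>k" 70) where
  "A \<otimes>\<^sub>k B = mat (dim_row A * dim_row B) (dim_col A * dim_col B)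
     (\<lambda>(i, j). A $$ (i div dim_row B, j div dim_col B) * B $$ (i mod dim_row B, j mod dim_col B))"

definition unitary_mat :: "nat \<Rightarrow> complex mat \<Rightarrow> bool" where
  "unitary_mat N U \<longleftrightarrow> U \<in> carrier_mat N N \<and>
     mat_adjoint U * U = 1\<^sub>m N \<and> U * mat_adjoint U = 1\<^sub>m N"

definition hadamard :: "complex mat" where
  "hadamard = complex_of_real (1 / sqrt 2) \<cdot>\<^sub>m mat_of_rows_list 2 [[1, 1], [1, -1]]"

text \<open>The content of qubit \<open>p\<close> is moved to qubit \<open>k p\<close>.\<close>

definition permutation_op :: "nat \<Rightarrow> (nat \<Rightarrow> nat) \<Rightarrow> complex mat" where
  "permutation_op n k = mat (2 ^ n) (2 ^ n)
     (\<lambda>(a, b). if \<forall>p<n. qubit n a (k p) \<longleftrightarrow> qubit n b p then 1 else 0)"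


section \<open>The Pauli group modulo phases\<close>

text \<open>
  A class of \<open>n\<close>-qubit Paulis modulo phases is the list of its \<open>n\<close> tensor factors;
  \<open>pauli_mat\<close> picks the representative with phase \<open>1\<close>.
\<close>

datatype pauli = PI | PX | PY | PZ

fun pauli1 :: "pauli \<Rightarrow> complex mat" where
  "pauli1 PI = mat_of_rows_list 2 [[1, 0], [0, 1]]"
| "pauli1 PX = mat_of_rows_list 2 [[0, 1], [1, 0]]"
| "pauli1 PY = mat_of_rows_list 2 [[0, -\<i>], [\<i>, 0]]"
| "pauli1 PZ = mat_of_rows_list 2 [[1, 0], [0, -1]]"

definition pauli_mat :: "pauli list \<Rightarrow> complex mat" where
  "pauli_mat P = foldr (\<lambda>Q A. pauli1 Q \<otimes>\<^sub>k A) P (1\<^sub>m 1)"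

definition paulis :: "nat \<Rightarrow> pauli list set" where
  "paulis n = {P. length P = n}"

definition pauli_id :: "nat \<Rightarrow> pauli list" where
  "pauli_id n = replicate n PI"

definition pauli_weight :: "pauli list \<Rightarrow> nat" where
  "pauli_weight P = length (filter (\<lambda>Q. Q \<noteq> PI) P)"

definition eq_up_to_phase :: "complex mat \<Rightarrow> complex mat \<Rightarrow> bool" where
  "eq_up_to_phase A B \<longleftrightarrow> (\<exists>c. cmod c = 1 \<and> A = c \<cdot>\<^sub>m B)"

definition clifford :: "nat \<Rightarrow> complex mat \<Rightarrow> bool" where
  "clifford n U \<longleftrightarrow> unitary_mat (2 ^ n) U \<and>
     (\<forall>P\<in>paulis n. \<exists>Q\<in>paulis n. eq_up_to_phase (U * pauli_mat P * mat_adjoint U) (pauli_mat Q))"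


section \<open>Codes\<close>

definition is_code :: "nat \<Rightarrow> nat \<Rightarrow> complex mat \<Rightarrow> bool" where
  "is_code n m V \<longleftrightarrow> m \<le> n \<and> unitary_mat (2 ^ n) V"

definition logical_state :: "nat \<Rightarrow> nat \<Rightarrow> complex mat \<Rightarrow> bit vec \<Rightarrow> complex vec" where
  "logical_state n m V x = V *\<^sub>v ket (x @\<^sub>v 0\<^sub>v (n - m))"

text \<open>
  Paulis being taken modulo phases, \<open>P |x\<^sub>L\<rangle> = |y\<^sub>L\<rangle>\<close> is asked of some representative of the class.
  For a benign Pauli one and the same representative has to fix all \<open>|x\<^sub>L\<rangle>\<close>, so that a logical
  \<open>Z\<close> is not benign.
\<close>

definition code_distance :: "nat \<Rightarrow> nat \<Rightarrow> complex mat \<Rightarrow> enat" where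
  "code_distance n m V = Inf {enat (pauli_weight P) | P. P \<in> paulis n \<and>
     (\<exists>x\<in>carrier_vec m. \<exists>y\<in>carrier_vec m. x \<noteq> y \<and>
       (\<exists>c. cmod c = 1 \<and>
         (c \<cdot>\<^sub>m pauli_mat P) *\<^sub>v logical_state n m V x = logical_state n m V y))}"

definition benign :: "nat \<Rightarrow> nat \<Rightarrow> complex mat \<Rightarrow> pauli list \<Rightarrow> bool" where
  "benign n m V P \<longleftrightarrow> P \<in> paulis n \<and> P \<noteq> pauli_id n \<and>
     (\<exists>c. cmod c = 1 \<and> (\<forall>x\<in>carrier_vec m.
         (c \<cdot>\<^sub>m pauli_mat P) *\<^sub>v logical_state n m V x = logical_state n m V x))"

definition benign_distance :: "nat \<Rightarrow> nat \<Rightarrow> complex mat \<Rightarrow> enat" where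
  "benign_distance n m V = Inf {enat (pauli_weight P) | P. benign n m V P}"


section \<open>Weakly self-dual CSS codes\<close>

definition linear_code :: "nat \<Rightarrow> bit vec set \<Rightarrow> bool" where
  "linear_code n C \<longleftrightarrow> VectorSpace.subspace class_ring C (module_vec TYPE(bit) n)"

definition dual_code :: "nat \<Rightarrow> bit vec set \<Rightarrow> bit vec set" where
  "dual_code n C = {v \<in> carrier_vec n. \<forall>u\<in>C. u \<bullet> v = 0}"

definition coset :: "bit vec set \<Rightarrow> bit vec \<Rightarrow> bit vec set" where
  "coset C v = (\<lambda>c. v + c) ` C"

definition coset_state :: "nat \<Rightarrow> bit vec set \<Rightarrow> complex vec" where
  "coset_state n S = vec (2 ^ n) (\<lambda>a. (\<Sum>u\<in>S. ket u $ a) / complex_of_real (sqrt (card S)))"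

definition X_type :: "bit vec \<Rightarrow> pauli list" where
  "X_type u = map (\<lambda>p. if u $ p = 1 then PX else PI) [0..<dim_vec u]"

definition Z_type :: "bit vec \<Rightarrow> pauli list" where
  "Z_type u = map (\<lambda>p. if u $ p = 1 then PZ else PI) [0..<dim_vec u]"

text \<open>
  \<open>E\<close> is a Clifford encoding unitary of \<open>CSS(C\<^sub>1, C\<^sub>2)\<close> with \<open>m\<close> logical qubits: the \<open>2 ^ m\<close> logical
  basis states are the uniform superpositions over the cosets of \<open>C\<^sub>2\<close> in \<open>C\<^sub>1\<close>, in any order. The
  bijection forces \<open>dim C\<^sub>1 - dim C\<^sub>2 = m\<close>, so that the code space is the one stabilized by
  \<open>css_generators\<close> (with sign \<open>+\<close>); see \<open>css_generator_fixes_logical_state\<close> below. On the other basis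
  states \<open>E\<close> is only constrained by being Clifford.
\<close>

definition css_generators :: "nat \<Rightarrow> bit vec set \<Rightarrow> bit vec set \<Rightarrow> pauli list set" where
  "css_generators n C1 C2 = X_type ` C2 \<union> Z_type ` dual_code n C1"

definition css_encoding ::
  "nat \<Rightarrow> nat \<Rightarrow> bit vec set \<Rightarrow> bit vec set \<Rightarrow> complex mat \<Rightarrow> bool" where
  "css_encoding n m C1 C2 E \<longleftrightarrow>
     is_code n m E \<and> clifford n E \<and>
     linear_code n C1 \<and> linear_code n C2 \<and> C2 \<subseteq> C1 \<and>
     (\<exists>K. bij_betw K (carrier_vec m) (coset C2 ` C1) \<and>
       (\<forall>x\<in>carrier_vec m. logical_state n m E x = coset_state n (K x)))"

definition weakly_self_dual_css ::
  "nat \<Rightarrow> nat \<Rightarrow> bit vec set \<Rightarrow> bit vec set \<Rightarrow> complex mat \<Rightarrow> bool" where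
  "weakly_self_dual_css n m C1 C2 E \<longleftrightarrow> css_encoding n m C1 C2 E \<and> C2 = dual_code n C1"


section \<open>Asymptotics\<close>

definition negligible_in :: "(nat \<Rightarrow> real) \<Rightarrow> (nat \<Rightarrow> nat) \<Rightarrow> bool" where
  "negligible_in f n \<longleftrightarrow> (\<forall>c::nat. \<exists>i0. \<forall>i\<ge>i0. f i < 1 / real (n i) ^ c)"

text \<open>
  \<open>\<Omega>\<close> for sequences that may take the value \<open>\<infinity>\<close>, as the benign distance does; the \<open>\<Omega>\<close> of
  \<^theory>\<open>HOL-Library.Landau_Symbols\<close> is for functions into a normed field.
\<close>

definition enat_bigomega :: "(nat \<Rightarrow> enat) \<Rightarrow> (nat \<Rightarrow> real) \<Rightarrow> bool" where
  "enat_bigomega f g \<longleftrightarrow>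
     (\<exists>c>0. \<forall>\<^sub>F i in sequentially. ereal (c * \<bar>g i\<bar>) \<le> ereal_of_enat (f i))"

definition paulis_of_type :: "nat \<Rightarrow> nat \<Rightarrow> nat \<Rightarrow> nat \<Rightarrow> pauli list set" where
  "paulis_of_type n x y z =
     {P \<in> paulis n. count_list P PX = x \<and> count_list P PY = y \<and> count_list P PZ = z}"

definition benign_of_type ::
  "nat \<Rightarrow> nat \<Rightarrow> complex mat \<Rightarrow> nat \<Rightarrow> nat \<Rightarrow> nat \<Rightarrow> pauli list set" where
  "benign_of_type n m V x y z = {P \<in> paulis_of_type n x y z. benign n m V P}"

definition max_benign_fraction :: "nat \<Rightarrow> nat \<Rightarrow> complex mat \<Rightarrow> real" where
  "max_benign_fraction n m V =
     Max {real (card (benign_of_type n m V x y z)) / real (card (paulis_of_type n x y z))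
          | x y z. x + y + z \<le> n}"

definition weight_sparse :: "(nat \<Rightarrow> nat) \<Rightarrow> nat \<Rightarrow> (nat \<Rightarrow> complex mat) \<Rightarrow> bool" where
  "weight_sparse n m E \<longleftrightarrow> negligible_in (\<lambda>i. max_benign_fraction (n i) m (E i)) n"


section \<open>Strong purity testing and the strong trap code\<close>

definition strong_purity_testing ::
  "nat \<Rightarrow> nat \<Rightarrow> 'k set \<Rightarrow> ('k \<Rightarrow> complex mat) \<Rightarrow> real \<Rightarrow> bool" where
  "strong_purity_testing m t K V \<epsilon> \<longleftrightarrow>
     finite K \<and> K \<noteq> {} \<and> (\<forall>k\<in>K. is_code (m + t) m (V k)) \<and>
     (\<forall>P \<in> paulis (m + t) - {pauli_id (m + t)}.
        real (card {k \<in> K. \<exists>Q\<in>paulis m. \<exists>R\<in>paulis t. set R \<subseteq> {PI, PZ} \<and>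
          eq_up_to_phase (mat_adjoint (V k) * pauli_mat P * V k) (pauli_mat (Q @ R))})
        / real (card K) \<le> \<epsilon>)"

text \<open>The Hadamard acts on the first qubit of the third block.\<close>

definition strong_trap_code :: "nat \<Rightarrow> complex mat \<Rightarrow> (nat \<Rightarrow> nat) \<Rightarrow> complex mat" where
  "strong_trap_code n E k =
     permutation_op (3 * n) k * (E \<otimes>\<^sub>k E \<otimes>\<^sub>k E) *
     (1\<^sub>m (2 ^ (2 * n)) \<otimes>\<^sub>k hadamard \<otimes>\<^sub>k 1\<^sub>m (2 ^ (n - 1)))"


section \<open>The stabilizer generators of a CSS code fix its logical states\<close>

lemma linear_codeD:
  assumes "linear_code n C"
  shows "C \<subseteq> carrier_vec n" "0\<^sub>v n \<in> C" "\<And>u v. u \<in> C \<Longrightarrow> v \<in> C \<Longrightarrow> u + v \<in> C"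
  using assms unfolding linear_code_def VectorSpace.subspace_def submodule_def
  by (auto simp: module_vec_def)

lemma pauli1_dim [simp]: "dim_row (pauli1 Q) = 2" "dim_col (pauli1 Q) = 2"
  by (cases Q; simp add: mat_of_rows_list_def)+

lemma pauli_mat_dim [simp]:
  "dim_row (pauli_mat P) = 2 ^ length P" "dim_col (pauli_mat P) = 2 ^ length P"
  by (induction P) (simp_all add: pauli_mat_def kron_def)

lemma pauli_mat_index:
  assumes "a < 2 ^ length P" "b < 2 ^ length P"
  shows "pauli_mat P $$ (a, b) = (\<Prod>p<length P.
    pauli1 (P ! p) $$ (of_bool (qubit (length P) a p), of_bool (qubit (length P) b p)))"
  using assms
proof (induction P arbitrary: a b)
  case Nil
  then show ?case by (simp add: pauli_mat_def)
next
  case (Cons Q P)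
  let ?n = "length P"
  have top: "c div 2 ^ ?n = of_bool (qubit (Suc ?n) c 0)" if "c < 2 ^ Suc ?n" for c :: nat
  proof -
    have "c div 2 ^ ?n < 2" using that by (simp add: less_mult_imp_div_less)
    then show ?thesis by (auto simp: qubit_def bit_iff_odd less_2_cases_iff)
  qed
  have low: "qubit (Suc ?n) c (Suc p) = qubit ?n (c mod 2 ^ ?n) p" if "p < ?n" for c p
    using that unfolding qubit_def
    by (auto simp: bit_take_bit_iff simp flip: take_bit_eq_mod)
  have "pauli_mat (Q # P) $$ (a, b) =
      pauli1 Q $$ (a div 2 ^ ?n, b div 2 ^ ?n) * pauli_mat P $$ (a mod 2 ^ ?n, b mod 2 ^ ?n)"
    using Cons.prems pauli_mat_dim[of P] by (simp add: pauli_mat_def kron_def)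
  also have "pauli_mat P $$ (a mod 2 ^ ?n, b mod 2 ^ ?n) = (\<Prod>p<?n.
      pauli1 (P ! p) $$ (of_bool (qubit (Suc ?n) a (Suc p)), of_bool (qubit (Suc ?n) b (Suc p))))"
    by (subst Cons.IH) (simp_all add: low)
  finally show ?case
    using Cons.prems
    by (simp add: top prod.lessThan_Suc_shift del: power_Suc prod.lessThan_Suc split del: if_split)
qed

lemma ket_eq_unit_vec:
  obtains b where "b < 2 ^ dim_vec v" "ket v = unit_vec (2 ^ dim_vec v) b"
    "\<And>p. p < dim_vec v \<Longrightarrow> qubit (dim_vec v) b p \<longleftrightarrow> v $ p = 1"
proof -
  let ?n = "dim_vec v"
  define xs where "xs = map (\<lambda>j. v $ (?n - 1 - j) = 1) [0..<?n]"
  define b :: nat where "b = horner_sum of_bool 2 xs"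
  have b: "b < 2 ^ ?n" unfolding b_def
    using horner_sum_of_bool_2_less[of xs] by (simp add: xs_def)
  have q: "qubit ?n b p \<longleftrightarrow> v $ p = 1" if "p < ?n" for p
    using that by (simp add: qubit_def b_def bit_horner_sum_bit_iff xs_def)
  have inj: "a = b" if "a < 2 ^ ?n" "\<forall>p<?n. qubit ?n a p \<longleftrightarrow> v $ p = 1" for a
  proof (rule bit_eqI)
    fix j
    show "bit a j = bit b j"
    proof (cases "j < ?n")
      case True
      then have "qubit ?n a (?n - 1 - j) = qubit ?n b (?n - 1 - j)" using that(2) q by auto
      with True show ?thesis by (simp add: qubit_def)
    next
      case False
      have "take_bit ?n a = a" "take_bit ?n b = b"
        using that(1) b by (simp_all add: take_bit_nat_eq_self)
      with False show ?thesis by (metis bit_take_bit_iff)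
    qed
  qed
  have "ket v = unit_vec (2 ^ ?n) b"
  proof (rule eq_vecI)
    fix a assume "a < dim_vec (unit_vec (2 ^ ?n) b :: complex vec)"
    then have "a < 2 ^ ?n" by simp
    moreover from this have "(\<forall>p<?n. qubit ?n a p \<longleftrightarrow> v $ p = 1) \<longleftrightarrow> a = b"
      using inj q by metis
    ultimately show "ket v $ a = unit_vec (2 ^ ?n) b $ a"
      by (simp add: ket_def unit_vec_def)
  qed (simp add: ket_def)
  from that[OF b this q] show ?thesis .
qed

lemma pauli_mat_mult_ket:
  assumes "length P = dim_vec v" "a < 2 ^ dim_vec v"
  shows "(pauli_mat P *\<^sub>v ket v) $ a = (\<Prod>p<dim_vec v.
    pauli1 (P ! p) $$ (of_bool (qubit (dim_vec v) a p), of_bool (v $ p = 1)))"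
proof -
  obtain b where b: "b < 2 ^ dim_vec v" "ket v = unit_vec (2 ^ dim_vec v) b"
    "\<And>p. p < dim_vec v \<Longrightarrow> qubit (dim_vec v) b p \<longleftrightarrow> v $ p = 1"
    using ket_eq_unit_vec[of v] by blast
  have "(pauli_mat P *\<^sub>v ket v) $ a = pauli_mat P $$ (a, b)"
    using assms b by (simp add: scalar_prod_right_unit)
  with assms b show ?thesis by (simp add: pauli_mat_index)
qed

lemma X_type_mult_ket:
  assumes "u \<in> carrier_vec n" "v \<in> carrier_vec n"
  shows "pauli_mat (X_type u) *\<^sub>v ket v = ket (v + u)"
proof (rule eq_vecI)
  fix a assume "a < dim_vec (ket (v + u))"
  with assms have a: "a < 2 ^ n" by (simp add: ket_def)
  have "(pauli_mat (X_type u) *\<^sub>v ket v) $ a = (\<Prod>p<n. of_bool (qubit n a p \<longleftrightarrow> (v + u) $ p = 1))"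
    using assms a
    by (subst pauli_mat_mult_ket) (auto simp: X_type_def mat_of_rows_list_def intro!: prod.cong)
  also have "\<dots> = ket (v + u) $ a"
    using assms a by (auto simp: ket_def intro!: prod.neutral)
  finally show "(pauli_mat (X_type u) *\<^sub>v ket v) $ a = ket (v + u) $ a" .
qed (use assms in \<open>simp add: ket_def X_type_def\<close>)


lemma Z_type_mult_ket:
  assumes "u \<in> carrier_vec n" "v \<in> carrier_vec n" "v \<bullet> u = 0"
  shows "pauli_mat (Z_type u) *\<^sub>v ket v = ket v"
proof (rule eq_vecI)
  fix a assume "a < dim_vec (ket v)"
  with assms have a: "a < 2 ^ n" by (simp add: ket_def)
  have sign: "(\<Prod>p\<in>I. if v $ p = 1 \<and> u $ p = 1 then - 1 else 1) =
      (if (\<Sum>p\<in>I. v $ p * u $ p) = 0 then 1 else (- 1 :: complex))" if "finite I" for I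
    using that by (induction I rule: finite_induct) auto
  have "(pauli_mat (Z_type u) *\<^sub>v ket v) $ a = (\<Prod>p<n.
      if qubit n a p \<longleftrightarrow> v $ p = 1 then if v $ p = 1 \<and> u $ p = 1 then - 1 else 1 else 0)"
    using assms a
    by (subst pauli_mat_mult_ket) (auto simp: Z_type_def mat_of_rows_list_def intro!: prod.cong)
  also have "\<dots> = (\<Prod>p<n. of_bool (qubit n a p \<longleftrightarrow> v $ p = 1)) *
      (\<Prod>p<n. if v $ p = 1 \<and> u $ p = 1 then - 1 else 1)"
    by (subst prod.distrib[symmetric], rule prod.cong) auto
  also have "(\<Prod>p<n. if v $ p = 1 \<and> u $ p = 1 then - 1 else 1) = (1 :: complex)"
    using sign[of "{..<n}"] assms by (simp add: scalar_prod_def atLeast0LessThan)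
  also have "(\<Prod>p<n. of_bool (qubit n a p \<longleftrightarrow> v $ p = 1)) * 1 =
      (\<Prod>p<n. of_bool (qubit n a p \<longleftrightarrow> v $ p = 1) :: complex)"
    by simp
  also have "\<dots> = ket v $ a"
    using assms a by (auto simp: ket_def intro!: prod.neutral)
  finally show "(pauli_mat (Z_type u) *\<^sub>v ket v) $ a = ket v $ a" .
qed (use assms in \<open>simp add: ket_def Z_type_def\<close>)

lemma pauli_mat_mult_coset_state:
  assumes "length P = n" "S \<subseteq> carrier_vec n" "bij_betw f S S"
    "\<And>v. v \<in> S \<Longrightarrow> pauli_mat P *\<^sub>v ket v = ket (f v)"
  shows "pauli_mat P *\<^sub>v coset_state n S = coset_state n S"
proof (rule eq_vecI)
  fix a assume "a < dim_vec (coset_state n S)"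
  then have a: "a < 2 ^ n" by (simp add: coset_state_def)
  let ?r = "complex_of_real (sqrt (card S))"
  have "(pauli_mat P *\<^sub>v coset_state n S) $ a =
      (\<Sum>b<2 ^ n. \<Sum>v\<in>S. pauli_mat P $$ (a, b) * ket v $ b) / ?r"
    using assms(1) a
    by (simp add: coset_state_def scalar_prod_def sum_distrib_left sum_divide_distrib atLeast0LessThan)
  also have "\<dots> = (\<Sum>v\<in>S. \<Sum>b<2 ^ n. pauli_mat P $$ (a, b) * ket v $ b) / ?r"
    by (subst sum.swap) simp
  also have "\<dots> = (\<Sum>v\<in>S. (pauli_mat P *\<^sub>v ket v) $ a) / ?r"
    using assms(1,2) a
    by (intro arg_cong[where f = "\<lambda>s. s / ?r"] sum.cong refl)
      (auto simp: scalar_prod_def ket_def atLeast0LessThan intro!: sum.cong)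
  also have "\<dots> = (\<Sum>v\<in>S. ket (f v) $ a) / ?r"
    using assms(4) by simp
  also have "\<dots> = coset_state n S $ a"
    using a sum.reindex_bij_betw[OF assms(3), of "\<lambda>v. ket v $ a"] by (simp add: coset_state_def)
  finally show "(pauli_mat P *\<^sub>v coset_state n S) $ a = coset_state n S $ a" .
qed (use assms in \<open>simp add: coset_state_def\<close>)

lemma css_generator_fixes_logical_state:
  assumes css: "css_encoding n m C1 C2 E" and P: "P \<in> css_generators n C1 C2"
    and x: "x \<in> carrier_vec m"
  shows "pauli_mat P *\<^sub>v logical_state n m E x = logical_state n m E x"
proof -
  from css obtain K where K: "bij_betw K (carrier_vec m) (coset C2 ` C1)"
    "\<And>x. x \<in> carrier_vec m \<Longrightarrow> logical_state n m E x = coset_state n (K x)"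
    unfolding css_encoding_def by auto
  with x obtain w where w: "w \<in> C1" "logical_state n m E x = coset_state n (coset C2 w)"
    using bij_betwE[OF K(1)] by fastforce
  note C1 = linear_codeD[of n C1] and C2 = linear_codeD[of n C2]
  have lin: "linear_code n C1" "linear_code n C2" "C2 \<subseteq> C1"
    using css unfolding css_encoding_def by auto
  have sub: "coset C2 w \<subseteq> C1"
    using lin w C1(3) by (auto simp: coset_def)
  have carr: "coset C2 w \<subseteq> carrier_vec n"
    using sub C1(1) lin by auto
  from P consider u where "u \<in> C2" "P = X_type u" | u where "u \<in> dual_code n C1" "P = Z_type u"
    unfolding css_generators_def by auto
  then have "pauli_mat P *\<^sub>v coset_state n (coset C2 w) = coset_state n (coset C2 w)"
  proof cases
    case 1
    have u: "u \<in> carrier_vec n" using 1 C2(1) lin by auto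
    have wc: "w \<in> carrier_vec n" using w C1(1) lin by auto
    have twice: "v + u + u = v" if "v \<in> carrier_vec n" for v
      using that u by (intro eq_vecI) auto
    have shift: "v + u \<in> coset C2 w" if "v \<in> coset C2 w" for v
    proof -
      from that obtain c where c: "c \<in> C2" "v = w + c" by (auto simp: coset_def)
      moreover have "c \<in> carrier_vec n" using c C2(1) lin by auto
      ultimately have "v + u = w + (c + u)" using u wc by simp
      then show ?thesis using c 1 C2(3) lin by (auto simp: coset_def)
    qed
    have "bij_betw (\<lambda>v. v + u) (coset C2 w) (coset C2 w)"
      by (rule bij_betw_byWitness[where f' = "\<lambda>v. v + u"]) (use twice shift carr in auto)
    then show ?thesis
      using u carr 1(2) X_type_mult_ket[OF u]
      by (intro pauli_mat_mult_coset_state) (auto simp: X_type_def)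
  next
    case 2
    then have u: "u \<in> carrier_vec n" "\<And>v. v \<in> C1 \<Longrightarrow> v \<bullet> u = 0" by (auto simp: dual_code_def)
    have "pauli_mat P *\<^sub>v ket v = ket (id v)" if "v \<in> coset C2 w" for v
      using that carr sub u(2) 2(2) Z_type_mult_ket[OF u(1), of v] by auto
    moreover have "length P = n" using u 2(2) by (simp add: Z_type_def)
    ultimately show ?thesis
      using carr by (intro pauli_mat_mult_coset_state[where f = id]) auto
  qed
  with w show ?thesis by simp
qed

end

theory Submission
  imports Defs "HOL-Combinatorics.Multiset_Permutations" "HOL-Real_Asymp.Real_Asymp"
begin

text \<open>
  Write a Pauli as a pair \<open>(x, z)\<close> of binary vectors. A permuted Pauli passes the test only if its
  three blocks satisfy \<open>x, z \<in> C1\<close> in the first block, \<open>x \<in> C2, z \<in> C1\<close> in the second and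
  \<open>x \<in> C1, z \<in> C2\<close> in the third. Since \<open>C2\<close> is the dual of \<open>C1\<close> and has index 2 in it, the all-ones
  vector represents the nontrivial coset. Hence the second block is benign up to a factor \<open>Z\<^sup>n\<close>, or
  it is \<open>I\<^sup>n\<close> or \<open>Z\<^sup>n\<close>; likewise the third block with \<open>X\<^sup>n\<close>. Conditioned on its type, each block is
  uniformly distributed, so weight sparsity makes the benign cases negligible. If the second and third
  blocks are constant with different letters, they are one of at least \<open>2\<^sup>n\<close> equally likely
  arrangements. If both are the identity, the whole error sits in the first block, has weight at
  least the distance or the benign distance, and \<open>w\<close> errors all fall into the first third of the
  positions with probability at most \<open>2\<^sup>-\<^sup>w\<close>.

  Block lengths need not tend to infinity. A code of length \<open>n > 1\<close> has a benign Pauli, so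
  sparsity excludes bounded lengths other than \<open>1\<close>; for length \<open>1\<close> an error
  below \<open>1\<close> suffices.
\<close>

section \<open>Random permutations of a list\<close>

text \<open>The claim is an upper bound, so only necessary conditions for escaping detection are
  derived. They come from letting both sides of the conjugation identity act on logical basis
  states, the states on which the CSS property describes \<open>E\<close>. The blocks of a random
  arrangement are dependent, and the type of a block is itself random. Both difficulties disappear
  once all letters outside one block are fixed: inside it the arrangements of a single multiset
  remain equally likely, so a bound uniform in the type carries over with no sum over types. This is
  where the maximum in weight sparsity enters. The code distance counts only operators that change
  the logical label and thus says nothing directly about a logical \<open>Z\<close> of low weight;
  weak self-duality does, as the X-type Pauli with the same support is logical too. The error is the
  worst case over the finitely many Paulis instead of an explicit formula, so that the strict bound
  below \<open>1\<close> at length \<open>1\<close> and the asymptotic bound at other lengths apply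
  to the same function.\<close>

lemma card_permute_list_vimage:
  "card {k. k permutes {..<length xs} \<and> permute_list k xs \<in> S} *
     card (permutations_of_multiset (mset xs)) =
   fact (length xs) * card (S \<inter> permutations_of_multiset (mset xs))"
proof -
  let ?n = "length xs"
  let ?K = "{k. k permutes {..<?n}}"
  let ?A = "permutations_of_multiset (mset xs)"
  define F where "F ys = {k \<in> ?K. permute_list k xs = ys}" for ys
  have fin: "finite ?K" by (simp add: finite_permutations)
  \<comment> \<open>Composition on the right with a fixed \<open>h\<close> that sends
    \<open>xs\<close> to \<open>ys\<close> carries the stabilizer of \<open>xs\<close> onto the
    fibre over \<open>ys\<close>, so all arrangements are hit equally often.\<close>
  have c: "card (F ys) = card (F xs)" if ys: "ys \<in> ?A" for ys
  proof -
    have "mset ys = mset xs" using ys by (simp add: permutations_of_multisetD)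
    then obtain h where h: "h permutes {..<?n}" "permute_list h xs = ys"
      by (rule mset_eq_permutation)
    have len: "length ys = ?n" using h(2) by auto
    have "bij_betw (\<lambda>k. k \<circ> h) (F xs) (F ys)"
    proof (rule bij_betw_byWitness[where f' = "\<lambda>k. k \<circ> inv_into UNIV h"])
      show "\<forall>k\<in>F xs. (k \<circ> h) \<circ> inv_into UNIV h = k"
        using h(1) by (auto simp: permutes_inv_o o_assoc[symmetric])
      show "\<forall>k\<in>F ys. (k \<circ> inv_into UNIV h) \<circ> h = k"
        using h(1) by (auto simp: permutes_inv_o o_assoc[symmetric])
      show "(\<lambda>k. k \<circ> h) ` F xs \<subseteq> F ys"
        using h by (auto simp: F_def permutes_compose permute_list_compose)
      have "permute_list (k \<circ> inv_into UNIV h) xs = xs" if "k \<in> F ys" for k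
      proof -
        have "permute_list (k \<circ> inv_into UNIV h) xs = permute_list (inv_into UNIV h) ys"
          using that h by (auto simp: F_def permute_list_compose permutes_inv)
        also have "\<dots> = permute_list (h \<circ> inv_into UNIV h) xs"
          using h by (simp add: permute_list_compose permutes_inv)
        finally show ?thesis using h(1) by (simp add: permutes_inv_o)
      qed
      then show "(\<lambda>k. k \<circ> inv_into UNIV h) ` F ys \<subseteq> F xs"
        using h by (auto simp: F_def permutes_compose permutes_inv)
    qed
    then show ?thesis by (simp add: bij_betw_same_card)
  qed
  have count: "card {k \<in> ?K. permute_list k xs \<in> T} = card (T \<inter> ?A) * card (F xs)" for T
  proof -
    have "{k \<in> ?K. permute_list k xs \<in> T} = (\<Union>ys \<in> T \<inter> ?A. F ys)"
      by (auto simp: F_def permutations_of_multiset_def)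
    also have "card \<dots> = (\<Sum>ys \<in> T \<inter> ?A. card (F ys))"
      using fin by (intro card_UN_disjoint) (auto simp: F_def)
    also have "\<dots> = card (T \<inter> ?A) * card (F xs)" using c by simp
    finally show ?thesis .
  qed
  have "fact ?n = card ?A * card (F xs)"
    using count[of UNIV] card_permutations[of "{..<?n}" ?n] by simp
  then show ?thesis using count[of S] by simp
qed

text \<open>Once the letters outside the block are fixed, the block runs through all arrangements of
  one multiset of size \<open>q\<close>. The hypothesis bounds the share of \<open>S\<close> in
  every such fibre, and summing over fibres requires no knowledge of how the block types are
  distributed.\<close>

lemma card_permutations_of_multiset_block_le:
  fixes f :: real
  assumes size: "p + q \<le> size M"
    and S: "\<And>N. size N = q \<Longrightarrow>
      real (card (S \<inter> permutations_of_multiset N)) \<le> f * real (card (permutations_of_multiset N))"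
  shows "real (card {L \<in> permutations_of_multiset M. take q (drop p L) \<in> S}) \<le>
    f * real (card (permutations_of_multiset M))"
proof -
  let ?A = "permutations_of_multiset M"
  define g where "g L = (take p L, drop (p + q) L)" for L :: "'a list"
  have card_eq: "real (card {L \<in> ?A. P L}) =
      (\<Sum>y\<in>g ` ?A. real (card {L \<in> ?A. g L = y \<and> P L}))" for P
  proof -
    have "real (card {L \<in> ?A. P L}) = (\<Sum>L\<in>?A. of_bool (P L))"
      by (simp add: Int_def)
    also have "\<dots> = (\<Sum>y\<in>g ` ?A. \<Sum>L\<in>{L \<in> ?A. g L = y}. of_bool (P L))"
      by (rule sum.image_gen) simp
    also have "\<dots> = (\<Sum>y\<in>g ` ?A. real (card {L \<in> ?A. g L = y \<and> P L}))"
      by (intro sum.cong refl) (simp add: Int_def conj_assoc)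
    finally show ?thesis .
  qed
  have fibre: "real (card {L \<in> ?A. g L = y \<and> take q (drop p L) \<in> S}) \<le>
      f * real (card {L \<in> ?A. g L = y \<and> True})" if y: "y \<in> g ` ?A" for y
  proof -
    obtain L0 where L0: "L0 \<in> ?A" "y = g L0" using y by auto
    define N where "N = mset (take q (drop p L0))"
    have split: "L = take p L @ take q (drop p L) @ drop (p + q) L" for L :: "'a list"
      by (metis append_take_drop_id drop_drop add.commute)
    have len: "length L = size M" if "L \<in> ?A" for L
      using that by (auto simp: permutations_of_multiset_def)
    have M: "M = mset (take p L0) + N + mset (drop (p + q) L0)"
      using L0(1) split[of L0] unfolding N_def
      by (metis mset_append permutations_of_multisetD add.assoc)
    have sN: "size N = q" using len[OF L0(1)] size by (simp add: N_def)
    \<comment> \<open>Left open in \<open>T\<close>: \<open>S\<close> gives the numerator and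
      \<open>UNIV\<close> the size of the whole fibre.\<close>
    have bij: "bij_betw (\<lambda>B. take p L0 @ B @ drop (p + q) L0)
        {B \<in> permutations_of_multiset N. B \<in> T}
        {L \<in> ?A. g L = y \<and> take q (drop p L) \<in> T}" for T
    proof (rule bij_betw_byWitness[where f' = "\<lambda>L. take q (drop p L)"])
      have lp: "length (take p L0) = p" using len[OF L0(1)] size by simp
      have lB: "length B = q" if "B \<in> permutations_of_multiset N" for B
        using that sN by (auto simp: permutations_of_multiset_def)
      show "\<forall>B\<in>{B \<in> permutations_of_multiset N. B \<in> T}.
          take q (drop p (take p L0 @ B @ drop (p + q) L0)) = B"
        using lp lB by (auto simp del: length_take)
      show "\<forall>L\<in>{L \<in> ?A. g L = y \<and> take q (drop p L) \<in> T}.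
          take p L0 @ take q (drop p L) @ drop (p + q) L0 = L"
        using L0(2) split by (auto simp: g_def) (metis split)
      show "(\<lambda>B. take p L0 @ B @ drop (p + q) L0) ` {B \<in> permutations_of_multiset N. B \<in> T}
          \<subseteq> {L \<in> ?A. g L = y \<and> take q (drop p L) \<in> T}"
        using lp lB L0(2) M by (auto simp: g_def permutations_of_multiset_def simp del: length_take)
      show "(\<lambda>L. take q (drop p L)) ` {L \<in> ?A. g L = y \<and> take q (drop p L) \<in> T}
          \<subseteq> {B \<in> permutations_of_multiset N. B \<in> T}"
      proof (rule image_subsetI)
        fix L assume "L \<in> {L \<in> ?A. g L = y \<and> take q (drop p L) \<in> T}"
        then have L: "L \<in> ?A" "g L = y" "take q (drop p L) \<in> T" by auto
        have "M = mset (take p L0) + mset (take q (drop p L)) + mset (drop (p + q) L0)"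
          using L L0(2) split[of L] unfolding g_def
          by (metis mset_append permutations_of_multisetD add.assoc prod.inject)
        with M L(3) show "take q (drop p L) \<in> {B \<in> permutations_of_multiset N. B \<in> T}"
          by (simp add: permutations_of_multiset_def)
      qed
    qed
    show ?thesis
      using bij_betw_same_card[OF bij[of S]] bij_betw_same_card[OF bij[of UNIV]] S[OF sN]
      by (simp add: Int_def conj_commute)
  qed
  have "real (card {L \<in> ?A. take q (drop p L) \<in> S}) \<le>
      (\<Sum>y\<in>g ` ?A. f * real (card {L \<in> ?A. g L = y \<and> True}))"
    unfolding card_eq[of "\<lambda>L. take q (drop p L) \<in> S"] by (rule sum_mono) (rule fibre)
  also have "\<dots> = f * real (card ?A)"
    using card_eq[of "\<lambda>_. True"] by (simp add: sum_distrib_left)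
  finally show ?thesis .
qed

text \<open>After division this bounds the chance that \<open>w\<close> marked letters among
  \<open>3 * n\<close> all land in the first \<open>n\<close> places, a product of factors
  \<open>(n - j) / (3 * n - j)\<close>. Each is at most \<open>1/3\<close>; the weaker
  \<open>1/2\<close> is enough and gives the power of two.\<close>

lemma fact_mult_fact_le:
  assumes "w \<le> n"
  shows "2 ^ w * (fact n * fact (3 * n - w)) \<le> (fact (3 * n) * fact (n - w) :: nat)"
  using assms
proof (induction w)
  case (Suc w)
  define a b where "a = n - Suc w" and "b = 3 * n - Suc w"
  have ab: "n - w = Suc a" "3 * n - w = Suc b" "2 * Suc a \<le> Suc b"
    using Suc.prems by (auto simp: a_def b_def)
  have IH: "2 ^ w * (fact n * fact (Suc b)) \<le> (fact (3 * n) * fact (Suc a) :: nat)"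
    using Suc ab by simp
  have "Suc b * (2 ^ Suc w * (fact n * fact b)) = 2 * (2 ^ w * (fact n * fact (Suc b)))"
    by (simp add: algebra_simps)
  also have "\<dots> \<le> 2 * (fact (3 * n) * fact (Suc a))" using IH by simp
  also have "\<dots> = 2 * Suc a * (fact (3 * n) * fact a)"
    by (simp add: algebra_simps)
  also have "\<dots> \<le> Suc b * (fact (3 * n) * fact a)" using ab(3) by (rule mult_right_mono) simp
  finally have "2 ^ Suc w * (fact n * fact b) \<le> fact (3 * n) * (fact a :: nat)"
    by (simp only: Suc_mult_le_cancel1)
  then show ?case by (simp only: a_def b_def)
qed simp

text \<open>The letters different from \<open>a\<close> must all fit into the first \<open>n\<close>
  places, which \<open>fact_mult_fact_le\<close> makes unlikely. Both arrangement counts are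
  multinomial coefficients, and the factorials of the other letters agree in them.\<close>

lemma card_permutations_of_multiset_constant_suffix_le:
  assumes M: "size M = 3 * n"
  shows "2 ^ size {#x \<in># M. x \<noteq> a#} *
      card {L \<in> permutations_of_multiset M. drop n L = replicate (2 * n) a} \<le>
    card (permutations_of_multiset M)"
proof (cases "replicate_mset (2 * n) a \<subseteq># M")
  case False
  have "{L \<in> permutations_of_multiset M. drop n L = replicate (2 * n) a} = {}"
  proof (safe, goal_cases)
    case (1 L)
    then have "M = mset (take n L) + replicate_mset (2 * n) a"
      by (metis append_take_drop_id mset_append mset_replicate permutations_of_multisetD)
    then show ?case using False by simp
  qed
  then show ?thesis by (simp only: card.empty)
next
  case True
  define N where "N = M - replicate_mset (2 * n) a"
  have MN: "M = N + replicate_mset (2 * n) a" using True by (simp add: N_def)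
  have sN: "size N = n" using MN M by simp
  define w where "w = size {#x \<in># M. x \<noteq> a#}"
  have w': "w = size {#x \<in># N. x \<noteq> a#}" by (simp add: w_def MN filter_mset_eq_conv)
  have split: "size K = count K a + size {#x \<in># K. x \<noteq> a#}" for K :: "'a multiset"
    by (metis filter_eq_replicate_mset multiset_partition size_replicate_mset size_union)
  have wn: "w \<le> n" and cN: "count N a = n - w" using split[of N] w' sN by auto
  have cM: "count M a = 3 * n - w" using split[of M] w_def M by auto
  have count_eq: "count N x = count M x" if "x \<noteq> a" for x using that by (simp add: MN)
  define r where "r = (\<Prod>x\<in>set_mset M - {a}. fact (count M x) :: nat)"
  have prods: "(\<Prod>x\<in>set_mset K. fact (count K x)) = fact (count K a) * r"
    if "\<And>x. x \<noteq> a \<Longrightarrow> count K x = count M x" for K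
  proof -
    \<comment> \<open>Letters missing from \<open>K\<close> contribute \<open>fact 0 = 1\<close>, so
      the product may run over \<open>insert a (set_mset M)\<close>, even when \<open>a\<close> does
      not occur in \<open>K\<close>.\<close>
    have "(\<Prod>x\<in>set_mset K. fact (count K x)) = (\<Prod>x\<in>insert a (set_mset M). fact (count K x))"
      using that by (intro prod.mono_neutral_left) (auto simp: not_in_iff, metis count_eq_zero_iff)
    also have "\<dots> = fact (count K a) * (\<Prod>x\<in>set_mset M - {a}. fact (count K x))"
      by (simp add: prod.insert_remove)
    also have "(\<Prod>x\<in>set_mset M - {a}. fact (count K x)) = r"
      unfolding r_def using that by (intro prod.cong) auto
    finally show ?thesis .
  qed
  have eN: "fact (n - w) * r * card (permutations_of_multiset N) = fact n"
    using card_permutations_of_multiset_aux[of N] prods[of N] count_eq cN sN by (simp add: ac_simps)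
  have eM: "fact (3 * n - w) * r * card (permutations_of_multiset M) = fact (3 * n)"
    using card_permutations_of_multiset_aux[of M] prods[of M] cM M by (simp add: ac_simps)
  have "{L \<in> permutations_of_multiset M. drop n L = replicate (2 * n) a} \<subseteq>
      (\<lambda>B. B @ replicate (2 * n) a) ` permutations_of_multiset N"
  proof (safe, goal_cases)
    case (1 L)
    then have "L = take n L @ replicate (2 * n) a" by (metis append_take_drop_id)
    moreover from this have "take n L \<in> permutations_of_multiset N"
      using 1 MN by (metis add_right_cancel mset_append mset_replicate permutations_of_multisetD
          permutations_of_multisetI)
    ultimately show ?case by blast
  qed
  then have "card {L \<in> permutations_of_multiset M. drop n L = replicate (2 * n) a} \<le>
      card (permutations_of_multiset N)"
    by (meson card_image_le card_mono finite_imageI finite_permutations_of_multiset le_trans)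
  then have "2 ^ w * card {L \<in> permutations_of_multiset M. drop n L = replicate (2 * n) a} \<le>
      2 ^ w * card (permutations_of_multiset N)" by simp
  also have "\<dots> \<le> card (permutations_of_multiset M)"
  proof -
    define cn cm f1 f2 f3 f4 where defs: "cn = card (permutations_of_multiset N)"
      "cm = card (permutations_of_multiset M)"
      "f1 = (fact (n - w) :: nat)" "f2 = (fact (3 * n - w) :: nat)"
      "f3 = (fact n :: nat)" "f4 = (fact (3 * n) :: nat)"
    have "2 ^ w * (f3 * f2) \<le> f4 * f1"
      using fact_mult_fact_le[OF wn] by (simp add: defs)
    then have "2 ^ w * ((f1 * r * cn) * f2) \<le> (f2 * r * cm) * f1"
      using eN eM by (simp only: defs)
    then have "(f1 * r * f2) * (2 ^ w * cn) \<le> (f1 * r * f2) * cm" by (simp only: ac_simps)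
    moreover have "0 < f1 * r * f2" by (simp add: defs r_def prod_pos)
    ultimately show ?thesis by (simp add: defs)
  qed
  finally show ?thesis by (simp add: w_def)
qed

text \<open>For each \<open>i < n\<close> put \<open>a\<close> and \<open>b\<close> in either order
  at the places \<open>i\<close> and \<open>n + i\<close>: the \<open>2^n\<close> choices
  \<open>t\<close> give distinct arrangements of the same multiset.\<close>

lemma two_power_le_card_permutations_of_multiset:
  assumes "a \<noteq> b"
  shows "2 ^ n \<le> card (permutations_of_multiset (mset (replicate n a @ replicate n b)))"
proof -
  let ?g = "\<lambda>t. map (\<lambda>c. if c then a else b) t @ map (\<lambda>c. if c then b else a) t"
  let ?T = "{t :: bool list. set t \<subseteq> UNIV \<and> length t = n}"
  have ms: "mset (?g t) = mset (replicate (length t) a @ replicate (length t) b)" for t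
    by (induction t) auto
  have "inj_on ?g ?T"
  proof (rule inj_onI)
    fix s t assume "s \<in> ?T" "t \<in> ?T" "?g s = ?g t"
    then have "map (\<lambda>c. if c then a else b) s = map (\<lambda>c. if c then a else b) t" by simp
    then show "s = t" using assms
      by (subst (asm) inj_map_eq_map) (auto simp: inj_def)
  qed
  then have "card ?T \<le> card (permutations_of_multiset (mset (replicate n a @ replicate n b)))"
    by (rule card_inj_on_le) (use ms in \<open>auto intro!: permutations_of_multisetI\<close>)
  moreover have "card ?T = 2 ^ n" by (subst card_lists_length_eq) auto
  ultimately show ?thesis by simp
qed

section \<open>Computational basis states\<close>

definition bits :: "nat \<Rightarrow> nat \<Rightarrow> bit vec" where
  "bits n a = vec n (\<lambda>p. if qubit n a p then 1 else 0)"

text \<open>Inverse of \<open>bits n\<close> on the basis indices. With amplitudes addressed by bit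
  vectors, a Pauli acts by a translation and a sign, and code states become normalised indicator
  functions.\<close>

definition index_of :: "bit vec \<Rightarrow> nat" where
  "index_of v = inv_into {..<2 ^ dim_vec v} (bits (dim_vec v)) v"

lemma bits_carrier [simp]: "bits n a \<in> carrier_vec n"
  and dim_bits [simp]: "dim_vec (bits n a) = n"
  by (simp_all add: bits_def)

lemma index_bits: "p < n \<Longrightarrow> bits n a $ p = 1 \<longleftrightarrow> qubit n a p"
  by (simp add: bits_def)

lemma qubit_ext:
  assumes "a < 2 ^ n" "b < 2 ^ n" "\<And>p. p < n \<Longrightarrow> qubit n a p = qubit n b p"
  shows "a = b"
proof (rule bit_eqI)
  fix j
  show "bit a j = bit b j"
  proof (cases "j < n")
    case True
    then show ?thesis using assms(3)[of "n - 1 - j"] by (simp add: qubit_def)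
  next
    case False
    have "take_bit n a = a" "take_bit n b = b"
      using assms by (simp_all add: take_bit_nat_eq_self)
    with False show ?thesis by (metis bit_take_bit_iff)
  qed
qed

lemma bij_betw_bits: "bij_betw (bits n) {..<2 ^ n} (carrier_vec n)"
proof (rule bij_betw_imageI)
  show "inj_on (bits n) {..<2 ^ n}"
    by (rule inj_onI, rule qubit_ext[of _ n]) (auto simp: index_bits[symmetric])
  show "bits n ` {..<2 ^ n} = carrier_vec n"
  proof (intro subset_antisym subsetI)
    fix v :: "bit vec" assume v: "v \<in> carrier_vec n"
    obtain b where b: "b < 2 ^ dim_vec v" "\<And>p. p < dim_vec v \<Longrightarrow> qubit (dim_vec v) b p \<longleftrightarrow> v $ p = 1"
      using ket_eq_unit_vec[of v] by blast
    have "bits n b = v" using b(2) v by (intro eq_vecI) (auto simp: bits_def)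
    then show "v \<in> bits n ` {..<2 ^ n}" using b(1) v by auto
  qed auto
qed

lemma index_of_less: "v \<in> carrier_vec n \<Longrightarrow> index_of v < 2 ^ n"
  using inv_into_into[of v "bits n" "{..<2 ^ n}"] bij_betw_bits[of n]
  by (auto simp: index_of_def bij_betw_def)

lemma bits_index_of [simp]: "v \<in> carrier_vec n \<Longrightarrow> bits n (index_of v) = v"
  using f_inv_into_f[of v "bits n" "{..<2 ^ n}"] bij_betw_bits[of n]
  by (auto simp: index_of_def bij_betw_def)

lemma index_of_bits [simp]: "a < 2 ^ n \<Longrightarrow> index_of (bits n a) = a"
  using inv_into_f_f[of "bits n" "{..<2 ^ n}" a] bij_betw_bits[of n]
  by (simp add: index_of_def bij_betw_def)

lemma finite_carrier_vec_bit [simp]: "finite (carrier_vec n :: bit vec set)"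
  using bij_betw_finite[OF bij_betw_bits[of n]] by simp

lemma card_carrier_vec_bit: "card (carrier_vec n :: bit vec set) = 2 ^ n"
  using bij_betw_same_card[OF bij_betw_bits[of n]] by simp

lemma eq_vec_index_of:
  assumes "f \<in> carrier_vec (2 ^ n)" "g \<in> carrier_vec (2 ^ n)"
    "\<And>v. v \<in> carrier_vec n \<Longrightarrow> f $ index_of v = g $ index_of v"
  shows "f = g"
proof (rule eq_vecI)
  fix a assume "a < dim_vec g"
  then show "f $ a = g $ a" using assms(2) assms(3)[of "bits n a"] by simp
qed (use assms in auto)

lemma ket_index_of:
  assumes "v \<in> carrier_vec n" "w \<in> carrier_vec n"
  shows "ket v $ index_of w = of_bool (w = v)"
proof -
  have "(\<forall>p<n. qubit n (index_of w) p \<longleftrightarrow> v $ p = 1) \<longleftrightarrow> w = v"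
    using assms by (auto simp flip: index_bits intro!: eq_vecI)
  then show ?thesis using assms index_of_less[OF assms(2)] by (simp add: ket_def)
qed

lemma ket_carrier [simp]: "v \<in> carrier_vec n \<Longrightarrow> ket v \<in> carrier_vec (2 ^ n)"
  by (simp add: ket_def carrier_vecD)

lemma coset_state_index_of:
  assumes "S \<subseteq> carrier_vec n" "v \<in> carrier_vec n"
  shows "coset_state n S $ index_of v = of_bool (v \<in> S) / complex_of_real (sqrt (card S))"
proof -
  have "(\<Sum>u\<in>S. ket u $ index_of v) = (\<Sum>u\<in>S. of_bool (v = u))"
    using assms by (intro sum.cong) (auto simp: ket_index_of)
  also have "\<dots> = of_bool (v \<in> S)"
    using finite_subset[OF assms(1)] by (simp add: of_bool_def sum.delta)
  finally show ?thesis using index_of_less[OF assms(2)] by (simp add: coset_state_def)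
qed

section \<open>The action of a Pauli operator\<close>

text \<open>Symplectic coordinates: every letter is \<open>X^x Z^z\<close> up to a phase.
  \<open>PY\<close> carries both bits, since \<open>Y = \<i> X Z\<close>; these factors
  \<open>\<i>\<close> are collected in \<open>pauli_phase\<close>.\<close>

fun x_bit :: "pauli \<Rightarrow> bit" where
  "x_bit PI = 0" | "x_bit PX = 1" | "x_bit PY = 1" | "x_bit PZ = 0"

fun z_bit :: "pauli \<Rightarrow> bit" where
  "z_bit PI = 0" | "z_bit PX = 0" | "z_bit PY = 1" | "z_bit PZ = 1"

definition x_part :: "pauli list \<Rightarrow> bit vec" where
  "x_part P = vec (length P) (\<lambda>p. x_bit (P ! p))"

definition z_part :: "pauli list \<Rightarrow> bit vec" where
  "z_part P = vec (length P) (\<lambda>p. z_bit (P ! p))"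

definition pauli_phase :: "pauli list \<Rightarrow> complex" where
  "pauli_phase P = (\<Prod>p<length P. if P ! p = PY then \<i> else 1)"

definition bsign :: "bit \<Rightarrow> complex" where
  "bsign b = (if b = 0 then 1 else - 1)"

lemma x_part_carrier [simp]: "length P = n \<Longrightarrow> x_part P \<in> carrier_vec n"
  and z_part_carrier [simp]: "length P = n \<Longrightarrow> z_part P \<in> carrier_vec n"
  by (auto simp: x_part_def z_part_def)

lemma dim_x_part [simp]: "dim_vec (x_part P) = length P"
  and dim_z_part [simp]: "dim_vec (z_part P) = length P"
  by (simp_all add: x_part_def z_part_def)

lemma cmod_pauli_phase [simp]: "cmod (pauli_phase P) = 1"
  unfolding pauli_phase_def prod_norm[symmetric] by (rule prod.neutral) simp

lemma pauli_phase_nonzero [simp]: "pauli_phase P \<noteq> 0"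
  using cmod_pauli_phase[of P] by (auto simp del: cmod_pauli_phase)

lemma bsign_simps [simp]: "bsign 0 = 1" "bsign 1 = - 1" "bsign b \<noteq> 0" "cmod (bsign b) = 1"
  "bsign b * bsign b = 1"
  by (simp_all add: bsign_def)

lemma bsign_add: "bsign (a + b) = bsign a * bsign b"
  by (cases a; cases b) auto

lemma bsign_eq_iff: "bsign a = bsign b \<longleftrightarrow> a = b"
  by (cases a; cases b) auto

lemma bsign_sum: "finite I \<Longrightarrow> bsign (\<Sum>i\<in>I. f i) = (\<Prod>i\<in>I. bsign (f i))"
  by (induction I rule: finite_induct)
    (simp_all only: sum.insert prod.insert sum.empty prod.empty bsign_add bsign_simps
      not_False_eq_True)

lemma bit_vec_add_self: "v \<in> carrier_vec n \<Longrightarrow> v + v = (0\<^sub>v n :: bit vec)"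
  by (intro eq_vecI) auto

lemma bit_vec_add_cancel [simp]:
  "v \<in> carrier_vec n \<Longrightarrow> u \<in> carrier_vec n \<Longrightarrow> v + u + u = (v :: bit vec)"
  by (intro eq_vecI) auto

lemma bit_vec_eq_add_iff:
  assumes "u \<in> carrier_vec n" "v \<in> carrier_vec n" "w \<in> carrier_vec n"
  shows "u = v + w \<longleftrightarrow> v = (u + w :: bit vec)"
  using assms bit_vec_add_cancel[of u n w] bit_vec_add_cancel[of v n w] by auto

text \<open>Entrywise form of \<open>P = pauli_phase P * X^x Z^z\<close>. As \<open>Z^z\<close> acts
  first, the sign is read off the column index \<open>b\<close> and not off
  \<open>a\<close>.\<close>

lemma pauli_mat_entry:
  assumes P: "length P = n" and ab: "a < 2 ^ n" "b < 2 ^ n"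
  shows "pauli_mat P $$ (a, b) = (if bits n a = bits n b + x_part P
    then pauli_phase P * bsign (z_part P \<bullet> bits n b) else 0)"
proof -
  let ?f = "\<lambda>p. of_bool (bits n a $ p = bits n b $ p + x_part P $ p) *
    ((if P ! p = PY then \<i> else 1) * bsign (z_part P $ p * bits n b $ p))"
  have "pauli_mat P $$ (a, b) = (\<Prod>p<n. ?f p)"
    unfolding pauli_mat_index[OF ab[folded P]] P
  proof (rule prod.cong)
    fix p assume "p \<in> {..<n}"
    then have p: "p < n" by simp
    show "pauli1 (P ! p) $$ (of_bool (qubit n a p), of_bool (qubit n b p)) = ?f p"
      using p P by (cases "P ! p"; cases "qubit n a p"; cases "qubit n b p")
        (simp_all add: bits_def x_part_def z_part_def mat_of_rows_list_def)
  qed simp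
  also have "\<dots> = (\<Prod>p<n. of_bool (bits n a $ p = bits n b $ p + x_part P $ p)) *
      (pauli_phase P * bsign (z_part P \<bullet> bits n b))"
    by (simp only: prod.distrib pauli_phase_def P scalar_prod_def bsign_sum atLeast0LessThan
        dim_bits finite_lessThan)
  also have "(\<Prod>p<n. of_bool (bits n a $ p = bits n b $ p + x_part P $ p)) =
      (of_bool (bits n a = bits n b + x_part P) :: complex)"
  proof (cases "bits n a = bits n b + x_part P")
    case True
    then show ?thesis using P by (auto intro!: prod.neutral)
  next
    case False
    then obtain p where "p < n" "bits n a $ p \<noteq> bits n b $ p + x_part P $ p"
      using P by (metis (no_types, lifting) dim_bits dim_x_part eq_vecI index_add_vec)
    then have "(\<Prod>p<n. of_bool (bits n a $ p = bits n b $ p + x_part P $ p)) = (0 :: complex)"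
      by (intro prod_zero bexI[of _ p]) (simp_all only: of_bool_eq finite_lessThan lessThan_iff
        not_False_eq_True)
    then show ?thesis using False by (simp only: of_bool_eq)
  qed
  finally show ?thesis by simp
qed

lemma pauli_mat_carrier [simp]: "length P = n \<Longrightarrow> pauli_mat P \<in> carrier_mat (2 ^ n) (2 ^ n)"
  by auto

text \<open>The amplitude at \<open>v\<close> comes from the single basis state
  \<open>v + x_part P\<close>, because translation by a bit vector is its own inverse; the sign is
  therefore taken there as well.\<close>

lemma pauli_mat_mult_vec:
  assumes P: "length P = n" and f: "f \<in> carrier_vec (2 ^ n)" and v: "v \<in> carrier_vec n"
  shows "(pauli_mat P *\<^sub>v f) $ index_of v =
    pauli_phase P * bsign (z_part P \<bullet> (v + x_part P)) * f $ index_of (v + x_part P)"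
proof -
  let ?x = "x_part P" and ?c = "pauli_phase P"
  have vx: "v + ?x \<in> carrier_vec n" using v P by simp
  have "(pauli_mat P *\<^sub>v f) $ index_of v = (\<Sum>b<2 ^ n. pauli_mat P $$ (index_of v, b) * f $ b)"
    using assms index_of_less[OF v] by (simp add: scalar_prod_def atLeast0LessThan)
  also have "\<dots> = (\<Sum>b<2 ^ n. if b = index_of (v + ?x)
      then ?c * bsign (z_part P \<bullet> (v + ?x)) * f $ index_of (v + ?x) else 0)"
  proof (rule sum.cong)
    fix b :: nat assume "b \<in> {..<2 ^ n}"
    then have b: "b < 2 ^ n" by simp
    have "v = bits n b + ?x \<longleftrightarrow> bits n b = v + ?x"
      using bit_vec_eq_add_iff[OF v bits_carrier x_part_carrier[OF P]] .
    also have "\<dots> \<longleftrightarrow> b = index_of (v + ?x)"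
      using b bits_index_of[OF vx] index_of_bits[OF b] by metis
    finally have iff: "v = bits n b + ?x \<longleftrightarrow> b = index_of (v + ?x)" .
    have e: "pauli_mat P $$ (index_of v, b) = (if b = index_of (v + ?x)
        then ?c * bsign (z_part P \<bullet> bits n b) else 0)"
      using pauli_mat_entry[OF P index_of_less[OF v] b] iff by (simp only: bits_index_of[OF v])
    show "pauli_mat P $$ (index_of v, b) * f $ b = (if b = index_of (v + ?x)
        then ?c * bsign (z_part P \<bullet> (v + ?x)) * f $ index_of (v + ?x) else 0)"
      using e bits_index_of[OF vx] by (cases "b = index_of (v + ?x)") simp_all
  qed simp
  also have "\<dots> = ?c * bsign (z_part P \<bullet> (v + ?x)) * f $ index_of (v + ?x)"
    using index_of_less[OF vx] by simp
  finally show ?thesis .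
qed

lemma pauli_mat_mult_vec_carrier [simp]:
  "length P = n \<Longrightarrow> pauli_mat P *\<^sub>v f \<in> carrier_vec (2 ^ n)"
  by (rule carrier_vecI) simp

lemma pauli_mat_mult_ket_eq:
  assumes P: "length P = n" and v: "v \<in> carrier_vec n"
  shows "pauli_mat P *\<^sub>v ket v = (pauli_phase P * bsign (z_part P \<bullet> v)) \<cdot>\<^sub>v ket (v + x_part P)"
proof (rule eq_vec_index_of)
  have vx: "v + x_part P \<in> carrier_vec n" using v P by simp
  then show "(pauli_phase P * bsign (z_part P \<bullet> v)) \<cdot>\<^sub>v ket (v + x_part P) \<in> carrier_vec (2 ^ n)"
    by simp
  fix w :: "bit vec" assume w: "w \<in> carrier_vec n"
  have wx: "w + x_part P \<in> carrier_vec n" using w P by simp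
  show "(pauli_mat P *\<^sub>v ket v) $ index_of w =
      ((pauli_phase P * bsign (z_part P \<bullet> v)) \<cdot>\<^sub>v ket (v + x_part P)) $ index_of w"
  proof (cases "w = v + x_part P")
    case True
    then have "w + x_part P = v" using bit_vec_add_cancel[OF v x_part_carrier[OF P]] by simp
    then show ?thesis
      using True pauli_mat_mult_vec[OF P ket_carrier[OF v] w] index_of_less[OF w]
        carrier_vecD[OF ket_carrier[OF vx]] ket_index_of[OF v wx] ket_index_of[OF vx w]
      by simp
  next
    case False
    then have "w + x_part P \<noteq> v" using bit_vec_add_cancel[OF w x_part_carrier[OF P]] by auto
    then show ?thesis
      using False pauli_mat_mult_vec[OF P ket_carrier[OF v] w] index_of_less[OF w]
        carrier_vecD[OF ket_carrier[OF vx]] ket_index_of[OF v wx] ket_index_of[OF vx w]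
      by simp
  qed
qed (use P in simp)

section \<open>Kronecker products\<close>

lemma dim_kron [simp]:
  "dim_row (A \<otimes>\<^sub>k B) = dim_row A * dim_row B" "dim_col (A \<otimes>\<^sub>k B) = dim_col A * dim_col B"
  by (simp_all add: kron_def)

lemma kron_carrier [simp]:
  "A \<in> carrier_mat r s \<Longrightarrow> B \<in> carrier_mat r' s' \<Longrightarrow> A \<otimes>\<^sub>k B \<in> carrier_mat (r * r') (s * s')"
  by auto

lemma index_kron:
  assumes "i < dim_row A * dim_row B" "j < dim_col A * dim_col B"
  shows "(A \<otimes>\<^sub>k B) $$ (i, j) =
    A $$ (i div dim_row B, j div dim_col B) * B $$ (i mod dim_row B, j mod dim_col B)"
  using assms by (simp add: kron_def)

lemma kron_assoc: "(A \<otimes>\<^sub>k B) \<otimes>\<^sub>k C = A \<otimes>\<^sub>k (B \<otimes>\<^sub>k C)"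
proof (rule eq_matI)
  have idx: "i div r div s = i div (s * r)" "i div r mod s = i mod (s * r) div r"
    "i mod (s * r) mod r = i mod r" "i div r < q * s" "i mod (s * r) < s * r" "i mod r < r"
    if "i < q * (s * r)" for i q r s :: nat
  proof -
    have pos: "0 < r" "0 < s" using that by (metis mult_0_right mult_0 not_gr_zero not_less_zero)+
    show "i div r div s = i div (s * r)" by (metis div_mult2_eq mult.commute)
    have "i mod (s * r) = r * (i div r mod s) + i mod r" by (metis mod_mult2_eq mult.commute)
    then show "i div r mod s = i mod (s * r) div r" using pos by simp
    show "i mod (s * r) mod r = i mod r" by (simp add: mod_mod_cancel)
    show "i div r < q * s" using that by (simp add: less_mult_imp_div_less mult.assoc)
    show "i mod (s * r) < s * r" "i mod r < r" using pos by simp_all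
  qed
  fix i j assume "i < dim_row (A \<otimes>\<^sub>k B \<otimes>\<^sub>k C)" "j < dim_col (A \<otimes>\<^sub>k B \<otimes>\<^sub>k C)"
  then have ij: "i < dim_row A * (dim_row B * dim_row C)" "j < dim_col A * (dim_col B * dim_col C)"
    by simp_all
  show "((A \<otimes>\<^sub>k B) \<otimes>\<^sub>k C) $$ (i, j) = (A \<otimes>\<^sub>k B \<otimes>\<^sub>k C) $$ (i, j)"
    using ij idx[OF ij(1)] idx[OF ij(2)] by (simp add: index_kron mult.assoc[symmetric])
qed (simp_all add: mult.assoc)

lemma sum_div_mod:
  fixes f :: "nat \<Rightarrow> nat \<Rightarrow> 'a :: comm_monoid_add"
  shows "(\<Sum>k<s * t. f (k div t) (k mod t)) = (\<Sum>u<s. \<Sum>v<t. f u v)"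
proof -
  have "(\<Sum>k<s * t. f (k div t) (k mod t)) = (\<Sum>(u, v)\<in>{..<s} \<times> {..<t}. f u v)"
  proof (rule sum.reindex_bij_witness[where i = "\<lambda>(u, v). u * t + v" and j = "\<lambda>k. (k div t, k mod t)"])
    fix y assume "y \<in> {..<s} \<times> {..<t}"
    then obtain u v where y: "y = (u, v)" "u < s" "v < t" by auto
    have "u * t + v < Suc u * t" using y by simp
    also have "\<dots> \<le> s * t" using y by (intro mult_right_mono) auto
    finally show "(\<lambda>(u, v). u * t + v) y \<in> {..<s * t}" using y by simp
    show "((\<lambda>(u, v). u * t + v) y div t, (\<lambda>(u, v). u * t + v) y mod t) = y" using y by simp
  qed (auto simp: less_mult_imp_div_less, metis mod_less_divisor mult_0_right not_gr_zero not_less_zero)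
  then show ?thesis by (simp add: sum.cartesian_product)
qed

lemma kron_mult:
  assumes A: "A \<in> carrier_mat r s" and B: "B \<in> carrier_mat r' s'"
    and C: "C \<in> carrier_mat s t" and D: "D \<in> carrier_mat s' t'"
  shows "(A \<otimes>\<^sub>k B) * (C \<otimes>\<^sub>k D) = (A * C) \<otimes>\<^sub>k (B * D)"
proof (rule eq_matI)
  fix i j assume "i < dim_row ((A * C) \<otimes>\<^sub>k (B * D))" "j < dim_col ((A * C) \<otimes>\<^sub>k (B * D))"
  then have ij: "i < r * r'" "j < t * t'" using assms by auto
  then have pos: "0 < r'" "0 < t'" by (cases r'; cases t'; auto)+
  have "((A \<otimes>\<^sub>k B) * (C \<otimes>\<^sub>k D)) $$ (i, j) =
      (\<Sum>k<s * s'. (A \<otimes>\<^sub>k B) $$ (i, k) * (C \<otimes>\<^sub>k D) $$ (k, j))"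
    using assms ij by (simp add: scalar_prod_def atLeast0LessThan)
  also have "\<dots> = (\<Sum>k<s * s'. (A $$ (i div r', k div s') * B $$ (i mod r', k mod s')) *
      (C $$ (k div s', j div t') * D $$ (k mod s', j mod t')))"
    using assms ij by (intro sum.cong) (auto simp: index_kron)
  also have "\<dots> = (\<Sum>u<s. \<Sum>v<s'. (A $$ (i div r', u) * B $$ (i mod r', v)) *
      (C $$ (u, j div t') * D $$ (v, j mod t')))"
    by (rule sum_div_mod)
  also have "\<dots> = (\<Sum>u<s. A $$ (i div r', u) * C $$ (u, j div t')) *
      (\<Sum>v<s'. B $$ (i mod r', v) * D $$ (v, j mod t'))"
    by (simp add: sum_product ac_simps)
  also have "\<dots> = (A * C) $$ (i div r', j div t') * (B * D) $$ (i mod r', j mod t')"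
    using assms ij pos by (simp add: scalar_prod_def atLeast0LessThan less_mult_imp_div_less)
  also have "\<dots> = ((A * C) \<otimes>\<^sub>k (B * D)) $$ (i, j)"
    using assms ij by (simp add: index_kron)
  finally show "((A \<otimes>\<^sub>k B) * (C \<otimes>\<^sub>k D)) $$ (i, j) = ((A * C) \<otimes>\<^sub>k (B * D)) $$ (i, j)" .
qed (use assms in auto)

lemma kron_one: "1\<^sub>m r \<otimes>\<^sub>k 1\<^sub>m s = 1\<^sub>m (r * s)"
proof (rule eq_matI)
  fix i j assume "i < dim_row (1\<^sub>m (r * s))" "j < dim_col (1\<^sub>m (r * s))"
  then have ij: "i < r * s" "j < r * s" by auto
  then have "0 < s" by (cases s) auto
  have "i = j \<longleftrightarrow> i div s = j div s \<and> i mod s = j mod s"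
    by (metis div_mult_mod_eq)
  then show "(1\<^sub>m r \<otimes>\<^sub>k 1\<^sub>m s) $$ (i, j) = 1\<^sub>m (r * s) $$ (i, j)"
    using ij \<open>0 < s\<close> by (auto simp: index_kron less_mult_imp_div_less)
qed auto

lemma one_kron_left [simp]: "1\<^sub>m 1 \<otimes>\<^sub>k A = A"
  by (rule eq_matI) (auto simp: index_kron)

lemma kron_smult_left: "(c \<cdot>\<^sub>m A) \<otimes>\<^sub>k B = c \<cdot>\<^sub>m (A \<otimes>\<^sub>k B)"
proof (rule eq_matI)
  fix i j assume "i < dim_row (c \<cdot>\<^sub>m (A \<otimes>\<^sub>k B))" "j < dim_col (c \<cdot>\<^sub>m (A \<otimes>\<^sub>k B))"
  then show "((c \<cdot>\<^sub>m A) \<otimes>\<^sub>k B) $$ (i, j) = (c \<cdot>\<^sub>m (A \<otimes>\<^sub>k B)) $$ (i, j)"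
    by (simp add: index_kron less_mult_imp_div_less)
qed auto

section \<open>Adjoints and unitary matrices\<close>

lemma dim_mat_adjoint [simp]:
  "dim_row (mat_adjoint A) = dim_col A" "dim_col (mat_adjoint A) = dim_row A"
  by (simp_all add: mat_adjoint_def)

lemma index_mat_adjoint [simp]:
  "i < dim_col A \<Longrightarrow> j < dim_row A \<Longrightarrow> mat_adjoint A $$ (i, j) = cnj (A $$ (j, i))"
  by (simp add: mat_adjoint_def mat_of_rows_def)

lemma mat_adjoint_carrier [simp]: "A \<in> carrier_mat r s \<Longrightarrow> mat_adjoint A \<in> carrier_mat s r"
  by auto

lemma mat_adjoint_kron: "mat_adjoint (A \<otimes>\<^sub>k B) = mat_adjoint A \<otimes>\<^sub>k mat_adjoint B"
proof (rule eq_matI)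
  fix i j
  assume "i < dim_row (mat_adjoint A \<otimes>\<^sub>k mat_adjoint B)" "j < dim_col (mat_adjoint A \<otimes>\<^sub>k mat_adjoint B)"
  then have ij: "i < dim_col A * dim_col B" "j < dim_row A * dim_row B" by simp_all
  then have "0 < dim_col B" "0 < dim_row B" by (cases "dim_col B"; cases "dim_row B"; auto)+
  with ij show "mat_adjoint (A \<otimes>\<^sub>k B) $$ (i, j) = (mat_adjoint A \<otimes>\<^sub>k mat_adjoint B) $$ (i, j)"
    by (simp add: index_kron less_mult_imp_div_less)
qed auto

lemma mat_adjoint_mult:
  fixes A B :: "complex mat"
  assumes "A \<in> carrier_mat r s" "B \<in> carrier_mat s t"
  shows "mat_adjoint (A * B) = mat_adjoint B * mat_adjoint A"
proof (rule eq_matI)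
  fix i j assume "i < dim_row (mat_adjoint B * mat_adjoint A)" "j < dim_col (mat_adjoint B * mat_adjoint A)"
  then show "mat_adjoint (A * B) $$ (i, j) = (mat_adjoint B * mat_adjoint A) $$ (i, j)"
    using carrier_matD[OF assms(1)] carrier_matD[OF assms(2)]
    by (simp add: scalar_prod_def mult.commute)
qed (use assms in auto)

lemma mat_adjoint_one [simp]: "mat_adjoint (1\<^sub>m n) = (1\<^sub>m n :: complex mat)"
  by (intro eq_matI) auto

lemma unitary_matD:
  assumes "unitary_mat N U"
  shows "U \<in> carrier_mat N N" "mat_adjoint U * U = 1\<^sub>m N" "U * mat_adjoint U = 1\<^sub>m N"
  using assms by (auto simp: unitary_mat_def)

lemma unitary_mat_one [simp]: "unitary_mat N (1\<^sub>m N)"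
  by (simp add: unitary_mat_def)

lemma unitary_mat_kron:
  assumes "unitary_mat M A" "unitary_mat N B"
  shows "unitary_mat (M * N) (A \<otimes>\<^sub>k B)"
  using unitary_matD[OF assms(1)] unitary_matD[OF assms(2)]
  unfolding unitary_mat_def mat_adjoint_kron
  by (auto simp: kron_mult[where r = M and s = M and t = M and r' = N and s' = N and t' = N] kron_one
)

lemma unitary_mat_mult:
  assumes "unitary_mat N A" "unitary_mat N B"
  shows "unitary_mat N (A * B)"
proof -
  note A = unitary_matD[OF assms(1)] and B = unitary_matD[OF assms(2)]
  note cA = mat_adjoint_carrier[OF A(1)] and cB = mat_adjoint_carrier[OF B(1)]
  note assoc = assoc_mult_mat[of _ N N _ N _ N]
  have "mat_adjoint (A * B) * (A * B) = mat_adjoint B * ((mat_adjoint A * A) * B)"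
    using A(1) B(1) cA cB by (simp only: mat_adjoint_mult[OF A(1) B(1)] assoc mult_carrier_mat)
  moreover have "(A * B) * mat_adjoint (A * B) = A * ((B * mat_adjoint B) * mat_adjoint A)"
    using A(1) B(1) cA cB by (simp only: mat_adjoint_mult[OF A(1) B(1)] assoc mult_carrier_mat)
  ultimately show ?thesis
    using A B cA cB by (simp add: unitary_mat_def)
qed

text \<open>A nonzero tensor product determines its factors up to scalars: evaluating at a fixed
  nonzero entry of one factor exhibits the other as a multiple. This is what separates an identity
  on \<open>3 * n\<close> qubits into one identity per block.\<close>

lemma kron_eq_kronD:
  assumes c: "A \<in> carrier_mat r s" "A' \<in> carrier_mat r s" "B \<in> carrier_mat r' s'" "B' \<in> carrier_mat r' s'"
    and nz: "A \<noteq> 0\<^sub>m r s" "B \<noteq> 0\<^sub>m r' s'" and eq: "A \<otimes>\<^sub>k B = A' \<otimes>\<^sub>k B'"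
  obtains a b where "a \<noteq> 0" "A = a \<cdot>\<^sub>m A'" "b \<noteq> 0" "B = b \<cdot>\<^sub>m B'"
proof -
  have e: "A $$ (i, j) * B $$ (k, l) = A' $$ (i, j) * B' $$ (k, l)"
    if "i < r" "j < s" "k < r'" "l < s'" for i j k l
  proof -
    have i: "i * r' + k < r * r'" and j: "j * s' + l < s * s'"
      using that mult_le_mono1[of "Suc i" r r'] mult_le_mono1[of "Suc j" s s'] by auto
    have "(A \<otimes>\<^sub>k B) $$ (i * r' + k, j * s' + l) = (A' \<otimes>\<^sub>k B') $$ (i * r' + k, j * s' + l)"
      using eq by simp
    then show ?thesis using c i j that by (simp add: index_kron)
  qed
  obtain i0 j0 where ij: "i0 < r" "j0 < s" "A $$ (i0, j0) \<noteq> 0"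
    using nz(1) c(1) by (metis (no_types, lifting) carrier_matD eq_matI index_zero_mat)
  obtain k0 l0 where kl: "k0 < r'" "l0 < s'" "B $$ (k0, l0) \<noteq> 0"
    using nz(2) c(3) by (metis (no_types, lifting) carrier_matD eq_matI index_zero_mat)
  have nz': "A' $$ (i0, j0) \<noteq> 0" "B' $$ (k0, l0) \<noteq> 0"
    using e[OF ij(1,2) kl(1,2)] ij kl by auto
  show thesis
  proof (rule that)
    show "B' $$ (k0, l0) / B $$ (k0, l0) \<noteq> 0" "A' $$ (i0, j0) / A $$ (i0, j0) \<noteq> 0"
      using ij kl nz' by auto
    show "A = (B' $$ (k0, l0) / B $$ (k0, l0)) \<cdot>\<^sub>m A'"
      using c e[OF _ _ kl(1,2)] kl(3) by (intro eq_matI) (auto simp: field_simps)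
    show "B = (A' $$ (i0, j0) / A $$ (i0, j0)) \<cdot>\<^sub>m B'"
      using c e[OF ij(1,2)] ij(3) by (intro eq_matI) (auto simp: field_simps)
  qed
qed

lemma pauli_mat_append: "pauli_mat (P @ Q) = pauli_mat P \<otimes>\<^sub>k pauli_mat Q"
  by (induction P) (simp_all add: pauli_mat_def kron_assoc del: One_nat_def)

lemma pauli_mat_Cons: "pauli_mat (Q # P) = pauli1 Q \<otimes>\<^sub>k pauli_mat P"
  by (simp add: pauli_mat_def)

section \<open>Conjugating Paulis by the strong trap code\<close>

definition index_where :: "nat \<Rightarrow> (nat \<Rightarrow> bool) \<Rightarrow> nat" where
  "index_where n f = index_of (vec n (\<lambda>p. if f p then 1 else 0))"

lemma index_where_less [simp]: "index_where n f < 2 ^ n"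
  unfolding index_where_def by (rule index_of_less) simp

lemma qubit_index_where [simp]: "p < n \<Longrightarrow> qubit n (index_where n f) p = f p"
  unfolding index_where_def by (subst index_bits[symmetric]) simp_all

lemma eq_index_where_iff:
  assumes "a < 2 ^ n"
  shows "a = index_where n f \<longleftrightarrow> (\<forall>p<n. qubit n a p = f p)"
  using qubit_ext[OF assms index_where_less[of n f]] by auto

text \<open>A permutation matrix has one nonzero entry in each row and column. The first form
  locates the row for a given column, the second the column for a given row, so that a sum over
  either index collapses.\<close>

lemma index_permutation_op:
  assumes k: "k permutes {..<n}" and ab: "a < 2 ^ n" "b < 2 ^ n"
  shows "permutation_op n k $$ (a, b) = of_bool (a = index_where n (\<lambda>p. qubit n b (inv_into UNIV k p)))"
    and "permutation_op n k $$ (a, b) = of_bool (b = index_where n (\<lambda>p. qubit n a (k p)))"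
proof -
  have e: "permutation_op n k $$ (a, b) = of_bool (\<forall>p<n. qubit n a (k p) = qubit n b p)"
    using ab by (simp add: permutation_op_def)
  then show "permutation_op n k $$ (a, b) = of_bool (b = index_where n (\<lambda>p. qubit n a (k p)))"
    unfolding eq_index_where_iff[OF ab(2)] by (simp add: eq_commute)
  have "(\<forall>p<n. qubit n a (k p) = qubit n b p) \<longleftrightarrow> (\<forall>p<n. qubit n a p = qubit n b (inv_into UNIV k p))"
    using permutes_in_image[OF k] permutes_in_image[OF permutes_inv[OF k]] permutes_inverses[OF k]
    by (metis lessThan_iff)
  then show "permutation_op n k $$ (a, b) = of_bool (a = index_where n (\<lambda>p. qubit n b (inv_into UNIV k p)))"
    unfolding e eq_index_where_iff[OF ab(1)] by simp
qed

lemma permutation_op_carrier [simp]: "permutation_op n k \<in> carrier_mat (2 ^ n) (2 ^ n)"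
  by (simp add: permutation_op_def)

lemma dim_permutation_op [simp]:
  "dim_row (permutation_op n k) = 2 ^ n" "dim_col (permutation_op n k) = 2 ^ n"
  by (simp_all add: permutation_op_def)

text \<open>\<open>permutation_op\<close> moves the content of qubit \<open>p\<close> to qubit
  \<open>k p\<close>, where the letter \<open>P ! k p\<close> meets it; that letter is the one at
  place \<open>p\<close> of \<open>permute_list k P\<close>.\<close>

lemma pauli_mat_mult_permutation_op:
  assumes k: "k permutes {..<n}" and P: "length P = n"
  shows "pauli_mat P * permutation_op n k = permutation_op n k * pauli_mat (permute_list k P)"
proof (rule eq_matI)
  fix a b
  assume "a < dim_row (permutation_op n k * pauli_mat (permute_list k P))"
    "b < dim_col (permutation_op n k * pauli_mat (permute_list k P))"
  then have ab: "a < 2 ^ n" "b < 2 ^ n" using P by simp_all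
  define b' where "b' = index_where n (\<lambda>p. qubit n b (inv_into UNIV k p))"
  define a' where "a' = index_where n (\<lambda>p. qubit n a (k p))"
  have ab': "a' < 2 ^ n" "b' < 2 ^ n" by (simp_all add: a'_def b'_def)
  have kp: "k p < n" if "p < n" for p
    using permutes_in_image[OF k] that by auto
  have "(pauli_mat P * permutation_op n k) $$ (a, b) =
      (\<Sum>c<2 ^ n. pauli_mat P $$ (a, c) * permutation_op n k $$ (c, b))"
    using ab P by (simp add: scalar_prod_def atLeast0LessThan)
  also have "\<dots> = (\<Sum>c<2 ^ n. if c = b' then pauli_mat P $$ (a, b') else 0)"
    using ab by (intro sum.cong) (auto simp: index_permutation_op(1)[OF k] b'_def)
  also have "\<dots> = pauli_mat P $$ (a, b')"
    using ab' by simp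
  also have "\<dots> = (\<Prod>p<n. pauli1 (P ! p) $$ (of_bool (qubit n a p), of_bool (qubit n b' p)))"
    using pauli_mat_index[of a P b'] ab ab' P by simp
  also have "\<dots> = (\<Prod>p<n. pauli1 (P ! k p) $$ (of_bool (qubit n a (k p)), of_bool (qubit n b' (k p))))"
    by (rule prod.reindex_bij_betw[OF permutes_imp_bij[OF k], symmetric])
  also have "\<dots> = (\<Prod>p<n. pauli1 (permute_list k P ! p) $$
      (of_bool (qubit n a' p), of_bool (qubit n b p)))"
    using kp P k permutes_inverses(2)[OF k]
    by (intro prod.cong) (auto simp: a'_def b'_def permute_list_nth)
  also have "\<dots> = pauli_mat (permute_list k P) $$ (a', b)"
    using pauli_mat_index[of a' "permute_list k P" b] ab ab' P by simp
  also have "\<dots> = (\<Sum>c<2 ^ n. if c = a' then pauli_mat (permute_list k P) $$ (a', b) else 0)"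
    using ab' by simp
  also have "\<dots> = (\<Sum>c<2 ^ n. permutation_op n k $$ (a, c) * pauli_mat (permute_list k P) $$ (c, b))"
    using ab by (intro sum.cong) (auto simp: index_permutation_op(2)[OF k] a'_def)
  also have "\<dots> = (permutation_op n k * pauli_mat (permute_list k P)) $$ (a, b)"
    using ab P by (simp add: scalar_prod_def atLeast0LessThan)
  finally show "(pauli_mat P * permutation_op n k) $$ (a, b) =
    (permutation_op n k * pauli_mat (permute_list k P)) $$ (a, b)" .
qed (use P in simp_all)

lemma unitary_permutation_op:
  assumes k: "k permutes {..<n}"
  shows "unitary_mat (2 ^ n) (permutation_op n k)"
proof -
  let ?T = "permutation_op n k"
  let ?s = "\<lambda>b. index_where n (\<lambda>p. qubit n b (inv_into UNIV k p))"
  let ?t = "\<lambda>a. index_where n (\<lambda>p. qubit n a (k p))"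
  have kp: "k p < n" "inv_into UNIV k p < n" if "p < n" for p
    using permutes_in_image[OF k] permutes_in_image[OF permutes_inv[OF k]] that by auto
  have ts: "?t (?s b) = b" if "b < 2 ^ n" for b
    using that kp permutes_inverses(2)[OF k] by (intro qubit_ext[of _ n]) auto
  have st: "?s (?t b) = b" if "b < 2 ^ n" for b
    using that kp permutes_inverses(1)[OF k] by (intro qubit_ext[of _ n]) auto
  have "mat_adjoint ?T * ?T = 1\<^sub>m (2 ^ n)"
  proof (rule eq_matI)
    fix a b assume "a < dim_row (1\<^sub>m (2 ^ n) :: complex mat)" "b < dim_col (1\<^sub>m (2 ^ n) :: complex mat)"
    then have ab: "a < 2 ^ n" "b < 2 ^ n" by simp_all
    have "(mat_adjoint ?T * ?T) $$ (a, b) = (\<Sum>c<2 ^ n. cnj (?T $$ (c, a)) * ?T $$ (c, b))"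
      using ab by (simp add: scalar_prod_def atLeast0LessThan)
    also have "\<dots> = (\<Sum>c<2 ^ n. if c = ?s a then of_bool (?s a = ?s b) else 0)"
      using ab by (intro sum.cong) (auto simp: index_permutation_op(1)[OF k])
    also have "\<dots> = of_bool (?s a = ?s b)" by simp
    also have "?s a = ?s b \<longleftrightarrow> a = b" using ts[OF ab(1)] ts[OF ab(2)] by metis
    finally show "(mat_adjoint ?T * ?T) $$ (a, b) = 1\<^sub>m (2 ^ n) $$ (a, b)" using ab by simp
  qed auto
  moreover have "?T * mat_adjoint ?T = 1\<^sub>m (2 ^ n)"
  proof (rule eq_matI)
    fix a b assume "a < dim_row (1\<^sub>m (2 ^ n) :: complex mat)" "b < dim_col (1\<^sub>m (2 ^ n) :: complex mat)"
    then have ab: "a < 2 ^ n" "b < 2 ^ n" by simp_all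
    have "(?T * mat_adjoint ?T) $$ (a, b) = (\<Sum>c<2 ^ n. ?T $$ (a, c) * cnj (?T $$ (b, c)))"
      using ab by (simp add: scalar_prod_def atLeast0LessThan)
    also have "\<dots> = (\<Sum>c<2 ^ n. if c = ?t a then of_bool (?t a = ?t b) else 0)"
      using ab by (intro sum.cong) (auto simp: index_permutation_op(2)[OF k])
    also have "\<dots> = of_bool (?t a = ?t b)" by simp
    also have "?t a = ?t b \<longleftrightarrow> a = b" using st[OF ab(1)] st[OF ab(2)] by metis
    finally show "(?T * mat_adjoint ?T) $$ (a, b) = 1\<^sub>m (2 ^ n) $$ (a, b)" using ab by simp
  qed auto
  ultimately show ?thesis by (simp add: unitary_mat_def)
qed

section \<open>The Hadamard gate and unitarity of the encoders\<close>

lemma hadamard_carrier [simp]: "hadamard \<in> carrier_mat 2 2"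
  unfolding hadamard_def mat_of_rows_list_def by (rule carrier_matI) simp_all

lemma dim_hadamard [simp]: "dim_row hadamard = 2" "dim_col hadamard = 2"
  using carrier_matD[OF hadamard_carrier] by simp_all

lemma unitary_mat_2I:
  assumes "U \<in> carrier_mat 2 2"
    "\<And>i j. i < 2 \<Longrightarrow> j < 2 \<Longrightarrow>
      cnj (U $$ (0, i)) * U $$ (0, j) + cnj (U $$ (1, i)) * U $$ (1, j) = of_bool (i = j)"
    "\<And>i j. i < 2 \<Longrightarrow> j < 2 \<Longrightarrow>
      U $$ (i, 0) * cnj (U $$ (j, 0)) + U $$ (i, 1) * cnj (U $$ (j, 1)) = of_bool (i = j)"
  shows "unitary_mat 2 U"
proof -
  have s: "{0..<2::nat} = {0, 1}" by auto
  have "mat_adjoint U * U = 1\<^sub>m 2"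
    using carrier_matD[OF assms(1)] assms(2) by (intro eq_matI) (simp_all add: scalar_prod_def s)
  moreover have "U * mat_adjoint U = 1\<^sub>m 2"
    using carrier_matD[OF assms(1)] assms(3) by (intro eq_matI) (simp_all add: scalar_prod_def s)
  ultimately show ?thesis using assms(1) by (simp add: unitary_mat_def)
qed

lemma unitary_hadamard: "unitary_mat 2 hadamard"
proof (rule unitary_mat_2I)
  define r where "r = complex_of_real (1 / sqrt 2)"
  have rr: "(1 / sqrt 2) * (1 / sqrt 2) = (1 / 2 :: real)" by simp
  have "r * r = complex_of_real (1 / 2)" unfolding r_def of_real_mult[symmetric] rr ..
  then have r: "cnj r = r" "r * r = 1 / 2" by (simp_all add: r_def)
  have e: "hadamard $$ (0, 0) = r" "hadamard $$ (0, Suc 0) = r" "hadamard $$ (Suc 0, 0) = r"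
    "hadamard $$ (Suc 0, Suc 0) = - r"
    by (simp_all add: hadamard_def mat_of_rows_list_def r_def)
  show "cnj (hadamard $$ (0, i)) * hadamard $$ (0, j) + cnj (hadamard $$ (1, i)) * hadamard $$ (1, j) =
      of_bool (i = j)" if "i < 2" "j < 2" for i j
    using that by (auto simp: e r less_2_cases_iff)
  show "hadamard $$ (i, 0) * cnj (hadamard $$ (j, 0)) + hadamard $$ (i, 1) * cnj (hadamard $$ (j, 1)) =
      of_bool (i = j)" if "i < 2" "j < 2" for i j
    using that by (auto simp: e r less_2_cases_iff)
qed simp

lemma unitary_pauli1: "unitary_mat 2 (pauli1 Q)"
  by (rule unitary_mat_2I; cases Q) (auto simp: mat_of_rows_list_def less_2_cases_iff)

lemma unitary_pauli_mat: "length P = n \<Longrightarrow> unitary_mat (2 ^ n) (pauli_mat P)"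
proof (induction P arbitrary: n)
  case Nil
  then show ?case by (simp add: pauli_mat_def)
next
  case (Cons Q P)
  then show ?case
    using unitary_mat_kron[OF unitary_pauli1[of Q] Cons.IH[OF refl]] by (auto simp: pauli_mat_Cons)
qed

fun hadamard_swap :: "pauli \<Rightarrow> pauli" where
  "hadamard_swap PX = PZ" | "hadamard_swap PZ = PX" | "hadamard_swap Q = Q"

text \<open>On a tag letter the swap holds exactly; on \<open>PY\<close> it would cost a sign. Only
  \<open>PI\<close> and \<open>PZ\<close> can stand on the trap qubit in an undetected
  outcome.\<close>

lemma hadamard_mult_pauli1:
  assumes "Q \<in> {PI, PZ}"
  shows "hadamard * pauli1 Q = pauli1 (hadamard_swap Q) * hadamard"
proof -
  have s: "{0..<2::nat} = {0, 1}" by auto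
  show ?thesis using assms
    by (intro eq_matI) (auto simp: hadamard_def mat_of_rows_list_def scalar_prod_def s less_2_cases_iff)
qed

lemma unitary_cancel_left:
  assumes U: "unitary_mat N U" and c: "A \<in> carrier_mat N N" "B \<in> carrier_mat N N" and eq: "U * A = U * B"
  shows "A = B"
proof -
  note u = unitary_matD[OF U]
  have "mat_adjoint U * (U * A) = mat_adjoint U * (U * B)" using eq by simp
  then have "(mat_adjoint U * U) * A = (mat_adjoint U * U) * B"
    using assoc_mult_mat[OF mat_adjoint_carrier[OF u(1)] u(1) c(1)]
      assoc_mult_mat[OF mat_adjoint_carrier[OF u(1)] u(1) c(2)] by simp
  then show ?thesis using u c by simp
qed

lemma unitary_cancel_right:
  assumes U: "unitary_mat N U" and c: "A \<in> carrier_mat N N" "B \<in> carrier_mat N N" and eq: "A * U = B * U"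
  shows "A = B"
proof -
  note u = unitary_matD[OF U]
  have "(A * U) * mat_adjoint U = (B * U) * mat_adjoint U" using eq by simp
  then have "A * (U * mat_adjoint U) = B * (U * mat_adjoint U)"
    using assoc_mult_mat[OF c(1) u(1) mat_adjoint_carrier[OF u(1)]]
      assoc_mult_mat[OF c(2) u(1) mat_adjoint_carrier[OF u(1)]] by simp
  then show ?thesis using u c by simp
qed

lemma unitary_mat_nonzero:
  assumes "unitary_mat N U" "0 < N"
  shows "U \<noteq> 0\<^sub>m N N"
proof
  assume "U = 0\<^sub>m N N"
  with unitary_matD[OF assms(1)] have "0\<^sub>m N N = (1\<^sub>m N :: complex mat)" by simp
  then have "(0\<^sub>m N N :: complex mat) $$ (0, 0) = 1\<^sub>m N $$ (0, 0)" by simp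
  then show False using assms(2) by simp
qed

lemma unitary_trap_factors:
  assumes E: "unitary_mat (2 ^ n) E" and n: "1 \<le> n"
  shows "unitary_mat (2 ^ (3 * n)) (E \<otimes>\<^sub>k E \<otimes>\<^sub>k E)"
    and "unitary_mat (2 ^ (3 * n)) (1\<^sub>m (2 ^ (2 * n)) \<otimes>\<^sub>k hadamard \<otimes>\<^sub>k 1\<^sub>m (2 ^ (n - 1)))"
proof -
  have e1: "2 ^ n * (2 ^ n * 2 ^ n) = (2 ^ (3 * n) :: nat)"
    by (simp only: power_add[symmetric]) simp
  show "unitary_mat (2 ^ (3 * n)) (E \<otimes>\<^sub>k E \<otimes>\<^sub>k E)"
    using unitary_mat_kron[OF E unitary_mat_kron[OF E E]] unfolding e1 .
  have e2: "2 ^ (2 * n) * (2 * 2 ^ (n - 1)) = (2 ^ (3 * n) :: nat)"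
    unfolding power_Suc[symmetric] power_add[symmetric] using n by simp
  show "unitary_mat (2 ^ (3 * n)) (1\<^sub>m (2 ^ (2 * n)) \<otimes>\<^sub>k hadamard \<otimes>\<^sub>k 1\<^sub>m (2 ^ (n - 1)))"
    using unitary_mat_kron[OF unitary_mat_one unitary_mat_kron[OF unitary_hadamard unitary_mat_one],
        of "2 ^ (2 * n)" "2 ^ (n - 1)"] unfolding e2 .
qed

lemma unitary_strong_trap_code:
  assumes "unitary_mat (2 ^ n) E" "1 \<le> n" "k permutes {..<3 * n}"
  shows "unitary_mat (2 ^ (3 * n)) (strong_trap_code n E k)"
  unfolding strong_trap_code_def
  by (rule unitary_mat_mult[OF unitary_mat_mult[OF unitary_permutation_op[OF assms(3)]
          unitary_trap_factors(1)[OF assms(1,2)]] unitary_trap_factors(2)[OF assms(1,2)]])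

text \<open>The Hadamard conjugates a surviving \<open>PZ\<close> on the trap of the third block to
  \<open>PX\<close>, whence \<open>q3 \<in> {PI, PX}\<close> against
  \<open>q2 \<in> {PI, PZ}\<close>; \<open>q1\<close> sits on the message and is free. After the
  outer unitaries are cancelled, the identity factors over the blocks up to scalars, of which only
  nonvanishing is retained.\<close>

lemma strong_trap_code_blocks:
  assumes E: "unitary_mat (2 ^ n) E" and n: "1 \<le> n" and k: "k permutes {..<3 * n}"
    and P: "length P = 3 * n" and Q: "length Q = 1" and R: "length R = 3 * n - 1"
    and RIZ: "set R \<subseteq> {PI, PZ}"
    and eq: "eq_up_to_phase (mat_adjoint (strong_trap_code n E k) * pauli_mat P * strong_trap_code n E k)
      (pauli_mat (Q @ R))"
  defines "L \<equiv> permute_list k P"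
  obtains q1 r1 a1 q2 r2 a2 q3 r3 a3 where
    "pauli_mat (take n L) * E = a1 \<cdot>\<^sub>m (E * pauli_mat (q1 # r1))" "a1 \<noteq> 0"
    "length r1 = n - 1" "set r1 \<subseteq> {PI, PZ}"
    "pauli_mat (take n (drop n L)) * E = a2 \<cdot>\<^sub>m (E * pauli_mat (q2 # r2))" "a2 \<noteq> 0"
    "length r2 = n - 1" "set r2 \<subseteq> {PI, PZ}" "q2 \<in> {PI, PZ}"
    "pauli_mat (take n (drop (2 * n) L)) * E = a3 \<cdot>\<^sub>m (E * pauli_mat (q3 # r3))" "a3 \<noteq> 0"
    "length r3 = n - 1" "set r3 \<subseteq> {PI, PZ}" "q3 \<in> {PI, PX}"
proof -
  let ?N = "2 ^ (3 * n) :: nat"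
  let ?T = "permutation_op (3 * n) k" and ?D = "E \<otimes>\<^sub>k E \<otimes>\<^sub>k E"
  let ?H = "1\<^sub>m (2 ^ (2 * n)) \<otimes>\<^sub>k hadamard \<otimes>\<^sub>k 1\<^sub>m (2 ^ (n - 1)) :: complex mat"
  let ?V = "strong_trap_code n E k"
  note uT = unitary_permutation_op[OF k] and uD = unitary_trap_factors(1)[OF E n]
    and uH = unitary_trap_factors(2)[OF E n]
  note uV = unitary_strong_trap_code[OF E n k]
  note cT = unitary_matD(1)[OF uT] and cD = unitary_matD(1)[OF uD] and cH = unitary_matD(1)[OF uH]
    and cV = unitary_matD(1)[OF uV]
  have lL: "length L = 3 * n" by (simp add: L_def P)
  have cP: "pauli_mat P \<in> carrier_mat ?N ?N" and cL: "pauli_mat L \<in> carrier_mat ?N ?N"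
    using P lL by simp_all

  obtain Q0 where Q0: "Q = [Q0]" using Q by (cases Q) auto
  define S where "S = Q @ R"
  have lS: "length S = 3 * n" using n Q R by (simp add: S_def)
  have cS: "pauli_mat S \<in> carrier_mat ?N ?N" using lS by simp
  define q1 r1 where "q1 = Q0" and "r1 = take (n - 1) R"
  \<comment> \<open>\<open>S\<close> starts with the message letter \<open>Q0\<close>, so block
    boundaries lie one place earlier in \<open>R\<close>.\<close>
  have S1: "take n S = q1 # r1" using n by (cases n) (auto simp: S_def Q0 q1_def r1_def)
  have S2: "drop n S = drop (n - 1) R" using n by (cases n) (auto simp: S_def Q0)
  have S3: "drop (2 * n) S = drop (2 * n - 1) R" using n by (cases n) (auto simp: S_def Q0)
  obtain q2 r2 where S2': "take n (drop n S) = q2 # r2"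
    using lS n by (cases "take n (drop n S)") auto
  obtain q r3 where S3': "drop (2 * n) S = q # r3"
    using lS n by (cases "drop (2 * n) S") auto
  have r1: "length r1 = n - 1" "set r1 \<subseteq> {PI, PZ}"
    using R RIZ set_take_subset[of "n - 1" R] by (auto simp: r1_def)
  have "length (q2 # r2) = n" unfolding S2'[symmetric] using lS by simp
  moreover have "set (q2 # r2) \<subseteq> set R" unfolding S2'[symmetric] S2
    using set_take_subset set_drop_subset by fastforce
  ultimately have r2: "length r2 = n - 1" "set r2 \<subseteq> {PI, PZ}" "q2 \<in> {PI, PZ}"
    using RIZ by auto
  have "length (q # r3) = n" unfolding S3'[symmetric] using lS by simp
  moreover have "set (q # r3) \<subseteq> set R" unfolding S3'[symmetric] S3
    using set_drop_subset by fastforce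
  ultimately have r3: "length r3 = n - 1" "set r3 \<subseteq> {PI, PZ}" "q \<in> {PI, PZ}"
    using RIZ by auto
  define q3 where "q3 = hadamard_swap q"
  have q3: "q3 \<in> {PI, PX}" using r3(3) by (auto simp: q3_def)
  have splitS: "S = ((q1 # r1) @ (q2 # r2)) @ (q # r3)"
  proof -
    have "drop (2 * n) S = drop n (drop n S)" by (simp add: mult_2)
    then show ?thesis
      unfolding S1[symmetric] S2'[symmetric] S3'[symmetric] append.assoc
      by (simp only: append_take_drop_id)
  qed
  define S' where "S' = ((q1 # r1) @ (q2 # r2)) @ (q3 # r3)"
  have lS': "length S' = 3 * n" using r1 r2 r3 n by (simp add: S'_def)
  have cS': "pauli_mat S' \<in> carrier_mat ?N ?N" using lS' by simp

  \<comment> \<open>The Hadamard acts on a single tensor factor, so \<open>kron_mult\<close> reduces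
    the passage to the one-qubit identity at the head of the third block.\<close>
  have HS: "?H * pauli_mat S = pauli_mat S' * ?H"
  proof -
    let ?A = "pauli_mat ((q1 # r1) @ (q2 # r2))" and ?B = "pauli_mat r3"
    let ?I = "1\<^sub>m (2 ^ (2 * n)) :: complex mat" and ?J = "1\<^sub>m (2 ^ (n - 1)) :: complex mat"
    have cA: "?A \<in> carrier_mat (2 ^ (2 * n)) (2 ^ (2 * n))"
      using r1 r2 n by (intro pauli_mat_carrier) simp
    have cB: "?B \<in> carrier_mat (2 ^ (n - 1)) (2 ^ (n - 1))" using r3 by simp
    have cq: "pauli1 x \<in> carrier_mat 2 2" for x by (rule carrier_matI) simp_all
    have hJ: "hadamard \<otimes>\<^sub>k ?J \<in> carrier_mat (2 * 2 ^ (n - 1)) (2 * 2 ^ (n - 1))"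
      by (rule kron_carrier[OF hadamard_carrier one_carrier_mat])
    have qB: "pauli1 x \<otimes>\<^sub>k ?B \<in> carrier_mat (2 * 2 ^ (n - 1)) (2 * 2 ^ (n - 1))" for x
      by (rule kron_carrier[OF cq cB])
    have "?H * pauli_mat S = (?I \<otimes>\<^sub>k (hadamard \<otimes>\<^sub>k ?J)) * (?A \<otimes>\<^sub>k (pauli1 q \<otimes>\<^sub>k ?B))"
      unfolding splitS pauli_mat_append[of _ "q # r3"] pauli_mat_Cons[of q r3] ..
    also have "\<dots> = (?I * ?A) \<otimes>\<^sub>k ((hadamard * pauli1 q) \<otimes>\<^sub>k (?J * ?B))"
      using kron_mult[OF one_carrier_mat hJ cA qB[of q]]
        kron_mult[OF hadamard_carrier one_carrier_mat cq cB] by (simp only:)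
    also have "\<dots> = (?A * ?I) \<otimes>\<^sub>k ((pauli1 q3 * hadamard) \<otimes>\<^sub>k (?B * ?J))"
      unfolding left_mult_one_mat[OF cA] right_mult_one_mat[OF cA] left_mult_one_mat[OF cB]
        right_mult_one_mat[OF cB] hadamard_mult_pauli1[OF r3(3)] q3_def ..
    also have "\<dots> = (?A \<otimes>\<^sub>k (pauli1 q3 \<otimes>\<^sub>k ?B)) * (?I \<otimes>\<^sub>k (hadamard \<otimes>\<^sub>k ?J))"
      using kron_mult[OF cA qB[of q3] one_carrier_mat hJ]
        kron_mult[OF cq cB hadamard_carrier one_carrier_mat] by (simp only:)
    also have "\<dots> = pauli_mat S' * ?H"
      unfolding S'_def pauli_mat_append[of _ "q3 # r3"] pauli_mat_Cons[of q3 r3] ..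
    finally show ?thesis .
  qed

  obtain c where c: "cmod c = 1" "mat_adjoint ?V * pauli_mat P * ?V = c \<cdot>\<^sub>m pauli_mat S"
    using eq unfolding eq_up_to_phase_def S_def by blast
  note assoc = assoc_mult_mat[of _ ?N ?N _ ?N _ ?N]
  note carr = mult_carrier_mat[of _ ?N ?N _ ?N] smult_carrier_mat
  note cVa = mat_adjoint_carrier[OF cV]
  \<comment> \<open>Multiplying by \<open>?V\<close> on the left removes the adjoint. On the other
    side the permutation is moved past \<open>P\<close>, which becomes \<open>L\<close>, and can
    then be cancelled.\<close>
  have "pauli_mat P * ?V = (?V * mat_adjoint ?V) * (pauli_mat P * ?V)"
    unfolding unitary_matD(3)[OF uV] left_mult_one_mat[OF mult_carrier_mat[OF cP cV]] ..
  also have "\<dots> = ?V * (mat_adjoint ?V * pauli_mat P * ?V)"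
    using cV cVa cP by (simp only: assoc carr)
  also have "\<dots> = c \<cdot>\<^sub>m (?V * pauli_mat S)"
    unfolding c(2) using cV cS by (rule mult_smult_distrib)
  also have "?V * pauli_mat S = ?T * (?D * (?H * pauli_mat S))"
    unfolding strong_trap_code_def using cT cD cH cS by (simp only: assoc carr)
  also have "c \<cdot>\<^sub>m \<dots> = ?T * (c \<cdot>\<^sub>m (?D * (pauli_mat S' * ?H)))"
    unfolding HS using cT cD cH cS' by (subst mult_smult_distrib[of _ ?N ?N _ ?N]) (simp_all only: carr)
  also have "pauli_mat P * ?V = (pauli_mat P * ?T) * (?D * ?H)"
    unfolding strong_trap_code_def using cT cD cH cP by (simp only: assoc carr)
  also have "\<dots> = ?T * (pauli_mat L * (?D * ?H))"
    unfolding pauli_mat_mult_permutation_op[OF k P] L_def[symmetric]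
    using cT cD cH cL by (simp only: assoc carr)
  finally have TL: "?T * (pauli_mat L * (?D * ?H)) = ?T * (c \<cdot>\<^sub>m (?D * (pauli_mat S' * ?H)))" .
  have "pauli_mat L * (?D * ?H) = c \<cdot>\<^sub>m (?D * (pauli_mat S' * ?H))"
    using cT cD cH cL cS' by - (rule unitary_cancel_left[OF uT _ _ TL]; simp only: carr)
  then have "(pauli_mat L * ?D) * ?H = c \<cdot>\<^sub>m ((?D * pauli_mat S') * ?H)"
    using cD cH cL cS' by (simp only: assoc carr)
  also have "\<dots> = (c \<cdot>\<^sub>m (?D * pauli_mat S')) * ?H"
    using cD cH cS' by (subst mult_smult_assoc_mat[of _ ?N ?N _ ?N]) (simp_all only: carr)
  finally have LDH: "(pauli_mat L * ?D) * ?H = (c \<cdot>\<^sub>m (?D * pauli_mat S')) * ?H" .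
  have LD: "pauli_mat L * ?D = c \<cdot>\<^sub>m (?D * pauli_mat S')"
    using cD cL cS' by - (rule unitary_cancel_right[OF uH _ _ LDH]; simp only: carr)

  define B1 B2 B3 where "B1 = take n L" and "B2 = take n (drop n L)" and "B3 = take n (drop (2 * n) L)"
  have B: "length B1 = n" "length B2 = n" "length B3 = n"
    using lL by (auto simp: B1_def B2_def B3_def)
  have "take n (drop (2 * n) L) = drop n (drop n L)"
    using lL by (simp add: mult_2)
  then have "L = B1 @ B2 @ B3"
    unfolding B1_def B2_def B3_def by (simp only: append_take_drop_id)
  then have pL: "pauli_mat L = pauli_mat B1 \<otimes>\<^sub>k (pauli_mat B2 \<otimes>\<^sub>k pauli_mat B3)"
    by (simp add: pauli_mat_append)
  have pS': "pauli_mat S' = pauli_mat (q1 # r1) \<otimes>\<^sub>k (pauli_mat (q2 # r2) \<otimes>\<^sub>k pauli_mat (q3 # r3))"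
    unfolding S'_def append.assoc pauli_mat_append ..
  let ?n = "2 ^ n :: nat"
  note cE = unitary_matD(1)[OF E]
  have M: "pauli_mat (q1 # r1) \<in> carrier_mat ?n ?n" "pauli_mat (q2 # r2) \<in> carrier_mat ?n ?n"
    "pauli_mat (q3 # r3) \<in> carrier_mat ?n ?n"
    using r1 r2 r3 n by (intro pauli_mat_carrier; simp)+
  note cB = B[THEN pauli_mat_carrier]
  have lhs: "pauli_mat L * ?D =
      (pauli_mat B1 * E) \<otimes>\<^sub>k ((pauli_mat B2 * E) \<otimes>\<^sub>k (pauli_mat B3 * E))"
    unfolding pL using kron_mult[OF cB(1) kron_carrier[OF cB(2,3)] cE kron_carrier[OF cE cE]]
      kron_mult[OF cB(2,3) cE cE] by (simp only:)
  have rhs: "c \<cdot>\<^sub>m (?D * pauli_mat S') = (c \<cdot>\<^sub>m (E * pauli_mat (q1 # r1))) \<otimes>\<^sub>k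
      ((E * pauli_mat (q2 # r2)) \<otimes>\<^sub>k (E * pauli_mat (q3 # r3)))"
    unfolding pS' kron_smult_left
    using kron_mult[OF cE kron_carrier[OF cE cE] M(1) kron_carrier[OF M(2,3)]]
      kron_mult[OF cE cE M(2,3)] by (simp only:)
  have u: "unitary_mat ?n (pauli_mat B1 * E)" "unitary_mat ?n (pauli_mat B2 * E)"
    "unitary_mat ?n (pauli_mat B3 * E)"
    by (rule unitary_mat_mult[OF unitary_pauli_mat E], rule B)+
  have cEM: "c \<cdot>\<^sub>m (E * pauli_mat (q1 # r1)) \<in> carrier_mat ?n ?n"
    "E * pauli_mat (q2 # r2) \<in> carrier_mat ?n ?n" "E * pauli_mat (q3 # r3) \<in> carrier_mat ?n ?n"
    by (rule smult_carrier_mat[OF mult_carrier_mat[OF cE M(1)]] mult_carrier_mat[OF cE M(2)]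
        mult_carrier_mat[OF cE M(3)])+
  note u23 = unitary_mat_kron[OF u(2,3)]
  \<comment> \<open>Unitary factors cannot vanish, as the comparison of tensor factors requires. The
    splitting is done twice: block one against the rest, then block two against block three.\<close>
  have nz: "pauli_mat B1 * E \<noteq> 0\<^sub>m ?n ?n" "pauli_mat B2 * E \<noteq> 0\<^sub>m ?n ?n"
    "pauli_mat B3 * E \<noteq> 0\<^sub>m ?n ?n"
    "(pauli_mat B2 * E) \<otimes>\<^sub>k (pauli_mat B3 * E) \<noteq> 0\<^sub>m (?n * ?n) (?n * ?n)"
    by (rule unitary_mat_nonzero[OF u(1)] unitary_mat_nonzero[OF u(2)]
        unitary_mat_nonzero[OF u(3)] unitary_mat_nonzero[OF u23]; simp)+
  have eq1: "(pauli_mat B1 * E) \<otimes>\<^sub>k ((pauli_mat B2 * E) \<otimes>\<^sub>k (pauli_mat B3 * E)) =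
      (c \<cdot>\<^sub>m (E * pauli_mat (q1 # r1))) \<otimes>\<^sub>k
      ((E * pauli_mat (q2 # r2)) \<otimes>\<^sub>k (E * pauli_mat (q3 # r3)))"
    unfolding lhs[symmetric] rhs[symmetric] by (rule LD)
  obtain a b where ab: "a \<noteq> 0" "pauli_mat B1 * E = a \<cdot>\<^sub>m (c \<cdot>\<^sub>m (E * pauli_mat (q1 # r1)))"
    "b \<noteq> 0" "(pauli_mat B2 * E) \<otimes>\<^sub>k (pauli_mat B3 * E) =
      b \<cdot>\<^sub>m ((E * pauli_mat (q2 # r2)) \<otimes>\<^sub>k (E * pauli_mat (q3 # r3)))"
    by (rule kron_eq_kronD[OF unitary_matD(1)[OF u(1)] cEM(1) unitary_matD(1)[OF u23]
          kron_carrier[OF cEM(2,3)] nz(1) nz(4) eq1])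
  have cbEM: "b \<cdot>\<^sub>m (E * pauli_mat (q2 # r2)) \<in> carrier_mat ?n ?n"
    using cEM(2) by (rule smult_carrier_mat)
  have eq2: "(pauli_mat B2 * E) \<otimes>\<^sub>k (pauli_mat B3 * E) =
      (b \<cdot>\<^sub>m (E * pauli_mat (q2 # r2))) \<otimes>\<^sub>k (E * pauli_mat (q3 # r3))"
    unfolding kron_smult_left by (rule ab(4))
  obtain a' b' where ab': "a' \<noteq> 0" "pauli_mat B2 * E = a' \<cdot>\<^sub>m (b \<cdot>\<^sub>m (E * pauli_mat (q2 # r2)))"
    "b' \<noteq> 0" "pauli_mat B3 * E = b' \<cdot>\<^sub>m (E * pauli_mat (q3 # r3))"
    by (rule kron_eq_kronD[OF unitary_matD(1)[OF u(2)] cbEM unitary_matD(1)[OF u(3)] cEM(3)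
          nz(2,3) eq2])
  have c0: "c \<noteq> 0" using c(1) by auto
  show thesis
  proof (rule that)
    show "pauli_mat (take n L) * E = (a * c) \<cdot>\<^sub>m (E * pauli_mat (q1 # r1))"
      unfolding B1_def[symmetric] ab(2) by (rule eq_matI) simp_all
    show "pauli_mat (take n (drop n L)) * E = (a' * b) \<cdot>\<^sub>m (E * pauli_mat (q2 # r2))"
      unfolding B2_def[symmetric] ab'(2) by (rule eq_matI) simp_all
    show "pauli_mat (take n (drop (2 * n) L)) * E = b' \<cdot>\<^sub>m (E * pauli_mat (q3 # r3))"
      using ab'(4) unfolding B3_def .
  qed (use ab(1,3) ab'(1,3) c0 r1 r2 r3 q3 in auto)
qed

section \<open>Weakly self-dual CSS codes\<close>

lemma bit_vec_add_swap:
  assumes "u \<in> carrier_vec n" "v \<in> carrier_vec n"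
  shows "u + (u + v) = (v :: bit vec)" "u + v + u = v"
    and "w \<in> carrier_vec n \<Longrightarrow> u + v + w = u + w + v"
  using assms by (auto intro!: eq_vecI)

lemma smult_mat_mult_vec:
  fixes A :: "complex mat"
  assumes "A \<in> carrier_mat r s" "v \<in> carrier_vec s"
  shows "(c \<cdot>\<^sub>m A) *\<^sub>v v = c \<cdot>\<^sub>v (A *\<^sub>v v)"
  using carrier_matD[OF assms(1)] carrier_vecD[OF assms(2)]
  by (intro eq_vecI) (simp_all add: scalar_prod_def sum_distrib_left mult.assoc)

text \<open>Squaring is the identity on bits.\<close>

lemma scalar_prod_self_bit:
  "u \<in> carrier_vec n \<Longrightarrow> u \<bullet> u = u \<bullet> vec n (\<lambda>_. 1 :: bit)"
  unfolding scalar_prod_def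
proof (rule sum.cong)
  fix i assume "u \<in> carrier_vec n" "i \<in> {0..<dim_vec (vec n (\<lambda>_. 1 :: bit))}"
  then show "u $ i * u $ i = u $ i * vec n (\<lambda>_. 1) $ i" by (cases "u $ i") simp_all
qed simp

lemma bij_betw_add_bit_vec:
  assumes "S \<subseteq> carrier_vec n" "S' \<subseteq> carrier_vec n" "u \<in> carrier_vec n"
    "\<And>v. v \<in> S \<Longrightarrow> v + u \<in> S'" "\<And>v. v \<in> S' \<Longrightarrow> v + u \<in> (S :: bit vec set)"
  shows "bij_betw (\<lambda>v. v + u) S S'"
proof (rule bij_betw_byWitness[where f' = "\<lambda>v. v + u"])
  show "\<forall>v\<in>S. v + u + u = v" "\<forall>v\<in>S'. v + u + u = v"
    using assms(1,2) bit_vec_add_cancel[OF _ assms(3)] by blast+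
qed (use assms(4,5) in blast)+

text \<open>\<open>bsign (z \<bullet> v)\<close> is a character on \<open>C\<close>: if it is
  nontrivial at some \<open>u\<close>, translation by \<open>u\<close> permutes \<open>C\<close> and
  reverses the sign of the sum.\<close>

lemma sum_bsign_additive:
  assumes C: "C \<subseteq> carrier_vec n" and add: "\<And>u v. u \<in> C \<Longrightarrow> v \<in> C \<Longrightarrow> u + v \<in> C"
    and z: "z \<in> carrier_vec n"
  shows "(\<Sum>v\<in>C. bsign (z \<bullet> v)) = (if \<forall>v\<in>C. z \<bullet> v = 0 then of_nat (card C) else 0)"
proof (cases "\<forall>v\<in>C. z \<bullet> v = 0")
  case True
  then show ?thesis by simp
next
  case False
  then obtain u where u: "u \<in> C" "z \<bullet> u = 1" by auto
  have uc: "u \<in> carrier_vec n" using u C by auto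
  have "bij_betw (\<lambda>v. v + u) C C"
    by (rule bij_betw_add_bit_vec[OF C C uc]) (rule add[OF _ u(1)], assumption)+
  then have "(\<Sum>v\<in>C. bsign (z \<bullet> v)) = (\<Sum>v\<in>C. bsign (z \<bullet> (v + u)))"
    by (rule sum.reindex_bij_betw[symmetric])
  also have "\<dots> = (\<Sum>v\<in>C. - bsign (z \<bullet> v))"
  proof (rule sum.cong)
    fix v assume "v \<in> C"
    then have "z \<bullet> (v + u) = z \<bullet> v + z \<bullet> u"
      using C uc z by (intro scalar_prod_add_distrib[of _ n]) auto
    then show "bsign (z \<bullet> (v + u)) = - bsign (z \<bullet> v)" by (simp only: bsign_add u bsign_simps mult_minus1_right)
  qed simp
  finally have "(\<Sum>v\<in>C. bsign (z \<bullet> v)) = - (\<Sum>v\<in>C. bsign (z \<bullet> v))"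
    by (simp only: sum_negf)
  then have "(\<Sum>v\<in>C. bsign (z \<bullet> v)) = 0" by simp
  then show ?thesis using False by (simp only: if_False)
qed

lemma dual_code_carrier: "dual_code n C \<subseteq> carrier_vec n"
  by (auto simp: dual_code_def)

lemma dual_code_add:
  assumes "C \<subseteq> carrier_vec n" "u \<in> dual_code n C" "v \<in> dual_code n C"
  shows "u + v \<in> dual_code n C"
proof -
  have "w \<bullet> (u + v) = w \<bullet> u + w \<bullet> v" if "w \<in> C" for w
    using assms that by (intro scalar_prod_add_distrib[of _ n]) (auto simp: dual_code_def)
  then show ?thesis using assms by (auto simp: dual_code_def)
qed

lemma zero_mem_dual_code:
  assumes "C \<subseteq> carrier_vec n"
  shows "0\<^sub>v n \<in> dual_code n C"
  using assms by (auto simp: dual_code_def)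

text \<open>Sum \<open>bsign (x \<bullet> v)\<close> over all \<open>x\<close> and all
  \<open>v \<in> C\<close> in both orders: one order keeps only the \<open>x\<close> in the dual
  code, the other only \<open>v = 0\<close>.\<close>

lemma card_dual_code:
  assumes C: "C \<subseteq> carrier_vec n" and z: "0\<^sub>v n \<in> C"
    and add: "\<And>u v. u \<in> C \<Longrightarrow> v \<in> C \<Longrightarrow> u + v \<in> C"
  shows "card (dual_code n C) * card C = 2 ^ n"
proof -
  let ?F = "carrier_vec n :: bit vec set"
  have fin: "finite C" using C by (rule finite_subset) simp
  have inner: "(\<Sum>v\<in>C. bsign (x \<bullet> v)) = (if x \<in> dual_code n C then of_nat (card C) else 0)"
    if x: "x \<in> ?F" for x
  proof -
    have "(\<forall>v\<in>C. x \<bullet> v = 0) \<longleftrightarrow> x \<in> dual_code n C"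
      using x C comm_scalar_prod[OF x] by (auto simp: dual_code_def subset_iff)
    then show ?thesis using sum_bsign_additive[OF C add x] by simp
  qed
  have outer: "(\<Sum>x\<in>?F. bsign (x \<bullet> v)) = (if v = 0\<^sub>v n then 2 ^ n else 0)" if v: "v \<in> ?F" for v
  proof -
    have "(\<Sum>x\<in>?F. bsign (x \<bullet> v)) = (\<Sum>x\<in>?F. bsign (v \<bullet> x))"
      using comm_scalar_prod[OF _ v] by (intro sum.cong) auto
    also have "\<dots> = (if \<forall>x\<in>?F. v \<bullet> x = 0 then of_nat (card ?F) else 0)"
      by (rule sum_bsign_additive[OF subset_refl _ v]) auto
    also have "(\<forall>x\<in>?F. v \<bullet> x = 0) \<longleftrightarrow> v = 0\<^sub>v n"
    proof
      assume all: "\<forall>x\<in>?F. v \<bullet> x = 0"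
      show "v = 0\<^sub>v n"
      proof (rule eq_vecI)
        fix i assume "i < dim_vec (0\<^sub>v n :: bit vec)"
        then have i: "i < n" by simp
        have "v \<bullet> unit_vec n i = 0" using all by simp
        then show "v $ i = 0\<^sub>v n $ i" using scalar_prod_right_unit[OF i, of v] i by simp
      qed (use v in simp)
    qed simp
    finally show ?thesis by (simp add: card_carrier_vec_bit)
  qed
  have "of_nat (card (dual_code n C) * card C) =
      (\<Sum>x\<in>?F. if x \<in> dual_code n C then of_nat (card C) else (0 :: complex))"
    using dual_code_carrier[of n C] by (simp add: sum.If_cases Int_absorb1)
  also have "\<dots> = (\<Sum>x\<in>?F. \<Sum>v\<in>C. bsign (x \<bullet> v))"
    using inner by simp
  also have "\<dots> = (\<Sum>v\<in>C. \<Sum>x\<in>?F. bsign (x \<bullet> v))" by (rule sum.swap)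
  also have "\<dots> = (\<Sum>v\<in>C. if v = 0\<^sub>v n then 2 ^ n else 0)"
    using outer C by (intro sum.cong refl) (simp add: subset_iff)
  also have "\<dots> = of_nat (2 ^ n)" using z fin by simp
  finally show ?thesis by (simp only: of_nat_eq_iff)
qed

text \<open>The inclusion of \<open>C\<close> in its bidual is immediate, and two applications of
  \<open>card_dual_code\<close> give both the same size.\<close>

lemma dual_dual_code:
  assumes C: "C \<subseteq> carrier_vec n" and z: "0\<^sub>v n \<in> C"
    and add: "\<And>u v. u \<in> C \<Longrightarrow> v \<in> C \<Longrightarrow> u + v \<in> C"
  shows "dual_code n (dual_code n C) = C"
proof (rule card_subset_eq[symmetric])
  let ?D = "dual_code n C"
  show "finite (dual_code n ?D)"
    using dual_code_carrier by (rule finite_subset) simp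
  show "C \<subseteq> dual_code n ?D"
    using C comm_scalar_prod by (fastforce simp: dual_code_def subset_iff)
  have "card ?D * card C = 2 ^ n" by (rule card_dual_code[OF C z add])
  moreover have "card (dual_code n ?D) * card ?D = 2 ^ n"
    using card_dual_code[OF dual_code_carrier zero_mem_dual_code[OF C] dual_code_add[OF C]] .
  moreover from \<open>card ?D * card C = 2 ^ n\<close> have "card ?D \<noteq> 0" by (intro notI) simp
  ultimately have "card ?D * card C = card ?D * card (dual_code n ?D)" "card ?D \<noteq> 0"
    by (simp_all only: mult.commute not_False_eq_True)
  then show "card C = card (dual_code n ?D)" by (simp only: mult_cancel_left) simp
qed

text \<open>Compare amplitudes, which are constant on the support: translation by
  \<open>x_part B\<close> must match the two supports, so they have equal size, the normalisations
  cancel and the phase is the same at every point of \<open>S\<close>.\<close>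

lemma pauli_mat_coset_stateD:
  assumes B: "length B = n" and S: "S \<subseteq> carrier_vec n" "S \<noteq> {}"
    and S': "S' \<subseteq> carrier_vec n" "S' \<noteq> {}" and c: "c \<noteq> 0"
    and eq: "pauli_mat B *\<^sub>v coset_state n S = c \<cdot>\<^sub>v coset_state n S'"
  shows "\<And>v. v \<in> S \<Longrightarrow> v + x_part B \<in> S'"
    and "\<And>v. v \<in> S \<Longrightarrow> pauli_phase B * bsign (z_part B \<bullet> v) = c"
proof -
  let ?x = "x_part B"
  have fin: "finite S" "finite S'" using S S' finite_subset by (metis finite_carrier_vec_bit)+
  have pos: "card S \<noteq> 0" "card S' \<noteq> 0" using fin S S' by simp_all
  have x: "?x \<in> carrier_vec n" using B by simp
  have cS: "coset_state n T \<in> carrier_vec (2 ^ n)" for T by (rule carrier_vecI) (simp add: coset_state_def)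
  have pt: "pauli_phase B * bsign (z_part B \<bullet> v) * (of_bool (v \<in> S) / complex_of_real (sqrt (card S))) =
      c * (of_bool (v + ?x \<in> S') / complex_of_real (sqrt (card S')))" if v: "v \<in> carrier_vec n" for v
  proof -
    have vx: "v + ?x \<in> carrier_vec n" using v x by simp
    have "(pauli_mat B *\<^sub>v coset_state n S) $ index_of (v + ?x) =
        c * coset_state n S' $ index_of (v + ?x)"
      unfolding eq using index_of_less[OF vx] carrier_vecD[OF cS[of S']] by simp
    then show ?thesis
      unfolding pauli_mat_mult_vec[OF B cS vx] bit_vec_add_cancel[OF v x]
        coset_state_index_of[OF S(1) v] coset_state_index_of[OF S'(1) vx] .
  qed
  have mem: "v \<in> S \<longleftrightarrow> v + ?x \<in> S'" if "v \<in> carrier_vec n" for v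
    using pt[OF that] c pos by (cases "v \<in> S"; cases "v + ?x \<in> S'") auto
  show mem1: "v + ?x \<in> S'" if "v \<in> S" for v using mem that S by auto
  have "bij_betw (\<lambda>v. v + ?x) S S'"
  proof (rule bij_betw_add_bit_vec[OF S(1) S'(1) x mem1])
    fix v assume v: "v \<in> S'"
    then have vc: "v \<in> carrier_vec n" using S' by auto
    then have "v + ?x \<in> carrier_vec n" using x by simp
    from mem[OF this] v show "v + ?x \<in> S" unfolding bit_vec_add_cancel[OF vc x] by simp
  qed
  then have card: "card S = card S'" by (rule bij_betw_same_card)
  show "pauli_phase B * bsign (z_part B \<bullet> v) = c" if v: "v \<in> S" for v
  proof -
    have "v \<in> carrier_vec n" using v S by auto
    from pt[OF this] mem1[OF v] v card pos show ?thesis by simp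
  qed
qed

text \<open>When \<open>z_part B\<close> is orthogonal to \<open>S\<close> all signs are trivial, so
  only the translation and the global phase remain.\<close>

lemma pauli_mat_coset_stateI:
  assumes B: "length B = n" and S: "S \<subseteq> carrier_vec n" and S': "S' = (\<lambda>v. v + x_part B) ` S"
    and z: "\<And>v. v \<in> S \<Longrightarrow> z_part B \<bullet> v = 0"
  shows "pauli_mat B *\<^sub>v coset_state n S = pauli_phase B \<cdot>\<^sub>v coset_state n S'"
proof (rule eq_vec_index_of)
  let ?x = "x_part B"
  have cS: "coset_state n T \<in> carrier_vec (2 ^ n)" for T by (rule carrier_vecI) (simp add: coset_state_def)
  have x: "?x \<in> carrier_vec n" using B by simp
  have S'c: "S' \<subseteq> carrier_vec n" using S x unfolding S' by auto
  have "inj_on (\<lambda>v. v + ?x) S"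
    using S bit_vec_add_cancel[OF _ x] by (intro inj_on_inverseI[where g = "\<lambda>v. v + ?x"]) auto
  then have card: "card S' = card S" unfolding S' by (rule card_image)
  show "pauli_mat B *\<^sub>v coset_state n S \<in> carrier_vec (2 ^ n)" using B by simp
  show "pauli_phase B \<cdot>\<^sub>v coset_state n S' \<in> carrier_vec (2 ^ n)" using cS by simp
  fix v :: "bit vec" assume v: "v \<in> carrier_vec n"
  have vx: "v + ?x \<in> carrier_vec n" using v x by simp
  have mem: "v \<in> S' \<longleftrightarrow> v + ?x \<in> S"
  proof
    assume "v \<in> S'"
    then obtain u where "u \<in> S" "v = u + ?x" unfolding S' by auto
    then show "v + ?x \<in> S" using S bit_vec_add_cancel[OF _ x, of u] by auto
  next
    assume "v + ?x \<in> S"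
    then have "v + ?x + ?x \<in> S'" unfolding S' by (rule imageI)
    then show "v \<in> S'" unfolding bit_vec_add_cancel[OF v x] .
  qed
  have "(pauli_phase B \<cdot>\<^sub>v coset_state n S') $ index_of v = pauli_phase B * coset_state n S' $ index_of v"
    using index_of_less[OF v] carrier_vecD[OF cS[of S']] by simp
  moreover have "pauli_phase B * bsign (z_part B \<bullet> (v + ?x)) * of_bool (v + ?x \<in> S) =
      pauli_phase B * of_bool (v + ?x \<in> S)"
    using z[of "v + ?x"] by (cases "v + ?x \<in> S") simp_all
  ultimately show "(pauli_mat B *\<^sub>v coset_state n S) $ index_of v =
      (pauli_phase B \<cdot>\<^sub>v coset_state n S') $ index_of v"
    unfolding pauli_mat_mult_vec[OF B cS v] coset_state_index_of[OF S vx]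
      coset_state_index_of[OF S'c v] card mem by (simp only: times_divide_eq_right)
qed

section \<open>How \<open>C2\<close> sits inside \<open>C1\<close> for one logical qubit\<close>

locale weakly_self_dual =
  fixes n :: nat and C1 C2 :: "bit vec set" and E :: "complex mat"
  assumes css: "weakly_self_dual_css n 1 C1 C2 E"
begin

lemma encoding: "css_encoding n 1 C1 C2 E" and C2_eq: "C2 = dual_code n C1"
  using css by (auto simp: weakly_self_dual_css_def)

lemma n_pos: "1 \<le> n" and unitary_E: "unitary_mat (2 ^ n) E" and C2_sub: "C2 \<subseteq> C1"
  and lin1: "linear_code n C1" and lin2: "linear_code n C2"
  using encoding by (auto simp: css_encoding_def is_code_def)

lemmas C1 = linear_codeD[OF lin1] and C2 = linear_codeD[OF lin2]

lemma carrier1: "v \<in> C1 \<Longrightarrow> v \<in> carrier_vec n" and carrier2: "v \<in> C2 \<Longrightarrow> v \<in> carrier_vec n"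
  using C1(1) C2(1) by auto

lemma finite_C: "finite C1" "finite C2"
  using C1(1) C2(1) finite_subset by (metis finite_carrier_vec_bit)+

lemma mem_C2_iff: "v \<in> C2 \<longleftrightarrow> v \<in> carrier_vec n \<and> (\<forall>u\<in>C1. u \<bullet> v = 0)"
  unfolding C2_eq dual_code_def by simp

lemma mem_C1_iff: "v \<in> C1 \<longleftrightarrow> v \<in> carrier_vec n \<and> (\<forall>u\<in>C2. u \<bullet> v = 0)"
  using dual_dual_code[OF C1] unfolding C2_eq[symmetric] by (auto simp: dual_code_def)

lemma orthogonal: "u \<in> C1 \<Longrightarrow> v \<in> C2 \<Longrightarrow> u \<bullet> v = 0"
  using mem_C2_iff by blast

lemma coset_eq_iff:
  assumes "u \<in> carrier_vec n" "v \<in> carrier_vec n"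
  shows "coset C2 u = coset C2 v \<longleftrightarrow> u + v \<in> C2"
proof
  assume "coset C2 u = coset C2 v"
  moreover have "u \<in> coset C2 u" unfolding coset_def using assms C2(2) by force
  ultimately obtain c where c: "c \<in> C2" "u = v + c" by (auto simp: coset_def)
  have cc: "c \<in> carrier_vec n" by (rule carrier2[OF c(1)])
  have "u + v = c" using c(2) cc assms bit_vec_add_cancel[OF cc assms(2)] comm_add_vec[OF assms(2) cc]
    by simp
  with c show "u + v \<in> C2" by simp
next
  have sub: "coset C2 u \<subseteq> coset C2 v" if uv: "u \<in> carrier_vec n" "v \<in> carrier_vec n" "u + v \<in> C2" for u v
  proof
    fix x assume "x \<in> coset C2 u"
    then obtain c where c: "c \<in> C2" "x = u + c" by (auto simp: coset_def)
    have cc: "c \<in> carrier_vec n" by (rule carrier2[OF c(1)])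
    have "v + (u + v + c) = u + c" using uv(1,2) cc by (intro eq_vecI) auto
    moreover have "u + v + c \<in> C2" using C2(3)[OF uv(3) c(1)] .
    ultimately show "x \<in> coset C2 v" unfolding coset_def using c(2) by (metis image_eqI)
  qed
  assume "u + v \<in> C2"
  moreover from this have "v + u \<in> C2" using comm_add_vec[OF assms] by simp
  ultimately show "coset C2 u = coset C2 v" using sub assms by blast
qed

lemma mem_coset_iff:
  assumes "u \<in> carrier_vec n" "v \<in> carrier_vec n"
  shows "u \<in> coset C2 v \<longleftrightarrow> u + v \<in> C2"
proof
  assume "u \<in> coset C2 v"
  then obtain c where c: "c \<in> C2" "u = v + c" by (auto simp: coset_def)
  have cc: "c \<in> carrier_vec n" by (rule carrier2[OF c(1)])
  have "u + v = c" using c(2) cc assms bit_vec_add_cancel[OF cc assms(2)] comm_add_vec[OF assms(2) cc]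
    by simp
  with c show "u + v \<in> C2" by simp
next
  assume "u + v \<in> C2"
  then have "coset C2 u = coset C2 v" using coset_eq_iff[OF assms] by simp
  moreover have "u \<in> coset C2 u" unfolding coset_def using assms C2(2) by force
  ultimately show "u \<in> coset C2 v" by simp
qed

lemma card_cosets: "card (coset C2 ` C1) = 2"
proof -
  obtain K where K: "bij_betw K (carrier_vec 1) (coset C2 ` C1)"
    "\<forall>x\<in>carrier_vec 1. logical_state n 1 E x = coset_state n (K x)"
    using encoding unfolding css_encoding_def by blast
  from bij_betw_same_card[OF K(1)] show ?thesis unfolding card_carrier_vec_bit by simp
qed

text \<open>One logical qubit means exactly two cosets of \<open>C2\<close> in \<open>C1\<close>, so
  all vectors of \<open>C1\<close> outside \<open>C2\<close> share one coset.\<close>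

lemma coset_cases:
  assumes w: "w \<in> C1" "w \<notin> C2" and v: "v \<in> C1" "v \<notin> C2"
  shows "v + w \<in> C2"
proof -
  obtain A B where AB: "coset C2 ` C1 = {A, B}" using card_cosets by (auto simp: card_2_iff)
  have ne: "coset C2 u \<noteq> coset C2 (0\<^sub>v n)" if "u \<in> C1" "u \<notin> C2" for u
    using that coset_eq_iff[OF carrier1[OF that(1)], of "0\<^sub>v n"] carrier1[OF that(1)] by simp
  have "coset C2 u \<in> {A, B}" if "u \<in> C1" for u using AB that by blast
  from this[OF w(1)] this[OF v(1)] this[OF C1(2)] ne[OF w] ne[OF v]
  have "coset C2 v = coset C2 w" by auto
  then show ?thesis using coset_eq_iff carrier1 v w by blast
qed

definition one :: "bit vec" where "one = vec n (\<lambda>_. 1)"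

lemma one_carrier: "one \<in> carrier_vec n" by (simp add: one_def)

text \<open>\<open>C2\<close> is contained in its dual \<open>C1\<close>, so every
  \<open>u \<in> C2\<close> has \<open>u \<bullet> u = 0\<close>; over bits this is
  \<open>u \<bullet> one\<close>.\<close>

lemma one_mem: "one \<in> C1"
proof -
  have "u \<bullet> one = 0" if "u \<in> C2" for u
    using scalar_prod_self_bit[OF carrier2[OF that]] orthogonal[OF subsetD[OF C2_sub that] that]
    by (simp add: one_def)
  then show ?thesis using mem_C1_iff one_carrier by blast
qed

text \<open>If \<open>1\<^sup>n\<close> were in \<open>C2\<close>, then \<open>C1\<close> would be self-orthogonal, hence equal to \<open>C2\<close>.\<close>

lemma one_not_mem: "one \<notin> C2"
proof
  assume one: "one \<in> C2"
  have "\<exists>w\<in>C1. w \<notin> C2"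
  proof (rule ccontr)
    assume "\<not> ?thesis"
    then have "coset C2 v = coset C2 (0\<^sub>v n)" if "v \<in> C1" for v
      using coset_eq_iff[OF carrier1[OF that] zero_carrier_vec] carrier1[OF that] that by simp
    then have "coset C2 ` C1 \<subseteq> {coset C2 (0\<^sub>v n)}" by blast
    from card_mono[OF _ this] show False using card_cosets by simp
  qed
  then obtain w where w: "w \<in> C1" "w \<notin> C2" by blast
  have wc: "w \<in> carrier_vec n" by (rule carrier1[OF w(1)])
  \<comment> \<open>\<open>w \<bullet> w = w \<bullet> one\<close>, and the latter vanishes under
    the assumption; with only two cosets, \<open>w\<close> is then orthogonal to all of
    \<open>C1\<close>.\<close>
  have ww: "w \<bullet> w = 0"
    using scalar_prod_self_bit[OF wc] orthogonal[OF w(1) one] by (simp add: one_def)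
  have "v \<bullet> w = 0" if v: "v \<in> C1" for v
  proof (cases "v \<in> C2")
    case True
    then show ?thesis using orthogonal[OF w(1)] comm_scalar_prod[OF carrier1[OF v] wc] by simp
  next
    case False
    have vc: "v \<in> carrier_vec n" by (rule carrier1[OF v])
    have "w \<bullet> (v + w) = 0" by (rule orthogonal[OF w(1) coset_cases[OF w v False]])
    then have "w \<bullet> v = 0" unfolding scalar_prod_add_distrib[OF wc vc wc] ww by simp
    then show ?thesis using comm_scalar_prod[OF vc wc] by simp
  qed
  then have "w \<in> C2" using mem_C2_iff wc by blast
  with w show False by simp
qed

lemma mem_C1_cases: "v \<in> C1 \<Longrightarrow> v \<in> C2 \<or> v + one \<in> C2"
  using coset_cases[OF one_mem one_not_mem] by blast

text \<open>\<open>C1\<close> is the disjoint union of \<open>C2\<close> and its translate by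
  \<open>one\<close>, and \<open>card C1 * card C2 = 2 ^ n\<close>, so twice the square of
  \<open>card C2\<close> is \<open>2 ^ n\<close>. This separates length \<open>1\<close> from the
  lengths at which a benign Pauli exists.\<close>

lemma C2_trivial_iff: "n = 1 \<longleftrightarrow> C2 = {0\<^sub>v n}"
proof -
  have "C1 = C2 \<union> (\<lambda>v. v + one) ` C2"
  proof (intro subset_antisym subsetI)
    fix v assume v: "v \<in> C1"
    show "v \<in> C2 \<union> (\<lambda>v. v + one) ` C2"
      using mem_C1_cases[OF v] bit_vec_add_cancel[OF carrier1[OF v] one_carrier]
      by (metis UnI1 UnI2 imageI)
  next
    fix v assume "v \<in> C2 \<union> (\<lambda>v. v + one) ` C2"
    then show "v \<in> C1" using C2_sub C1(3) one_mem by auto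
  qed
  moreover have "C2 \<inter> (\<lambda>v. v + one) ` C2 = {}"
  proof (safe, goal_cases)
    case (1 v u)
    then have "u + (u + one) \<in> C2" using C2(3) by blast
    moreover have "u + (u + one) = one"
      using carrier2[OF 1(2)] one_carrier by (intro eq_vecI) auto
    ultimately show ?case using one_not_mem by simp
  qed
  moreover have "inj_on (\<lambda>v. v + one) C2"
    using bit_vec_add_cancel[OF carrier2 one_carrier]
    by (intro inj_on_inverseI[where g = "\<lambda>v. v + one"])
  ultimately have "card C1 = card C2 + card C2"
    using finite_C by (metis card_Un_disjoint card_image finite_imageI)
  then have card: "card C2 * (2 * card C2) = 2 ^ n"
    using card_dual_code[OF C1] unfolding C2_eq[symmetric] by (simp add: mult_2)
  show ?thesis
  proof
    assume "n = 1"
    with card have "card C2 = 1" by simp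
    then obtain x where "C2 = {x}" by (auto simp: card_1_singleton_iff)
    with C2(2) show "C2 = {0\<^sub>v n}" by simp
  next
    assume "C2 = {0\<^sub>v n}"
    with card have "2 ^ n = (2 ^ 1 :: nat)" by simp
    then show "n = 1" by (simp only: power_inject_exp one_less_numeral_iff semiring_norm)
  qed
qed

section \<open>Paulis acting on logical states\<close>

lemma logical_stateE:
  obtains K where "bij_betw K (carrier_vec 1) (coset C2 ` C1)"
    "\<And>x. x \<in> carrier_vec 1 \<Longrightarrow> logical_state n 1 E x = coset_state n (K x)"
    "\<And>x. x \<in> carrier_vec 1 \<Longrightarrow> \<exists>w\<in>C1. K x = coset C2 w"
    "\<And>x. x \<in> carrier_vec 1 \<Longrightarrow> K x \<subseteq> C1 \<and> K x \<noteq> {}"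
    "\<And>v. v \<in> C1 \<Longrightarrow> \<exists>x\<in>carrier_vec 1. v \<in> K x"
proof -
  obtain K where K: "bij_betw K (carrier_vec 1) (coset C2 ` C1)"
    "\<forall>x\<in>carrier_vec 1. logical_state n 1 E x = coset_state n (K x)"
    using encoding unfolding css_encoding_def by blast
  have w: "\<exists>w\<in>C1. K x = coset C2 w" if "x \<in> carrier_vec 1" for x
    using bij_betwE[OF K(1)] that by blast
  have s: "K x \<subseteq> C1 \<and> K x \<noteq> {}" if x: "x \<in> carrier_vec 1" for x
  proof -
    obtain w where w: "w \<in> C1" "K x = (\<lambda>c. w + c) ` C2" using w[OF x] by (auto simp: coset_def)
    show ?thesis unfolding w(2) using C1(3)[OF w(1) subsetD[OF C2_sub]] C2(2) by blast
  qed
  have c: "\<exists>x\<in>carrier_vec 1. v \<in> K x" if v: "v \<in> C1" for v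
  proof -
    have "coset C2 v \<in> K ` carrier_vec 1" using K(1) v by (auto simp: bij_betw_def)
    moreover have "v \<in> coset C2 v" unfolding coset_def using carrier1[OF v] C2(2) by force
    ultimately show ?thesis by auto
  qed
  show thesis by (rule that[OF K(1) K(2)[rule_format] w s c])
qed

text \<open>Let both sides act on a logical basis state. On the right the tag letters fix
  \<open>|0>\<close>, while \<open>q\<close> shifts the label by its x-bit and contributes a sign
  from its z-bit; so \<open>B\<close> maps coset states to coset states. If \<open>q\<close> does
  not shift, translation by \<open>x_part B\<close> preserves a coset and \<open>x_part B\<close>
  lies in \<open>C2\<close>; if \<open>q\<close> gives no sign, the phase is constant on all of
  \<open>C1\<close> and \<open>z_part B\<close> lies in \<open>C2\<close>.\<close>

lemma undetectedD:
  assumes B: "length B = n" and r: "length r = n - 1" "set r \<subseteq> {PI, PZ}" and a: "a \<noteq> 0"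
    and eq: "pauli_mat B * E = a \<cdot>\<^sub>m (E * pauli_mat (q # r))"
  shows "x_part B \<in> C1" "z_part B \<in> C1"
    and "q \<in> {PI, PZ} \<Longrightarrow> x_part B \<in> C2" and "q \<in> {PI, PX} \<Longrightarrow> z_part B \<in> C2"
proof -
  obtain K where K: "bij_betw K (carrier_vec 1) (coset C2 ` C1)"
    "\<And>x. x \<in> carrier_vec 1 \<Longrightarrow> logical_state n 1 E x = coset_state n (K x)"
    "\<And>x. x \<in> carrier_vec 1 \<Longrightarrow> \<exists>w\<in>C1. K x = coset C2 w"
    "\<And>x. x \<in> carrier_vec 1 \<Longrightarrow> K x \<subseteq> C1 \<and> K x \<noteq> {}"
    "\<And>v. v \<in> C1 \<Longrightarrow> \<exists>x\<in>carrier_vec 1. v \<in> K x"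
    by (rule logical_stateE) blast
  define y where "y = vec 1 (\<lambda>_. x_bit q)"
  have y: "y \<in> carrier_vec 1" by (simp add: y_def)
  have lqr: "length (q # r) = n" using r n_pos by simp
  have rx: "x_bit Q = 0" if "Q \<in> set r" for Q using r that by auto
  have xqr: "x_part (q # r) = y @\<^sub>v 0\<^sub>v (n - 1)"
    using lqr r rx by (intro eq_vecI) (auto simp: x_part_def y_def nth_Cons')
  \<comment> \<open>The phase picked up on label \<open>x\<close>; only \<open>z_bit q\<close> makes
    it depend on \<open>x\<close>.\<close>
  define c where "c x = a * (pauli_phase (q # r) * bsign (z_bit q * x $ 0))" for x :: "bit vec"
  have c0: "c x \<noteq> 0" for x using a by (simp add: c_def)
  have cE: "E \<in> carrier_mat (2 ^ n) (2 ^ n)" using unitary_matD(1)[OF unitary_E] .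
  have cB: "pauli_mat B \<in> carrier_mat (2 ^ n) (2 ^ n)" using B by simp
  have cM: "pauli_mat (q # r) \<in> carrier_mat (2 ^ n) (2 ^ n)" by (rule pauli_mat_carrier[OF lqr])
  have act: "pauli_mat B *\<^sub>v coset_state n (K x) = c x \<cdot>\<^sub>v coset_state n (K (x + y))"
    if x: "x \<in> carrier_vec 1" for x
  proof -
    define w where "w = x @\<^sub>v 0\<^sub>v (n - 1)"
    have wc: "w \<in> carrier_vec n"
      unfolding w_def using x append_carrier_vec[OF x zero_carrier_vec, of "n - 1"] n_pos by simp
    have xy: "x + y \<in> carrier_vec 1" using x y by simp
    have wy: "w + x_part (q # r) = (x + y) @\<^sub>v 0\<^sub>v (n - 1)"
      unfolding xqr w_def using x y by (intro eq_vecI) auto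
    have "z_part (q # r) \<bullet> w = (\<Sum>i<n. z_part (q # r) $ i * w $ i)"
      using wc by (simp add: scalar_prod_def atLeast0LessThan)
    also have "\<dots> = (\<Sum>i<n. if i = 0 then z_bit q * x $ 0 else 0)"
      using lqr x r by (intro sum.cong) (auto simp: w_def z_part_def)
    also have "\<dots> = z_bit q * x $ 0" using n_pos by simp
    finally have zw: "z_part (q # r) \<bullet> w = z_bit q * x $ 0" .
    have kc: "ket v \<in> carrier_vec (2 ^ n)" if "v \<in> carrier_vec n" for v using that by simp
    have "pauli_mat B *\<^sub>v (E *\<^sub>v ket w) = (pauli_mat B * E) *\<^sub>v ket w"
      using assoc_mult_mat_vec[OF cB cE kc[OF wc]] by simp
    also have "\<dots> = a \<cdot>\<^sub>v ((E * pauli_mat (q # r)) *\<^sub>v ket w)"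
      unfolding eq using smult_mat_mult_vec[OF mult_carrier_mat[OF cE cM] kc[OF wc]] .
    also have "(E * pauli_mat (q # r)) *\<^sub>v ket w = E *\<^sub>v (pauli_mat (q # r) *\<^sub>v ket w)"
      by (rule assoc_mult_mat_vec[OF cE cM kc[OF wc]])
    also have "pauli_mat (q # r) *\<^sub>v ket w =
        (pauli_phase (q # r) * bsign (z_bit q * x $ 0)) \<cdot>\<^sub>v ket ((x + y) @\<^sub>v 0\<^sub>v (n - 1))"
      unfolding pauli_mat_mult_ket_eq[OF lqr wc] zw wy ..
    also have "E *\<^sub>v \<dots> = (pauli_phase (q # r) * bsign (z_bit q * x $ 0)) \<cdot>\<^sub>v
        (E *\<^sub>v ket ((x + y) @\<^sub>v 0\<^sub>v (n - 1)))"
      by (rule mult_mat_vec[OF cE kc]) (use wy wc lqr x_part_carrier in \<open>metis add_carrier_vec\<close>)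
    also have "a \<cdot>\<^sub>v \<dots> = c x \<cdot>\<^sub>v (E *\<^sub>v ket ((x + y) @\<^sub>v 0\<^sub>v (n - 1)))"
      unfolding c_def by (rule smult_smult_assoc)
    finally show ?thesis
      using K(2)[OF x] K(2)[OF xy] unfolding logical_state_def w_def by simp
  qed
  have sub: "K x \<subseteq> carrier_vec n" "K x \<noteq> {}" if "x \<in> carrier_vec 1" for x
    using K(4)[OF that] C1(1) by auto
  have shift: "v + x_part B \<in> K (x + y)"
    and phase: "pauli_phase B * bsign (z_part B \<bullet> v) = c x"
    if x: "x \<in> carrier_vec 1" and v: "v \<in> K x" for x v
    using pauli_mat_coset_stateD[OF B sub[OF x] sub c0 act[OF x]] x y v by auto
  have xB: "x_part B \<in> carrier_vec n" and zB: "z_part B \<in> carrier_vec n" using B by simp_all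
  \<comment> \<open>One coset suffices for the conditions on \<open>x_part B\<close> and for
    \<open>z_part B \<in> C1\<close>; both cosets are compared only for
    \<open>z_part B \<in> C2\<close>.\<close>
  let ?o = "0\<^sub>v 1 :: bit vec"
  obtain w where w: "w \<in> C1" "K ?o = coset C2 w" using K(3)[of ?o] by auto
  have wc: "w \<in> carrier_vec n" by (rule carrier1[OF w(1)])
  have wK: "w \<in> K ?o" unfolding w(2) using mem_coset_iff[OF wc wc] bit_vec_add_self[OF wc] C2(2) by simp
  have wx: "w + x_part B \<in> K (?o + y)" by (rule shift[OF _ wK]) simp
  then have wx1: "w + x_part B \<in> C1" using K(4)[of "?o + y"] y by auto
  have wwx: "w + (w + x_part B) = x_part B" by (rule bit_vec_add_swap(1)[OF wc xB])
  show "x_part B \<in> C1" using C1(3)[OF w(1) wx1] unfolding wwx .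
  show zC1: "z_part B \<in> C1"
  proof -
    have "u \<bullet> z_part B = 0" if u: "u \<in> C2" for u
    proof -
      have uc: "u \<in> carrier_vec n" by (rule carrier2[OF u])
      have "w + u \<in> K ?o" unfolding w(2) coset_def using u by blast
      from phase[OF _ this] phase[OF _ wK]
      have "pauli_phase B * bsign (z_part B \<bullet> (w + u)) = pauli_phase B * bsign (z_part B \<bullet> w)" by simp
      then have "z_part B \<bullet> (w + u) = z_part B \<bullet> w" by (simp add: bsign_eq_iff)
      then have "z_part B \<bullet> u = 0" unfolding scalar_prod_add_distrib[OF zB wc uc]
        by (simp only: add_cancel_left_right)
      then show ?thesis using comm_scalar_prod[OF zB uc] by simp
    qed
    then show ?thesis using mem_C1_iff zB by blast
  qed
  show "x_part B \<in> C2" if q: "q \<in> {PI, PZ}"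
  proof -
    have "?o + y = ?o" using q by (intro eq_vecI) (auto simp: y_def)
    then have "w + x_part B \<in> coset C2 w" using wx w(2) by simp
    then have "(w + x_part B) + w \<in> C2" using mem_coset_iff[of "w + x_part B" w] wc xB by simp
    also have "(w + x_part B) + w = x_part B" by (rule bit_vec_add_swap(2)[OF wc xB])
    finally show ?thesis .
  qed
  show "z_part B \<in> C2" if q: "q \<in> {PI, PX}"
  proof -
    have c: "c x = a * pauli_phase (q # r)" for x using q by (auto simp: c_def)
    have all: "pauli_phase B * bsign (z_part B \<bullet> v) = a * pauli_phase (q # r)" if "v \<in> C1" for v
      using K(5)[OF that] phase c by auto
    have z0: "z_part B \<bullet> 0\<^sub>v n = 0" using zB by simp
    have "v \<bullet> z_part B = 0" if v: "v \<in> C1" for v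
    proof -
      have "bsign (z_part B \<bullet> v) = bsign (z_part B \<bullet> 0\<^sub>v n)"
        using all[OF v] all[OF C1(2)] by (metis mult_left_cancel pauli_phase_nonzero)
      then have "z_part B \<bullet> v = 0" unfolding bsign_eq_iff z0 .
      then show ?thesis using comm_scalar_prod[OF zB carrier1[OF v]] by simp
    qed
    then show ?thesis using mem_C2_iff zB by blast
  qed
qed

text \<open>With \<open>z_part B\<close> orthogonal to \<open>C1\<close> no sign arises, and
  \<open>x_part B\<close> merely translates cosets. This serves both to recognise benign operators
  and to bound the distance.\<close>

lemma pauli_mat_mult_logical:
  assumes B: "length B = n" and x: "x_part B \<in> C1" and z: "z_part B \<in> C2"
  obtains K where "bij_betw K (carrier_vec 1) (coset C2 ` C1)"
    "\<And>x. x \<in> carrier_vec 1 \<Longrightarrow> logical_state n 1 E x = coset_state n (K x)"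
    "\<And>x w. x \<in> carrier_vec 1 \<Longrightarrow> w \<in> C1 \<Longrightarrow> K x = coset C2 w \<Longrightarrow>
      pauli_mat B *\<^sub>v coset_state n (K x) = pauli_phase B \<cdot>\<^sub>v coset_state n (coset C2 (w + x_part B))"
proof -
  obtain K where K: "bij_betw K (carrier_vec 1) (coset C2 ` C1)"
    "\<And>x. x \<in> carrier_vec 1 \<Longrightarrow> logical_state n 1 E x = coset_state n (K x)"
    "\<And>x. x \<in> carrier_vec 1 \<Longrightarrow> \<exists>w\<in>C1. K x = coset C2 w"
    "\<And>x. x \<in> carrier_vec 1 \<Longrightarrow> K x \<subseteq> C1 \<and> K x \<noteq> {}"
    "\<And>v. v \<in> C1 \<Longrightarrow> \<exists>x\<in>carrier_vec 1. v \<in> K x"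
    by (rule logical_stateE) blast
  have "pauli_mat B *\<^sub>v coset_state n (K x) = pauli_phase B \<cdot>\<^sub>v coset_state n (coset C2 (w + x_part B))"
    if x: "x \<in> carrier_vec 1" and w: "w \<in> C1" "K x = coset C2 w" for x w
  proof (rule pauli_mat_coset_stateI[OF B])
    show "K x \<subseteq> carrier_vec n" using K(4)[OF x] C1(1) by auto
    have wc: "w \<in> carrier_vec n" and xc: "x_part B \<in> carrier_vec n" using carrier1[OF w(1)] B by simp_all
    have "w + x_part B + c = w + c + x_part B" if "c \<in> C2" for c
      by (rule bit_vec_add_swap(3)[OF wc xc carrier2[OF that]])
    then show "coset C2 (w + x_part B) = (\<lambda>v. v + x_part B) ` K x"
      unfolding w(2) coset_def image_image by (intro image_cong) auto
    fix v assume "v \<in> K x"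
    then have v: "v \<in> C1" using K(4)[OF x] by auto
    show "z_part B \<bullet> v = 0"
      using orthogonal[OF v z] comm_scalar_prod[OF carrier1[OF v] carrier2[OF z]] by simp
  qed
  with K(1,2) show thesis by (rule that)
qed

text \<open>Translation by \<open>x_part B \<in> C2\<close> maps each coset to itself; dividing by
  \<open>pauli_phase B\<close> gives a single representative that fixes both logical basis
  states.\<close>

lemma benignI:
  assumes B: "length B = n" "B \<noteq> pauli_id n" and x: "x_part B \<in> C2" and z: "z_part B \<in> C2"
  shows "benign n 1 E B"
proof -
  have xC1: "x_part B \<in> C1" using x C2_sub by auto
  obtain K where K: "bij_betw K (carrier_vec 1) (coset C2 ` C1)"
    "\<And>x. x \<in> carrier_vec 1 \<Longrightarrow> logical_state n 1 E x = coset_state n (K x)"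
    "\<And>x w. x \<in> carrier_vec 1 \<Longrightarrow> w \<in> C1 \<Longrightarrow> K x = coset C2 w \<Longrightarrow>
      pauli_mat B *\<^sub>v coset_state n (K x) = pauli_phase B \<cdot>\<^sub>v coset_state n (coset C2 (w + x_part B))"
    by (rule pauli_mat_mult_logical[OF B(1) xC1 z]) blast
  let ?c = "1 / pauli_phase B"
  have "(?c \<cdot>\<^sub>m pauli_mat B) *\<^sub>v logical_state n 1 E x = logical_state n 1 E x"
    if x': "x \<in> carrier_vec 1" for x
  proof -
    obtain w where w: "w \<in> C1" "K x = coset C2 w" using bij_betwE[OF K(1)] x' by blast
    have wc: "w \<in> carrier_vec n" by (rule carrier1[OF w(1)])
    have xc: "x_part B \<in> carrier_vec n" by (rule carrier2[OF x])
    have "w + x_part B + w = x_part B" by (rule bit_vec_add_swap(2)[OF wc xc])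
    then have "coset C2 (w + x_part B) = coset C2 w"
      using coset_eq_iff[of "w + x_part B" w] wc xc x by simp
    then have e: "pauli_mat B *\<^sub>v coset_state n (K x) = pauli_phase B \<cdot>\<^sub>v coset_state n (K x)"
      using K(3)[OF x' w] w(2) by simp
    have "coset_state n (K x) \<in> carrier_vec (2 ^ n)" by (rule carrier_vecI) (simp add: coset_state_def)
    then have "(?c \<cdot>\<^sub>m pauli_mat B) *\<^sub>v coset_state n (K x) = ?c \<cdot>\<^sub>v (pauli_mat B *\<^sub>v coset_state n (K x))"
      by (rule smult_mat_mult_vec[OF pauli_mat_carrier[OF B(1)]])
    also have "\<dots> = coset_state n (K x)" unfolding e smult_smult_assoc by simp
    finally show ?thesis using K(2)[OF x'] by simp
  qed
  moreover have "cmod ?c = 1" by (simp add: norm_divide)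
  ultimately show ?thesis using B unfolding benign_def paulis_def by blast
qed

text \<open>Since \<open>x_part B\<close> lies outside \<open>C2\<close>, the coset of
  \<open>w\<close> moves to a different one, so \<open>B\<close> carries the label \<open>0\<close>
  to a label \<open>y \<noteq> 0\<close>.\<close>

lemma code_distance_le:
  assumes B: "length B = n" and x: "x_part B \<in> C1" "x_part B \<notin> C2" and z: "z_part B \<in> C2"
  shows "code_distance n 1 E \<le> enat (pauli_weight B)"
proof -
  obtain K where K: "bij_betw K (carrier_vec 1) (coset C2 ` C1)"
    "\<And>x. x \<in> carrier_vec 1 \<Longrightarrow> logical_state n 1 E x = coset_state n (K x)"
    "\<And>x w. x \<in> carrier_vec 1 \<Longrightarrow> w \<in> C1 \<Longrightarrow> K x = coset C2 w \<Longrightarrow>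
      pauli_mat B *\<^sub>v coset_state n (K x) = pauli_phase B \<cdot>\<^sub>v coset_state n (coset C2 (w + x_part B))"
    by (rule pauli_mat_mult_logical[OF B(1) x(1) z]) blast
  let ?c = "1 / pauli_phase B" and ?o = "0\<^sub>v 1 :: bit vec"
  have o: "?o \<in> carrier_vec 1" by simp
  obtain w where w: "w \<in> C1" "K ?o = coset C2 w" using bij_betwE[OF K(1)] o by blast
  have wc: "w \<in> carrier_vec n" by (rule carrier1[OF w(1)])
  have xc: "x_part B \<in> carrier_vec n" by (rule carrier1[OF x(1)])
  have "coset C2 (w + x_part B) \<in> K ` carrier_vec 1"
    using K(1) C1(3)[OF w(1) x(1)] by (auto simp: bij_betw_def)
  then obtain y where y: "y \<in> carrier_vec 1" "K y = coset C2 (w + x_part B)" by auto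
  have "w + x_part B + w = x_part B" by (rule bit_vec_add_swap(2)[OF wc xc])
  then have "K y \<noteq> K ?o"
    unfolding y(2) w(2) using coset_eq_iff[of "w + x_part B" w] wc xc x(2) by simp
  then have ne: "?o \<noteq> y" by auto
  have "coset_state n (K ?o) \<in> carrier_vec (2 ^ n)" by (rule carrier_vecI) (simp add: coset_state_def)
  then have "(?c \<cdot>\<^sub>m pauli_mat B) *\<^sub>v coset_state n (K ?o) = ?c \<cdot>\<^sub>v (pauli_mat B *\<^sub>v coset_state n (K ?o))"
    by (rule smult_mat_mult_vec[OF pauli_mat_carrier[OF B(1)]])
  also have "\<dots> = coset_state n (K y)" unfolding K(3)[OF o w] y(2) smult_smult_assoc by simp
  finally have e: "(?c \<cdot>\<^sub>m pauli_mat B) *\<^sub>v logical_state n 1 E ?o = logical_state n 1 E y"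
    using K(2)[OF o] K(2)[OF y(1)] by simp
  have "cmod ?c = 1" by (simp add: norm_divide)
  with e ne o y(1) B show ?thesis
    unfolding code_distance_def paulis_def by (intro Inf_lower) blast
qed

lemma benign_distance_le:
  assumes "benign n 1 E B"
  shows "benign_distance n 1 E \<le> enat (pauli_weight B)"
  using assms unfolding benign_distance_def by (intro Inf_lower) blast

section \<open>Minimum weight of a nonidentity operator with both parts in \<open>C1\<close>\<close>

lemma x_part_X_type: "u \<in> carrier_vec n \<Longrightarrow> x_part (X_type u) = u"
  by (intro eq_vecI) (auto simp: x_part_def X_type_def)

lemma z_part_X_type: "u \<in> carrier_vec n \<Longrightarrow> z_part (X_type u) = 0\<^sub>v n"
  by (intro eq_vecI) (auto simp: z_part_def X_type_def)

lemma length_X_type: "u \<in> carrier_vec n \<Longrightarrow> length (X_type u) = n"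
  by (simp add: X_type_def)

lemma pauli_weight_X_type_le:
  assumes "u \<in> carrier_vec n" "length B = n" "\<And>p. p < n \<Longrightarrow> u $ p = 1 \<Longrightarrow> B ! p \<noteq> PI"
  shows "pauli_weight (X_type u) \<le> pauli_weight B"
  unfolding pauli_weight_def length_filter_conv_card
  using assms by (intro card_mono) (auto simp: X_type_def split: if_splits)

text \<open>The distance counts only operators that change the logical label, so a
  \<open>z_part\<close> outside \<open>C2\<close> gives no witness directly. As both Pauli types use
  the same codes, the X-type Pauli on the support of such a vector is one, and its weight is not
  larger. If both parts lie in \<open>C2\<close>, the operator is benign.\<close>

lemma pauli_weight_ge:
  assumes B: "length B = n" "B \<noteq> pauli_id n" and x: "x_part B \<in> C1" and z: "z_part B \<in> C1"
  shows "min (code_distance n 1 E) (benign_distance n 1 E) \<le> enat (pauli_weight B)"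
proof -
  have logical: "code_distance n 1 E \<le> enat (pauli_weight B)"
    if u: "u \<in> C1" "u \<notin> C2" and nz: "\<And>p. p < n \<Longrightarrow> u $ p = 1 \<Longrightarrow> B ! p \<noteq> PI" for u
  proof -
    have uc: "u \<in> carrier_vec n" by (rule carrier1[OF u(1)])
    have "code_distance n 1 E \<le> enat (pauli_weight (X_type u))"
      using u C2(2) x_part_X_type[OF uc] z_part_X_type[OF uc]
      by (intro code_distance_le length_X_type[OF uc]) simp_all
    also have "\<dots> \<le> enat (pauli_weight B)" using pauli_weight_X_type_le[OF uc B(1) nz] by simp
    finally show ?thesis .
  qed
  consider "x_part B \<notin> C2" | "z_part B \<notin> C2" | "x_part B \<in> C2" "z_part B \<in> C2" by blast
  then show ?thesis
  proof cases
    case 1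
    have "code_distance n 1 E \<le> enat (pauli_weight B)"
      by (rule logical[OF x 1]) (use B in \<open>auto simp: x_part_def\<close>)
    then show ?thesis by (rule min.coboundedI1)
  next
    case 2
    have "code_distance n 1 E \<le> enat (pauli_weight B)"
      by (rule logical[OF z 2]) (use B in \<open>auto simp: z_part_def\<close>)
    then show ?thesis by (rule min.coboundedI1)
  next
    case 3
    then show ?thesis using benign_distance_le[OF benignI[OF B 3]] by (rule_tac min.coboundedI2)
  qed
qed

end

section \<open>The probability that the trap code misses an error\<close>

lemma UNIV_pauli: "(UNIV :: pauli set) = {PI, PX, PY, PZ}"
  using pauli.exhaust by blast

lemma finite_pauli: "finite (UNIV :: pauli set)"
  unfolding UNIV_pauli by simp

lemma card_pauli_le: "card (UNIV :: pauli set) \<le> 4"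
  unfolding UNIV_pauli by simp

lemma paulis_eq: "paulis n = {P. set P \<subseteq> UNIV \<and> length P = n}"
  by (simp add: paulis_def)

lemma finite_paulis [simp]: "finite (paulis n)"
  unfolding paulis_eq by (rule finite_lists_length_eq[OF finite_pauli])

lemma card_paulis_le: "card (paulis n) \<le> 4 ^ n"
  unfolding paulis_eq card_lists_length_eq[OF finite_pauli] by (rule power_mono[OF card_pauli_le]) simp

lemma size_pauli_multiset:
  "size M = count M PI + count M PX + count M PY + count M PZ"
proof (induction M)
  case (add Q M)
  then show ?case by (cases Q) simp_all
qed simp

text \<open>The type lists the counts of \<open>PX\<close>, \<open>PY\<close> and \<open>PZ\<close>;
  the count of \<open>PI\<close> follows from the length. Arrangements of a multiset are thereby
  identified with the sets over which weight sparsity takes its maximum.\<close>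

lemma permutations_of_pauli_multiset:
  assumes "size M = n"
  shows "permutations_of_multiset M = paulis_of_type n (count M PX) (count M PY) (count M PZ)"
proof (intro subset_antisym subsetI)
  fix P assume "P \<in> permutations_of_multiset M"
  then have "mset P = M" by (rule permutations_of_multisetD)
  then show "P \<in> paulis_of_type n (count M PX) (count M PY) (count M PZ)"
    using assms by (auto simp: paulis_of_type_def paulis_def count_mset)
next
  fix P assume "P \<in> paulis_of_type n (count M PX) (count M PY) (count M PZ)"
  then have P: "size (mset P) = n" "count (mset P) PX = count M PX" "count (mset P) PY = count M PY"
    "count (mset P) PZ = count M PZ"
    by (auto simp: paulis_of_type_def paulis_def count_mset)
  then have "count (mset P) PI = count M PI"
    using size_pauli_multiset[of M] size_pauli_multiset[of "mset P"] assms by simp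
  with P have "mset P = M" by (intro multiset_eqI, rename_tac Q, case_tac Q) simp_all
  then show "P \<in> permutations_of_multiset M" by (rule permutations_of_multisetI)
qed

lemma card_benign_le:
  assumes M: "size M = n"
  shows "real (card ({B. benign n m V B} \<inter> permutations_of_multiset M)) \<le>
    max_benign_fraction n m V * real (card (permutations_of_multiset M))"
proof -
  define r where "r x y z = real (card (benign_of_type n m V x y z)) / real (card (paulis_of_type n x y z))"
    for x y z
  have "{r x y z | x y z. x + y + z \<le> n} \<subseteq> (\<lambda>(x, y, z). r x y z) ` ({..n} \<times> {..n} \<times> {..n})"
  proof
    fix t assume "t \<in> {r x y z | x y z. x + y + z \<le> n}"
    then obtain x y z where "t = r x y z" "x + y + z \<le> n" by blast
    then show "t \<in> (\<lambda>(x, y, z). r x y z) ` ({..n} \<times> {..n} \<times> {..n})"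
      by (intro image_eqI[of _ _ "(x, y, z)"]) simp_all
  qed
  then have fin: "finite {r x y z | x y z. x + y + z \<le> n}" by (rule finite_subset) simp
  have "count M PX + count M PY + count M PZ \<le> n" using M size_pauli_multiset[of M] by simp
  then have "r (count M PX) (count M PY) (count M PZ) \<le> max_benign_fraction n m V"
    unfolding max_benign_fraction_def r_def[symmetric] by (intro Max_ge[OF fin]) blast
  moreover have "{B. benign n m V B} \<inter> permutations_of_multiset M =
      benign_of_type n m V (count M PX) (count M PY) (count M PZ)"
    unfolding permutations_of_pauli_multiset[OF M] by (auto simp: benign_of_type_def)
  moreover have "0 < card (permutations_of_multiset M)"
    by (simp add: card_gt_0_iff)
  ultimately show ?thesis
    unfolding r_def permutations_of_pauli_multiset[OF M, symmetric] by (simp add: pos_divide_le_eq)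
qed

text \<open>An injective relabelling of letters is a bijection between the arrangements of
  \<open>M\<close> and those of its image; the image may have a different type, which the maximum
  over all types absorbs.\<close>

lemma card_map_benign_le:
  fixes g :: "pauli \<Rightarrow> pauli"
  assumes M: "size M = n" and g: "inj g"
  shows "real (card ({B. benign n m V (map g B)} \<inter> permutations_of_multiset M)) \<le>
    max_benign_fraction n m V * real (card (permutations_of_multiset M))"
proof -
  have inj: "inj (map g)" using g by simp
  have img: "map g ` permutations_of_multiset M = permutations_of_multiset (image_mset g M)"
    by (rule permutations_of_multiset_image[symmetric])
  have "card ({B. benign n m V (map g B)} \<inter> permutations_of_multiset M) =
      card (map g ` ({B. benign n m V (map g B)} \<inter> permutations_of_multiset M))"
    by (rule card_image[symmetric]) (rule inj_on_subset[OF inj], simp)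
  also have "map g ` ({B. benign n m V (map g B)} \<inter> permutations_of_multiset M) =
      {B. benign n m V B} \<inter> permutations_of_multiset (image_mset g M)"
    unfolding img[symmetric] by auto
  also have "real (card \<dots>) \<le>
      max_benign_fraction n m V * real (card (permutations_of_multiset (image_mset g M)))"
    by (rule card_benign_le) (simp add: M)
  also have "card (permutations_of_multiset (image_mset g M)) = card (permutations_of_multiset M)"
    unfolding img[symmetric] by (rule card_image) (rule inj_on_subset[OF inj], simp)
  finally show ?thesis .
qed

text \<open>Multiplication of a letter by \<open>X\<close> modulo phase. Applied to all letters it
  multiplies by \<open>X^n\<close>, which brings an x-part in the nontrivial coset back into
  \<open>C2\<close>.\<close>

fun mul_x :: "pauli \<Rightarrow> pauli" where
  "mul_x PI = PX" | "mul_x PX = PI" | "mul_x PY = PZ" | "mul_x PZ = PY"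

fun mul_z :: "pauli \<Rightarrow> pauli" where
  "mul_z PI = PZ" | "mul_z PX = PY" | "mul_z PY = PX" | "mul_z PZ = PI"

lemma mul_involution [simp]: "mul_x (mul_x Q) = Q" "mul_z (mul_z Q) = Q"
  by (cases Q; simp)+

lemma inj_mul: "inj mul_x" "inj mul_z"
  by (metis injI mul_involution)+

lemma pauli_weight_mset: "pauli_weight P = size {#Q \<in># mset P. Q \<noteq> PI#}"
  by (simp add: pauli_weight_def flip: mset_filter)

text \<open>The same expression as in \<open>strong_purity_testing\<close> with
  \<open>t = 3 * n - 1\<close>, so that it can be folded there.\<close>

definition undetected_fraction :: "nat \<Rightarrow> complex mat \<Rightarrow> pauli list \<Rightarrow> real" where
  "undetected_fraction n E P =
     real (card {k \<in> {k. k permutes {..<3 * n}}. \<exists>Q\<in>paulis 1. \<exists>R\<in>paulis (3 * n - 1). set R \<subseteq> {PI, PZ} \<and>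
       eq_up_to_phase (mat_adjoint (strong_trap_code n E k) * pauli_mat P * strong_trap_code n E k)
         (pauli_mat (Q @ R))})
     / real (card {k. k permutes {..<3 * n}})"

section \<open>From random permutations to accepted arrangements\<close>

context weakly_self_dual
begin

text \<open>A necessary condition for \<open>L\<close> to go undetected, stated without matrices; an
  upper bound on the error requires no converse.\<close>

definition passes :: "pauli list \<Rightarrow> bool" where
  "passes L \<longleftrightarrow>
     x_part (take n L) \<in> C1 \<and> z_part (take n L) \<in> C1 \<and>
     x_part (take n (drop n L)) \<in> C2 \<and> z_part (take n (drop n L)) \<in> C1 \<and>
     x_part (take n (drop (2 * n) L)) \<in> C1 \<and> z_part (take n (drop (2 * n) L)) \<in> C2"

lemma undetected_passes:
  assumes k: "k permutes {..<3 * n}" and P: "length P = 3 * n"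
    and Q: "Q \<in> paulis 1" and R: "R \<in> paulis (3 * n - 1)" "set R \<subseteq> {PI, PZ}"
    and eq: "eq_up_to_phase (mat_adjoint (strong_trap_code n E k) * pauli_mat P * strong_trap_code n E k)
      (pauli_mat (Q @ R))"
  shows "passes (permute_list k P)"
proof -
  let ?L = "permute_list k P"
  have l: "length Q = 1" "length R = 3 * n - 1" using Q R by (simp_all add: paulis_def)
  obtain q1 r1 a1 q2 r2 a2 q3 r3 a3 where b:
    "pauli_mat (take n ?L) * E = a1 \<cdot>\<^sub>m (E * pauli_mat (q1 # r1))" "a1 \<noteq> 0"
    "length r1 = n - 1" "set r1 \<subseteq> {PI, PZ}"
    "pauli_mat (take n (drop n ?L)) * E = a2 \<cdot>\<^sub>m (E * pauli_mat (q2 # r2))" "a2 \<noteq> 0"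
    "length r2 = n - 1" "set r2 \<subseteq> {PI, PZ}" "q2 \<in> {PI, PZ}"
    "pauli_mat (take n (drop (2 * n) ?L)) * E = a3 \<cdot>\<^sub>m (E * pauli_mat (q3 # r3))" "a3 \<noteq> 0"
    "length r3 = n - 1" "set r3 \<subseteq> {PI, PZ}" "q3 \<in> {PI, PX}"
    by (rule strong_trap_code_blocks[OF unitary_E n_pos k P l R(2) eq])
  have len: "length (take n ?L) = n" "length (take n (drop n ?L)) = n"
    "length (take n (drop (2 * n) ?L)) = n"
    using P by simp_all
  show ?thesis
    unfolding passes_def
    using undetectedD(1,2)[OF len(1) b(3,4,2,1)] undetectedD(2)[OF len(2) b(7,8,6,5)]
      undetectedD(3)[OF len(2) b(7,8,6,5) b(9)] undetectedD(1)[OF len(3) b(12,13,11,10)]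
      undetectedD(4)[OF len(3) b(12,13,11,10) b(14)] by blast
qed

text \<open>By \<open>card_permute_list_vimage\<close>, a uniform permutation induces the uniform
  distribution on the distinct arrangements of \<open>P\<close>, to which the counting lemmas
  apply.\<close>

lemma undetected_fraction_le:
  assumes P: "length P = 3 * n"
  shows "undetected_fraction n E P \<le>
    real (card {L \<in> permutations_of_multiset (mset P). passes L}) /
    real (card (permutations_of_multiset (mset P)))"
proof -
  let ?A = "permutations_of_multiset (mset P)" and ?K = "{k. k permutes {..<3 * n}}"
  let ?U = "{k. k permutes {..<length P} \<and> permute_list k P \<in> {L. passes L}}"
  have finK: "finite ?K" by (simp add: finite_permutations)
  have cK: "card ?K = fact (3 * n)" by (rule card_permutations) simp_all
  have cA: "0 < card ?A" by (simp add: card_gt_0_iff)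
  have "{k \<in> ?K. \<exists>Q\<in>paulis 1. \<exists>R\<in>paulis (3 * n - 1). set R \<subseteq> {PI, PZ} \<and>
       eq_up_to_phase (mat_adjoint (strong_trap_code n E k) * pauli_mat P * strong_trap_code n E k)
         (pauli_mat (Q @ R))} \<subseteq> ?U"
    using undetected_passes[OF _ P] unfolding P by blast
  then have "card {k \<in> ?K. \<exists>Q\<in>paulis 1. \<exists>R\<in>paulis (3 * n - 1). set R \<subseteq> {PI, PZ} \<and>
       eq_up_to_phase (mat_adjoint (strong_trap_code n E k) * pauli_mat P * strong_trap_code n E k)
         (pauli_mat (Q @ R))} \<le> card ?U"
    by (rule card_mono[rotated]) (use finK P in simp)
  then have "undetected_fraction n E P \<le> real (card ?U) / real (card ?K)"
    unfolding undetected_fraction_def by (intro divide_right_mono) simp_all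
  also have "real (card ?U) / real (card ?K) = real (card ({L. passes L} \<inter> ?A)) / real (card ?A)"
  proof -
    have "card ?U * card ?A = card ({L. passes L} \<inter> ?A) * card ?K"
      using card_permute_list_vimage[of P "{L. passes L}"] unfolding P cK by (simp only: mult.commute)
    then have "real (card ?U) * real (card ?A) = real (card ({L. passes L} \<inter> ?A)) * real (card ?K)"
      by (simp only: of_nat_mult[symmetric])
    moreover have "real (card ?K) \<noteq> 0" "real (card ?A) \<noteq> 0" using cA unfolding cK by simp_all
    ultimately show ?thesis by (simp only: frac_eq_eq not_False_eq_True)
  qed
  also have "{L. passes L} \<inter> ?A = {L \<in> ?A. passes L}" by blast
  finally show ?thesis .
qed

lemma parts_mul:
  assumes "length B = n"
  shows "x_part (map mul_z B) = x_part B" "z_part (map mul_z B) = z_part B + one"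
    "x_part (map mul_x B) = x_part B + one" "z_part (map mul_x B) = z_part B"
proof -
  have "x_bit (mul_z Q) = x_bit Q" "z_bit (mul_z Q) = z_bit Q + 1"
    "x_bit (mul_x Q) = x_bit Q + 1" "z_bit (mul_x Q) = z_bit Q" for Q
    by (cases Q; simp)+
  then show "x_part (map mul_z B) = x_part B" "z_part (map mul_z B) = z_part B + one"
    "x_part (map mul_x B) = x_part B + one" "z_part (map mul_x B) = z_part B"
    unfolding x_part_def z_part_def one_def using assms by (auto intro!: eq_vecI)
qed

lemma benign_or_id:
  assumes "length B = n" "x_part B \<in> C2" "z_part B \<in> C2"
  shows "benign n 1 E B \<or> B = replicate n PI"
  using benignI[OF assms(1) _ assms(2,3)] unfolding pauli_id_def by blast

text \<open>\<open>Z\<^sup>n\<close> and \<open>X\<^sup>n\<close> are logical operators, so multiplying by them turns a logical \<open>Z\<close> or \<open>X\<close>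
  into a benign operator or the identity.\<close>

lemma block_Z_cases:
  assumes B: "length B = n" "x_part B \<in> C2" "z_part B \<in> C1"
  shows "benign n 1 E B \<or> benign n 1 E (map mul_z B) \<or> B = replicate n PI \<or> B = replicate n PZ"
proof (cases "z_part B \<in> C2")
  case True
  then show ?thesis using benign_or_id[OF B(1,2)] by blast
next
  case False
  have "map mul_z (map mul_z B) = B" by (simp add: comp_def)
  moreover have "z_part B + one \<in> C2" using mem_C1_cases[OF B(3)] False by blast
  then have "benign n 1 E (map mul_z B) \<or> map mul_z B = replicate n PI"
    by (intro benign_or_id) (simp_all only: parts_mul[OF B(1)] length_map B)
  moreover have "map mul_z (replicate n PI) = replicate n PZ" by simp
  ultimately show ?thesis by metis
qed

lemma block_X_cases:
  assumes B: "length B = n" "x_part B \<in> C1" "z_part B \<in> C2"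
  shows "benign n 1 E B \<or> benign n 1 E (map mul_x B) \<or> B = replicate n PI \<or> B = replicate n PX"
proof (cases "x_part B \<in> C2")
  case True
  then show ?thesis using benign_or_id[OF B(1) True B(3)] by blast
next
  case False
  have "map mul_x (map mul_x B) = B" by (simp add: comp_def)
  moreover have "x_part B + one \<in> C2" using mem_C1_cases[OF B(2)] False by blast
  then have "benign n 1 E (map mul_x B) \<or> map mul_x B = replicate n PI"
    by (intro benign_or_id) (simp_all only: parts_mul[OF B(1)] length_map B)
  moreover have "map mul_x (replicate n PI) = replicate n PX" by simp
  ultimately show ?thesis by metis
qed

section \<open>Counting accepted arrangements\<close>

lemma card_benign_Un_le:
  assumes M: "size M = n" and g: "inj g"
  shows "real (card (({B. benign n 1 E B} \<union> {B. benign n 1 E (map g B)}) \<inter> permutations_of_multiset M))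
    \<le> 2 * max_benign_fraction n 1 E * real (card (permutations_of_multiset M))"
proof -
  let ?A = "permutations_of_multiset M"
  have "card (({B. benign n 1 E B} \<union> {B. benign n 1 E (map g B)}) \<inter> ?A) \<le>
      card ({B. benign n 1 E B} \<inter> ?A) + card ({B. benign n 1 E (map g B)} \<inter> ?A)"
    unfolding Int_Un_distrib2 by (rule card_Un_le)
  then show ?thesis
    using card_benign_le[OF M, of 1 E] card_map_benign_le[OF M g, of 1 E] by linarith
qed

text \<open>Given the multiset \<open>N\<close> on the last \<open>2 * n\<close> places, either the
  pattern is not an arrangement of \<open>N\<close>, or it is one of at least \<open>2^n\<close>
  equally likely ones. Different letters are essential: equal letters would leave a single
  arrangement.\<close>

lemma card_constant_blocks_le:
  fixes a b :: 'a
  assumes M: "size M = 3 * n" and ab: "a \<noteq> b"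
  shows "real (card {L \<in> permutations_of_multiset M.
      take (2 * n) (drop n L) \<in> {replicate n a @ replicate n b}}) \<le>
    1 / 2 ^ n * real (card (permutations_of_multiset M))"
proof (rule card_permutations_of_multiset_block_le)
  show "n + 2 * n \<le> size M" using M by simp
  fix N :: "'a multiset" assume "size N = 2 * n"
  show "real (card ({replicate n a @ replicate n b} \<inter> permutations_of_multiset N)) \<le>
      1 / 2 ^ n * real (card (permutations_of_multiset N))"
  proof (cases "mset (replicate n a @ replicate n b) = N")
    case True
    have "card ({replicate n a @ replicate n b} \<inter> permutations_of_multiset N) \<le>
        card {replicate n a @ replicate n b}"
      by (rule card_mono) auto
    then have "real (card ({replicate n a @ replicate n b} \<inter> permutations_of_multiset N)) \<le> 1" by simp
    also have "real (2 ^ n) \<le> real (card (permutations_of_multiset N))"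
      using two_power_le_card_permutations_of_multiset[OF ab, of n] unfolding True
      by (simp only: of_nat_le_iff)
    then have "1 \<le> 1 / 2 ^ n * real (card (permutations_of_multiset N))"
      by (simp add: field_simps)
    finally show ?thesis .
  next
    case False
    then have "{replicate n a @ replicate n b} \<inter> permutations_of_multiset N = {}"
      by (auto dest: permutations_of_multisetD)
    then show ?thesis by (simp only: card.empty) simp
  qed
qed

text \<open>All errors sit in the first block, so its weight is the number of nonidentity letters of
  \<open>M\<close>. If this is at least \<open>w\<close>, the bound for a constant suffix applies;
  if it is smaller, no arrangement passes.\<close>

lemma card_first_block_le:
  assumes M: "size M = 3 * n" and nt: "M \<noteq> replicate_mset (3 * n) PI"
    and w: "enat w \<le> min (code_distance n 1 E) (benign_distance n 1 E)"
  shows "real (card {L \<in> permutations_of_multiset M. passes L \<and> drop n L = replicate (2 * n) PI}) \<le>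
    1 / 2 ^ w * real (card (permutations_of_multiset M))"
proof -
  let ?A = "permutations_of_multiset M"
  let ?v = "size {#Q \<in># M. Q \<noteq> PI#}"
  have weight: "w \<le> ?v" if L: "L \<in> ?A" "passes L" "drop n L = replicate (2 * n) PI" for L
  proof -
    let ?B = "take n L"
    have mL: "mset L = M" using L(1) by (rule permutations_of_multisetD)
    then have len: "length ?B = n" using M size_mset[of L] by simp
    have e: "M = mset ?B + replicate_mset (2 * n) PI"
      unfolding mL[symmetric] using L(3) by (metis append_take_drop_id mset_append mset_replicate)
    have "?B \<noteq> pauli_id n"
    proof
      assume "?B = pauli_id n"
      with e have "M = replicate_mset n PI + replicate_mset (2 * n) PI" by (simp add: pauli_id_def)
      then have "M = replicate_mset (3 * n) PI" by (intro multiset_eqI) simp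
      with nt show False by simp
    qed
    then have "min (code_distance n 1 E) (benign_distance n 1 E) \<le> enat (pauli_weight ?B)"
      using L(2) unfolding passes_def by (intro pauli_weight_ge[OF len]) blast+
    with w have "enat w \<le> enat (pauli_weight ?B)" by (rule order_trans)
    moreover have "{#Q \<in># M. Q \<noteq> PI#} = {#Q \<in># mset ?B. Q \<noteq> PI#}"
      by (subst e) simp
    ultimately show ?thesis by (simp add: pauli_weight_mset)
  qed
  show ?thesis
  proof (cases "w \<le> ?v")
    case True
    have "2 ^ w * card {L \<in> ?A. passes L \<and> drop n L = replicate (2 * n) PI} \<le>
        2 ^ ?v * card {L \<in> ?A. drop n L = replicate (2 * n) PI}"
      using True by (intro mult_le_mono power_increasing card_mono) auto
    also have "\<dots> \<le> card ?A" by (rule card_permutations_of_multiset_constant_suffix_le[OF M])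
    finally have "real (2 ^ w * card {L \<in> ?A. passes L \<and> drop n L = replicate (2 * n) PI}) \<le> real (card ?A)"
      by (simp only: of_nat_le_iff)
    then show ?thesis by (simp add: field_simps)
  next
    case False
    then have "{L \<in> ?A. passes L \<and> drop n L = replicate (2 * n) PI} = {}" using weight by blast
    then show ?thesis by (simp only: card.empty) simp
  qed
qed

text \<open>Union bound. The \<open>4\<close> counts two trap blocks, each benign directly or after
  multiplication by \<open>Z^n\<close> or \<open>X^n\<close>; the \<open>3\<close> counts the
  constant pairs \<open>Z, I\<close>, \<open>I, X\<close> and \<open>Z, X\<close>; the last term is
  the pair \<open>I, I\<close>.\<close>

lemma card_passes_le:
  assumes M: "size M = 3 * n" and nt: "M \<noteq> replicate_mset (3 * n) PI"
    and w: "enat w \<le> min (code_distance n 1 E) (benign_distance n 1 E)"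
  shows "real (card {L \<in> permutations_of_multiset M. passes L}) \<le>
    (4 * max_benign_fraction n 1 E + 3 / 2 ^ n + 1 / 2 ^ w) * real (card (permutations_of_multiset M))"
proof -
  let ?A = "permutations_of_multiset M"
  let ?f = "max_benign_fraction n 1 E"
  let ?S = "\<lambda>g. {B. benign n 1 E B} \<union> {B. benign n 1 E (map g B)}"
  let ?T2 = "{L \<in> ?A. take n (drop n L) \<in> ?S mul_z}"
  let ?T3 = "{L \<in> ?A. take n (drop (2 * n) L) \<in> ?S mul_x}"
  let ?R = "\<lambda>a b. {L \<in> ?A. take (2 * n) (drop n L) \<in> {replicate n a @ replicate n b}}"
  let ?I = "{L \<in> ?A. passes L \<and> drop n L = replicate (2 * n) PI}"
  have T2: "real (card ?T2) \<le> 2 * ?f * real (card ?A)"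
    by (rule card_permutations_of_multiset_block_le)
      (use M in simp, rule card_benign_Un_le[OF _ inj_mul(2)])
  have T3: "real (card ?T3) \<le> 2 * ?f * real (card ?A)"
    by (rule card_permutations_of_multiset_block_le)
      (use M in simp, rule card_benign_Un_le[OF _ inj_mul(1)])
  have R: "real (card (?R a b)) \<le> 1 / 2 ^ n * real (card ?A)" if "a \<noteq> b" for a b
    by (rule card_constant_blocks_le[OF M that])
  have I: "real (card ?I) \<le> 1 / 2 ^ w * real (card ?A)"
    by (rule card_first_block_le[OF M nt w])
  have "{L \<in> ?A. passes L} \<subseteq> ?T2 \<union> (?T3 \<union> (?R PZ PI \<union> (?R PI PX \<union> (?R PZ PX \<union> ?I))))"
  proof
    fix L assume "L \<in> {L \<in> ?A. passes L}"
    then have L: "L \<in> ?A" "passes L" by auto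
    have len: "length L = 3 * n" using L(1) M by (metis permutations_of_multisetD size_mset)
    let ?B2 = "take n (drop n L)" and ?B3 = "take n (drop (2 * n) L)"
    have l: "length ?B2 = n" "length ?B3 = n" using len by simp_all
    have d: "drop n L = ?B2 @ ?B3"
    proof -
      have "?B3 = drop n (drop n L)" using len by (simp add: mult_2)
      then show ?thesis by (simp only: append_take_drop_id)
    qed
    then have t: "take (2 * n) (drop n L) = ?B2 @ ?B3" using len by simp
    have r: "replicate (2 * n) PI = replicate n PI @ replicate n PI"
      unfolding mult_2 by (rule replicate_add)
    from L(2) have p: "x_part ?B2 \<in> C2" "z_part ?B2 \<in> C1" "x_part ?B3 \<in> C1" "z_part ?B3 \<in> C2"
      unfolding passes_def by blast+
    consider "?B2 \<in> ?S mul_z" | "?B3 \<in> ?S mul_x"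
      | "?B2 = replicate n PZ" "?B3 = replicate n PI" | "?B2 = replicate n PI" "?B3 = replicate n PX"
      | "?B2 = replicate n PZ" "?B3 = replicate n PX" | "?B2 = replicate n PI" "?B3 = replicate n PI"
      using block_Z_cases[OF l(1) p(1,2)] block_X_cases[OF l(2) p(3,4)] by blast
    then show "L \<in> ?T2 \<union> (?T3 \<union> (?R PZ PI \<union> (?R PI PX \<union> (?R PZ PX \<union> ?I))))"
    proof cases
      case 1 then show ?thesis using L by blast
    next
      case 2 then show ?thesis using L by blast
    next
      case 3
      have "L \<in> ?R PZ PI" using L(1) t unfolding 3 by blast
      then show ?thesis by blast
    next
      case 4
      have "L \<in> ?R PI PX" using L(1) t unfolding 4 by blast
      then show ?thesis by blast
    next
      case 5
      have "L \<in> ?R PZ PX" using L(1) t unfolding 5 by blast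
      then show ?thesis by blast
    next
      case 6
      have "L \<in> ?I" using L d unfolding 6 r by blast
      then show ?thesis by blast
    qed
  qed
  then have "card {L \<in> ?A. passes L} \<le> card (?T2 \<union> (?T3 \<union> (?R PZ PI \<union> (?R PI PX \<union> (?R PZ PX \<union> ?I)))))"
    by (rule card_mono[rotated]) simp
  also have "\<dots> \<le> card ?T2 + (card ?T3 + (card (?R PZ PI) + (card (?R PI PX) + (card (?R PZ PX) + card ?I))))"
    by (intro order_trans[OF card_Un_le] add_left_mono order_refl)
  finally have "real (card {L \<in> ?A. passes L}) \<le> real (card ?T2) + (real (card ?T3) +
      (real (card (?R PZ PI)) + (real (card (?R PI PX)) + (real (card (?R PZ PX)) + real (card ?I)))))"
    by (simp only: of_nat_add[symmetric] of_nat_le_iff)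
  also have "\<dots> \<le> 2 * ?f * real (card ?A) + (2 * ?f * real (card ?A) +
      (1 / 2 ^ n * real (card ?A) + (1 / 2 ^ n * real (card ?A) + (1 / 2 ^ n * real (card ?A) +
        1 / 2 ^ w * real (card ?A)))))"
    by (intro add_mono T2 T3 R I) simp_all
  also have "\<dots> = (4 * ?f + 3 / 2 ^ n + 1 / 2 ^ w) * real (card ?A)"
    by (simp add: algebra_simps)
  finally show ?thesis .
qed

lemma mset_neq_identity:
  assumes "length P = N" "P \<noteq> pauli_id N"
  shows "mset P \<noteq> replicate_mset N PI"
proof
  assume "mset P = replicate_mset N PI"
  then have "set P \<subseteq> {PI}" by (metis set_mset_mset set_mset_replicate_mset_subset subsetI empty_iff)
  then have "P = replicate N PI" using assms(1) by (intro replicate_eqI) auto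
  with assms(2) show False by (simp add: pauli_id_def)
qed

lemma undetected_fraction_bound:
  assumes P: "P \<in> paulis (3 * n)" "P \<noteq> pauli_id (3 * n)"
    and w: "enat w \<le> min (code_distance n 1 E) (benign_distance n 1 E)"
  shows "undetected_fraction n E P \<le> 4 * max_benign_fraction n 1 E + 3 / 2 ^ n + 1 / 2 ^ w"
proof -
  let ?A = "permutations_of_multiset (mset P)"
  have len: "length P = 3 * n" using P by (simp add: paulis_def)
  have "0 < card ?A" by (simp add: card_gt_0_iff)
  then have "real (card {L \<in> ?A. passes L}) / real (card ?A) \<le>
      4 * max_benign_fraction n 1 E + 3 / 2 ^ n + 1 / 2 ^ w"
    using card_passes_le[OF _ mset_neq_identity[OF len P(2)] w] len by (simp add: pos_divide_le_eq)
  with undetected_fraction_le[OF len] show ?thesis by (rule order_trans)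
qed

text \<open>For \<open>n = 1\<close> the code is trivial and any fixed bound below \<open>1\<close> is negligible: an \<open>X\<close> or \<open>Y\<close> is
  caught by the second block, a \<open>Z\<close> by the third.\<close>

lemma undetected_fraction_less_1:
  assumes n: "n = 1" and P: "P \<in> paulis (3 * n)" "P \<noteq> pauli_id (3 * n)"
  shows "undetected_fraction n E P < 1"
proof -
  let ?A = "permutations_of_multiset (mset P)"
  have len: "length P = 3 * n" using P by (simp add: paulis_def)
  have C20: "C2 = {0\<^sub>v n}" using C2_trivial_iff n by blast
  have "\<exists>p<3. P ! p \<noteq> PI"
  proof (rule ccontr)
    assume "\<not> ?thesis"
    then have "P = replicate 3 PI" using len n by (intro nth_equalityI) auto
    with P n show False by (simp add: pauli_id_def)
  qed
  then obtain p where p: "p < 3" "P ! p \<noteq> PI" by blast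
  \<comment> \<open>A transposition brings the nonidentity letter to any chosen place
    \<open>j\<close>; at length \<open>1\<close> each place is a block by itself.\<close>
  have swap: "permute_list (transpose j p) P \<in> ?A \<and> permute_list (transpose j p) P ! j = P ! p"
    if "j < 3" for j
  proof -
    have t: "transpose j p permutes {..<length P}"
      using that p len n by (intro permutes_swap_id) auto
    then show ?thesis
      using that len n by (auto intro!: permutations_of_multisetI simp: permute_list_nth)
  qed
  \<comment> \<open>One rejected arrangement already makes the fraction of accepted ones smaller
    than \<open>1\<close>.\<close>
  have "\<exists>L\<in>?A. \<not> passes L"
  proof (cases "x_bit (P ! p) = 1")
    case True
    let ?L = "permute_list (transpose 1 p) P"
    have "take 1 (drop 1 ?L) = [?L ! 1]" using len n by (simp add: take_Suc_conv_app_nth)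
    then have "x_part (take n (drop n ?L)) $ 0 = x_bit (?L ! 1)" using n by (simp add: x_part_def)
    then have "x_part (take n (drop n ?L)) $ 0 = 1" using swap[of 1] True by simp
    then have "x_part (take n (drop n ?L)) \<noteq> 0\<^sub>v n" using n by auto
    then have "\<not> passes ?L" using C20 unfolding passes_def by blast
    with swap[of 1] show ?thesis by auto
  next
    case False
    then have z: "z_bit (P ! p) = 1" using p(2) by (cases "P ! p") simp_all
    let ?L = "permute_list (transpose 2 p) P"
    have "take 1 (drop 2 ?L) = [?L ! 2]"
      using len n Cons_nth_drop_Suc[of 2 ?L] by simp
    then have "z_part (take n (drop (2 * n) ?L)) $ 0 = z_bit (?L ! 2)" using n by (simp add: z_part_def)
    then have "z_part (take n (drop (2 * n) ?L)) $ 0 = 1" using swap[of 2] z by simp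
    then have "z_part (take n (drop (2 * n) ?L)) \<noteq> 0\<^sub>v n" using n by auto
    then have "\<not> passes ?L" using C20 unfolding passes_def by blast
    with swap[of 2] show ?thesis by auto
  qed
  then have "{L \<in> ?A. passes L} \<subset> ?A" by blast
  then have "card {L \<in> ?A. passes L} < card ?A" by (rule psubset_card_mono[rotated]) simp
  then have "real (card {L \<in> ?A. passes L}) / real (card ?A) < 1" by simp
  with undetected_fraction_le[OF len] show ?thesis by (rule le_less_trans)
qed

text \<open>A nonzero word of \<open>C2\<close> gives a benign X-type Pauli, and its type has at
  most \<open>4^n\<close> members. A lower bound in terms of \<open>n\<close> alone is what
  contradicts sparsity along bounded lengths other than \<open>1\<close>.\<close>

lemma max_benign_fraction_ge:
  assumes "n \<noteq> 1"
  shows "1 / 4 ^ n \<le> max_benign_fraction n 1 E"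
proof -
  obtain u where u: "u \<in> C2" "u \<noteq> 0\<^sub>v n" using C2_trivial_iff assms C2(2) by blast
  have uc: "u \<in> carrier_vec n" by (rule carrier2[OF u(1)])
  let ?B = "X_type u"
  have len: "length ?B = n" by (rule length_X_type[OF uc])
  have "x_part (pauli_id n) = 0\<^sub>v n" by (intro eq_vecI) (auto simp: x_part_def pauli_id_def)
  then have "?B \<noteq> pauli_id n" using x_part_X_type[OF uc] u(2) by auto
  then have ben: "benign n 1 E ?B"
    using u C2(2) x_part_X_type[OF uc] z_part_X_type[OF uc] by (intro benignI[OF len]) simp_all
  let ?A = "permutations_of_multiset (mset ?B)"
  have "?B \<in> {B. benign n 1 E B} \<inter> ?A" using ben by (auto intro: permutations_of_multisetI)
  then have "0 < card ({B. benign n 1 E B} \<inter> ?A)" by (auto simp: card_gt_0_iff)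
  then have "1 \<le> real (card ({B. benign n 1 E B} \<inter> ?A))" by simp
  also have "\<dots> \<le> max_benign_fraction n 1 E * real (card ?A)"
    by (rule card_benign_le) (simp add: len)
  finally have one: "1 \<le> max_benign_fraction n 1 E * real (card ?A)" .
  have pos: "0 < card ?A" by (simp add: card_gt_0_iff)
  have "?A \<subseteq> paulis n"
    using len by (auto simp: paulis_def dest!: permutations_of_multisetD mset_eq_length)
  then have "card ?A \<le> 4 ^ n" using card_mono[OF finite_paulis] card_paulis_le le_trans by blast
  then have "real (card ?A) \<le> 4 ^ n" by (simp only: of_nat_le_iff[symmetric, where 'a = real]) simp
  then have "1 / 4 ^ n \<le> 1 / real (card ?A)" using pos by (intro divide_left_mono) simp_all
  also have "\<dots> \<le> max_benign_fraction n 1 E" using one pos by (simp add: pos_divide_le_eq)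
  finally show ?thesis .
qed

end

section \<open>Asymptotics\<close>

text \<open>\<open>2 powr (- (C * sqrt m))\<close> decays faster than every power of
  \<open>m\<close>. The bound asks for half of \<open>1 / m^c\<close>, leaving the other half to the
  benign term.\<close>

lemma eventually_trap_bound_less:
  assumes "0 < C"
  shows "\<forall>\<^sub>F m in sequentially.
    3 / 2 ^ m + 2 * 2 powr (- (C * sqrt (real m))) < 1 / (2 * real m ^ c)"
proof -
  have "(\<lambda>m. (3 / 2 ^ m + 2 * 2 powr (- (C * sqrt (real m)))) * (2 * real m ^ c)) \<longlonglongrightarrow> 0"
    using assms by real_asymp
  then have "\<forall>\<^sub>F m in sequentially.
      (3 / 2 ^ m + 2 * 2 powr (- (C * sqrt (real m)))) * (2 * real m ^ c) < 1"
    by (rule order_tendstoD) simp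
  with eventually_gt_at_top[of 0] show ?thesis
    by eventually_elim (simp add: pos_less_divide_eq)
qed

lemma weight_bound:
  assumes "0 < C"
    and dist: "\<forall>\<^sub>F i in sequentially. C * sqrt (real (n i)) \<le> real (d i)"
    and benign: "\<forall>\<^sub>F i in sequentially. ereal (C * sqrt (real (n i))) \<le> ereal_of_enat (b i)"
  shows "\<forall>\<^sub>F i in sequentially. enat (nat \<lfloor>C * sqrt (real (n i))\<rfloor>) \<le> min (enat (d i)) (b i)"
  using dist benign
proof eventually_elim
  case (elim i)
  let ?w = "nat \<lfloor>C * sqrt (real (n i))\<rfloor>"
  have w: "real ?w \<le> C * sqrt (real (n i))" using assms(1) by simp
  have "enat ?w \<le> enat (d i)" using w elim(1) by simp
  moreover have "enat ?w \<le> b i"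
  proof (cases "b i")
    case (enat m)
    then have "C * sqrt (real (n i)) \<le> real m" using elim(2) by simp
    then show ?thesis using w enat by simp
  qed simp
  ultimately show ?case by simp
qed

text \<open>Rounding the exponent down loses at most one, hence the factor \<open>2\<close>.\<close>

lemma inverse_power_floor_le:
  fixes x :: real
  assumes "0 \<le> x"
  shows "1 / 2 ^ nat \<lfloor>x\<rfloor> \<le> 2 * 2 powr (- x)"
proof -
  have "x - 1 \<le> real (nat \<lfloor>x\<rfloor>)" using assms by linarith
  then have "2 powr (x - 1) \<le> 2 powr real (nat \<lfloor>x\<rfloor>)" by (rule powr_mono) simp
  then have "2 powr x / 2 \<le> 2 ^ nat \<lfloor>x\<rfloor>" by (simp add: powr_diff powr_realpow)
  then show ?thesis by (simp add: powr_minus divide_simps mult.commute)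
qed

theorem theorem13:
  fixes n d :: "nat \<Rightarrow> nat"
    and C1 C2 :: "nat \<Rightarrow> bit vec set"
    and E :: "nat \<Rightarrow> complex mat"
  assumes css: "\<And>i. weakly_self_dual_css (n i) 1 (C1 i) (C2 i) (E i)"
    and dist: "\<And>i. code_distance (n i) 1 (E i) = enat (d i)"
    and dist_omega: "(\<lambda>i. real (d i)) \<in> \<Omega>(\<lambda>i. sqrt (real (n i)))"
    and benign_omega:
      "enat_bigomega (\<lambda>i. benign_distance (n i) 1 (E i)) (\<lambda>i. sqrt (real (n i)))"
    and sparse: "weight_sparse n 1 E"
  shows "\<exists>\<epsilon>. negligible_in \<epsilon> n \<and>
    (\<forall>i. strong_purity_testing 1 (3 * n i - 1) {k. k permutes {..<3 * n i}}
           (strong_trap_code (n i) (E i)) (\<epsilon> i))"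
proof -
  have W: "weakly_self_dual (n i) (C1 i) (C2 i) (E i)" for i
    by unfold_locales (rule css)
  have n: "1 \<le> n i" and uE: "unitary_mat (2 ^ n i) (E i)" for i
    using weakly_self_dual.n_pos[OF W] weakly_self_dual.unitary_E[OF W] by blast+
  have tot: "1 + (3 * n i - 1) = 3 * n i" for i using n[of i] by simp
  define f where "f i = max_benign_fraction (n i) 1 (E i)" for i
  define S where "S i = paulis (3 * n i) - {pauli_id (3 * n i)}" for i
  \<comment> \<open>The maximum is attained, so the strict bound for each Pauli at length
    \<open>1\<close> survives; there \<open>1 / real (n i) ^ c = 1\<close>, and strictness is
    exactly what negligibility asks.\<close>
  define \<epsilon> where "\<epsilon> i = Max (undetected_fraction (n i) (E i) ` S i)" for i
  have finS: "finite (S i)" for i by (simp add: S_def)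
  \<comment> \<open>Any nonidentity Pauli would do; \<open>Max\<close> needs a nonempty set.\<close>
  have "replicate (3 * n i) PX \<in> S i" for i
    using n[of i] by (auto simp: S_def paulis_def pauli_id_def)
  then have neS: "S i \<noteq> {}" for i by blast
  have \<epsilon>_attained: "\<exists>P. P \<in> paulis (3 * n i) \<and> P \<noteq> pauli_id (3 * n i) \<and>
      \<epsilon> i = undetected_fraction (n i) (E i) P" for i
    using Max_in[of "undetected_fraction (n i) (E i) ` S i"] finS neS unfolding \<epsilon>_def S_def by blast

  have spt: "strong_purity_testing 1 (3 * n i - 1) {k. k permutes {..<3 * n i}}
      (strong_trap_code (n i) (E i)) (\<epsilon> i)" for i
    unfolding strong_purity_testing_def tot
  proof (intro conjI ballI)
    show "finite {k. k permutes {..<3 * n i}}" by (simp add: finite_permutations)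
    show "{k. k permutes {..<3 * n i}} \<noteq> {}" using permutes_id by blast
    show "is_code (3 * n i) 1 (strong_trap_code (n i) (E i) k)" if "k \<in> {k. k permutes {..<3 * n i}}" for k
      using unitary_strong_trap_code[OF uE n] that n[of i] by (simp add: is_code_def)
    fix P assume "P \<in> paulis (3 * n i) - {pauli_id (3 * n i)}"
    then show "real (card {k \<in> {k. k permutes {..<3 * n i}}. \<exists>Q\<in>paulis 1. \<exists>R\<in>paulis (3 * n i - 1).
        set R \<subseteq> {PI, PZ} \<and>
        eq_up_to_phase (mat_adjoint (strong_trap_code (n i) (E i) k) * pauli_mat P *
          strong_trap_code (n i) (E i) k) (pauli_mat (Q @ R))}) /
        real (card {k. k permutes {..<3 * n i}}) \<le> \<epsilon> i"
      unfolding \<epsilon>_def undetected_fraction_def[symmetric] using finS[of i]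
      by (intro Max_ge finite_imageI imageI) (simp_all add: S_def)
  qed

  have trivial: "\<epsilon> i < 1" if "n i = 1" for i
    using \<epsilon>_attained[of i] weakly_self_dual.undetected_fraction_less_1[OF W that] by metis
  have bound: "\<epsilon> i \<le> 4 * f i + 3 / 2 ^ n i + 1 / 2 ^ w"
    if "enat w \<le> min (enat (d i)) (benign_distance (n i) 1 (E i))" for i w
    using \<epsilon>_attained[of i] weakly_self_dual.undetected_fraction_bound[OF W, of _ i w] that
    unfolding dist[of i] f_def by metis
  have f_ge: "1 / 4 ^ n i \<le> f i" if "n i \<noteq> 1" for i
    using weakly_self_dual.max_benign_fraction_ge[OF W that] by (simp add: f_def)
  have f_less: "\<forall>\<^sub>F i in sequentially. f i < 1 / real (n i) ^ c" for c
    using sparse unfolding weight_sparse_def negligible_in_def f_def eventually_sequentially by blast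

  obtain A where A: "0 < A" "\<forall>\<^sub>F i in sequentially. A * sqrt (real (n i)) \<le> real (d i)"
    using dist_omega by (auto elim!: landau_omega.bigE)
  obtain B where B: "0 < B"
    "\<forall>\<^sub>F i in sequentially. ereal (B * sqrt (real (n i))) \<le> ereal_of_enat (benign_distance (n i) 1 (E i))"
    using benign_omega by (auto simp: enat_bigomega_def)
  \<comment> \<open>A common constant serves both distance bounds, since the weight must lie below
    their minimum.\<close>
  define C where "C = min A B"
  have C: "0 < C" using A B by (simp add: C_def)
  have CA: "C * sqrt (real m) \<le> A * sqrt (real m)" and CB: "C * sqrt (real m) \<le> B * sqrt (real m)" for m
    by (intro mult_right_mono; simp add: C_def)+
  have w: "\<forall>\<^sub>F i in sequentially. enat (nat \<lfloor>C * sqrt (real (n i))\<rfloor>) \<le>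
      min (enat (d i)) (benign_distance (n i) 1 (E i))"
  proof (rule weight_bound[OF C])
    show "\<forall>\<^sub>F i in sequentially. C * sqrt (real (n i)) \<le> real (d i)"
      using A(2) by eventually_elim (rule order_trans[OF CA])
    show "\<forall>\<^sub>F i in sequentially. ereal (C * sqrt (real (n i))) \<le>
        ereal_of_enat (benign_distance (n i) 1 (E i))"
      using B(2) by eventually_elim (rule order_trans[rotated], assumption, use CB in simp)
  qed

  have "\<forall>\<^sub>F i in sequentially. \<epsilon> i < 1 / real (n i) ^ c" for c
  proof -
    \<comment> \<open>\<open>N\<close> is a threshold for the block length, not for the index
      \<open>i\<close>; lengths from \<open>2\<close> up to \<open>N\<close> are excluded
      separately.\<close>
    obtain N where N: "\<And>m. m \<ge> N \<Longrightarrow>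
        3 / 2 ^ m + 2 * 2 powr (- (C * sqrt (real m))) < 1 / (2 * real m ^ c)"
      using eventually_trap_bound_less[OF C] unfolding eventually_sequentially by blast
    \<comment> \<open>Exponent \<open>c + 3\<close> makes \<open>4 * f i\<close> at most half of
      \<open>1 / n^c\<close>, since \<open>n^3 \<ge> 8\<close> for \<open>n \<ge> 2\<close>.
      Exponent \<open>2 * N\<close> gives \<open>f i < 1 / 4^N\<close>, which \<open>f_ge\<close>
      refutes when \<open>n < N\<close>.\<close>
    show ?thesis
      using f_less[of "c + 3"] f_less[of "2 * N"] w
    proof eventually_elim
      case (elim i)
      show ?case
      proof (cases "n i = 1")
        case True
        then show ?thesis using trivial[OF True] by simp
      next
        case False
        then have n2: "2 \<le> n i" using n[of i] by simp
        \<comment> \<open>A nontrivial code has a benign Pauli, so sparsity excludes bounded block lengths.\<close>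
        have "N \<le> n i"
        proof (rule ccontr)
          assume "\<not> N \<le> n i"
          then have "(4::real) ^ n i \<le> 4 ^ N" by (intro power_increasing) simp_all
          also have "\<dots> = 2 ^ (2 * N)" by (simp add: power_mult)
          also have "\<dots> \<le> real (n i) ^ (2 * N)" using n2 by (intro power_mono) simp_all
          finally have "1 / real (n i) ^ (2 * N) \<le> 1 / 4 ^ n i"
            using n2 by (intro divide_left_mono) simp_all
          with f_ge[OF False] elim(2) show False by linarith
        qed
        note Nn = N[OF this]
        let ?x = "C * sqrt (real (n i))"
        have "1 / 2 ^ nat \<lfloor>?x\<rfloor> \<le> 2 * 2 powr (- ?x)"
          using C by (intro inverse_power_floor_le) simp
        with bound[OF elim(3)] Nn have "\<epsilon> i < 4 * f i + 1 / (2 * real (n i) ^ c)" by linarith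
        also have "4 * f i \<le> 1 / (2 * real (n i) ^ c)"
        proof -
          have "(8::real) = 2 ^ 3" by simp
          also have "\<dots> \<le> real (n i) ^ 3" using n2 by (intro power_mono) simp_all
          finally have "8 * real (n i) ^ c \<le> real (n i) ^ (c + 3)"
            using n2 by (simp add: power_add mult.commute)
          then have "1 / real (n i) ^ (c + 3) \<le> 1 / (8 * real (n i) ^ c)"
            using n2 by (intro divide_left_mono) simp_all
          with elim(1) have "4 * f i \<le> 4 * (1 / (8 * real (n i) ^ c))" by linarith
          then show ?thesis by simp
        qed
        finally show ?thesis by simp
      qed
    qed
  qed
  then have "negligible_in \<epsilon> n"
    unfolding negligible_in_def eventually_sequentially by blast
  with spt show ?thesis by blast
qed

end
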